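(* Let $K$ be a field of characteristic $0$, let $d\geq 2$, and let $\delta$ be a Weitzenböck derivation of the free metabelian Lie algebra $L_d/L_d''$ over $K$. Then the vector space $(L_d'/L_d'')^{\delta}=\{u\in L_d'/L_d''\mid \delta(u)=0\}$ of the constants of $\delta$ in the commutator ideal $L_d'/L_d''$ of $L_d/L_d''$ is a finitely generated $K[X_d]^{\delta}$-module.
   Context: $X_d=\{x_1,\ldots,x_d\}$; $KX_d$ is the $K$-vector space with basis $X_d$; $K[X_d]=K[x_1,\ldots,x_d]$ is the polynomial algebra. $L_d$ is the free Lie algebra over $K$ freely generated by $X_d$, $L_d'=[L_d,L_d]$, $L_d''=[L_d',L_d']$, and $L_d/L_d''$ is the free metabelian Lie algebra; its free generators (the images of the $x_j$) are denoted by the same symbols $x_1,\ldots,x_d$. A derivation of an algebra $R$ is a $K$-linear map $\delta:R\to R$ with $\delta(uv)=\delta(u)v+u\delta(v)$ (with the Lie bracket as product in the Lie case). Every nonzero nilpotent linear operator $\delta$ of $KX_d$ extends uniquely to a derivation of $L_d/L_d''$ and uniquely to a derivation of $K[X_d]$; these derivations are called Weitzenböck derivations, and both are denoted by the same symbol $\delta$. $K[X_d]^{\delta}=\{f\in K[X_d]\mid\delta(f)=0\}$ is the algebra of constants. Module structure: $L_d'/L_d''$ is a (right) $K[X_d]$-module via $u\,f(x_1,\ldots,x_d)=u\,f(\mathrm{ad}\,x_1,\ldots,\mathrm{ad}\,x_d)$, where $u\,\mathrm{ad}\,x_j=[u,x_j]$, $u\in L_d'/L_d''$, $f\in K[X_d]$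 (this is well defined since the operators $\mathrm{ad}\,x_j$ commute on $L_d'/L_d''$). The subspace $(L_d'/L_d'')^{\delta}$ is a $K[X_d]^{\delta}$-module under the restriction of this action. *)

theory Defs
  imports "HOL-Analysis.Cartesian_Space" "HOL-Library.Poly_Mapping"
begin

section \<open>Algebras over a field\<close>

text \<open>
  Throughout, \<open>'k\<close> is the ground field and \<open>'n\<close> a finite linearly ordered index type with
  \<open>d = CARD('n)\<close>, so that \<open>x\<^sub>1, \<dots>, x\<^sub>d\<close> are indexed by \<open>'n\<close>. The vector space \<open>K X\<^sub>d\<close> is
  \<open>'k ^ 'n\<close> with scalar multiplication \<open>*s\<close> and basis \<open>axis j 1\<close>.
\<close>

definition derivation ::
    "('k::field \<Rightarrow> 'a::ab_group_add \<Rightarrow> 'a) \<Rightarrow> ('a \<Rightarrow> 'a \<Rightarrow> 'a) \<Rightarrow> ('a \<Rightarrow> 'a) \<Rightarrow> bool"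
  where "derivation sc mult \<delta> \<longleftrightarrow>
    Vector_Spaces.linear sc sc \<delta> \<and> (\<forall>u v. \<delta> (mult u v) = mult (\<delta> u) v + mult u (\<delta> v))"

locale lie_algebra = vector_space scale
  for scale :: "'k::field \<Rightarrow> 'a::ab_group_add \<Rightarrow> 'a" +
  fixes bracket :: "'a \<Rightarrow> 'a \<Rightarrow> 'a"
  assumes bracket_add_left: "bracket (x + y) z = bracket x z + bracket y z"
    and bracket_add_right: "bracket x (y + z) = bracket x y + bracket x z"
    and bracket_scale_left: "bracket (scale c x) y = scale c (bracket x y)"
    and bracket_scale_right: "bracket x (scale c y) = scale c (bracket x y)"
    and bracket_self: "bracket x x = 0"
    and jacobi: "bracket (bracket x y) z + bracket (bracket y z) x + bracket (bracket z x) y = 0"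
begin

definition commutator :: "'a set \<Rightarrow> 'a set \<Rightarrow> 'a set"
  where "commutator A B = span {bracket a b | a b. a \<in> A \<and> b \<in> B}"

abbreviation derived :: "'a set" where "derived \<equiv> commutator UNIV UNIV"
abbreviation derived2 :: "'a set" where "derived2 \<equiv> commutator derived derived"

lemma bracket_zero_left: "bracket 0 y = 0"
  using bracket_add_left[of 0 0 y] by simp

lemma bracket_zero_right: "bracket y 0 = 0"
  using bracket_add_right[of y 0 0] by simp

lemma bracket_anti: "bracket x y = - bracket y x"
proof -
  have "bracket (x + y) (x + y) = bracket x y + bracket y x"
    by (simp add: bracket_add_left bracket_add_right bracket_self[of x] bracket_self[of y])
  then have "bracket x y + bracket y x = 0" by (metis bracket_self)
  then show ?thesis by (simp only: eq_neg_iff_add_eq_0)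
qed

lemma bracket_minus_right: "bracket x (- y) = - bracket x y"
  using bracket_add_right[of x y "- y"] by (simp add: bracket_zero_right minus_unique)

lemma bracket_minus_left: "bracket (- x) y = - bracket x y"
  by (metis bracket_anti bracket_minus_right)

lemma bracket_diff_right: "bracket x (y - z) = bracket x y - bracket x z"
  by (simp only: diff_conv_add_uminus bracket_add_right bracket_minus_right)

lemma bracket_diff_left: "bracket (x - y) z = bracket x z - bracket y z"
  by (simp only: diff_conv_add_uminus bracket_add_left bracket_minus_left)

lemma subspace_commutator: "subspace (commutator A B)"
  by (simp add: commutator_def)

lemma bracket_in_commutator: "a \<in> A \<Longrightarrow> b \<in> B \<Longrightarrow> bracket a b \<in> commutator A B"
  unfolding commutator_def by (rule span_base) auto

lemma bracket_jacobi_left: "bracket (bracket a b) z = bracket (bracket a z) b + bracket a (bracket b z)"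
proof -
  have 1: "bracket (bracket z a) b = - bracket (bracket a z) b"
    by (metis bracket_anti bracket_minus_left)
  have 2: "bracket (bracket b z) a = - bracket a (bracket b z)"
    by (rule bracket_anti)
  from jacobi[of a b z] have "bracket (bracket a b) z = - (bracket (bracket b z) a + bracket (bracket z a) b)"
    by (simp only: eq_neg_iff_add_eq_0 add.assoc)
  then show ?thesis unfolding 1 2 by simp
qed

lemma derived2_bracket_left:
  assumes "x \<in> derived2" shows "bracket x y \<in> derived2"
  using assms unfolding commutator_def[of derived derived]
proof (induction rule: span_induct_alt)
  case base
  show ?case by (simp add: bracket_zero_left span_zero)
next
  case (step c x z)
  then obtain a b where x: "x = bracket a b" and ab: "a \<in> derived" "b \<in> derived" by blast
  have "bracket (bracket a y) b \<in> derived2" "bracket a (bracket b y) \<in> derived2"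
    by (intro bracket_in_commutator ab UNIV_I)+
  then have "bracket x y \<in> derived2"
    by (simp add: x bracket_jacobi_left[of a b y] subspace_add subspace_commutator)
  with step show ?case
    unfolding commutator_def[of derived derived]
    by (simp add: bracket_add_left bracket_scale_left span_add span_scale)
qed

lemma derived2_bracket_right: "x \<in> derived2 \<Longrightarrow> bracket y x \<in> derived2"
  by (metis bracket_anti derived2_bracket_left subspace_commutator subspace_neg)

end


context vector_space
begin

lemma equivp_subspace:
  assumes "subspace S" shows "equivp (\<lambda>u v. u - v \<in> S)"
proof (intro equivpI reflpI sympI transpI)
  show "u - u \<in> S" for u using assms by (simp add: subspace_0)
  show "v - u \<in> S" if "u - v \<in> S" for u v
    using subspace_neg[OF assms that] by simp
  show "u - w \<in> S" if "u - v \<in> S" "v - w \<in> S" for u v w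
    using subspace_add[OF assms that] by simp
qed

lemma subspace_cong:
  assumes "subspace S"
  shows "u - u' \<in> S \<Longrightarrow> v - v' \<in> S \<Longrightarrow> (u + v) - (u' + v') \<in> S"
    and "u - u' \<in> S \<Longrightarrow> v - v' \<in> S \<Longrightarrow> (u - v) - (u' - v') \<in> S"
    and "u - u' \<in> S \<Longrightarrow> (- u) - (- u') \<in> S"
    and "u - u' \<in> S \<Longrightarrow> scale c u - scale c u' \<in> S"
proof -
  show "u - u' \<in> S \<Longrightarrow> v - v' \<in> S \<Longrightarrow> (u + v) - (u' + v') \<in> S"
    using subspace_add[OF assms, of "u - u'" "v - v'"] by (simp only: add_diff_add)
  have eq: "(u - v) - (u' - v') = (u - u') - (v - v')" by (simp add: algebra_simps)
  show "u - u' \<in> S \<Longrightarrow> v - v' \<in> S \<Longrightarrow> (u - v) - (u' - v') \<in> S"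
    unfolding eq by (rule subspace_diff[OF assms])
  show "u - u' \<in> S \<Longrightarrow> (- u) - (- u') \<in> S"
    using subspace_neg[OF assms, of "u - u'"] by simp
  show "u - u' \<in> S \<Longrightarrow> scale c u - scale c u' \<in> S"
    using subspace_scale[OF assms, of "u - u'" c] by (simp only: scale_right_diff_distrib)
qed

end


section \<open>Finitely supported functions\<close>

definition pm_scale :: "'k::field \<Rightarrow> ('a \<Rightarrow>\<^sub>0 'k) \<Rightarrow> ('a \<Rightarrow>\<^sub>0 'k)"
  where "pm_scale c p = Poly_Mapping.map ((*) c) p"

lemma lookup_pm_scale [simp]: "Poly_Mapping.lookup (pm_scale c p) t = c * Poly_Mapping.lookup p t"
  unfolding pm_scale_def by transfer (auto simp: when_def)

interpretation pm: vector_space "pm_scale :: 'k::field \<Rightarrow> ('a \<Rightarrow>\<^sub>0 'k) \<Rightarrow> _"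
  by unfold_locales (auto intro!: poly_mapping_eqI simp: lookup_add algebra_simps)

text \<open>The linear map on the vector space with basis \<open>'a\<close> that sends \<open>t\<close> to \<open>b t\<close>.\<close>

definition linear_extension ::
    "('k::field \<Rightarrow> 'b::ab_group_add \<Rightarrow> 'b) \<Rightarrow> ('a \<Rightarrow> 'b) \<Rightarrow> ('a \<Rightarrow>\<^sub>0 'k) \<Rightarrow> 'b"
  where "linear_extension sc b p = (\<Sum>t \<in> Poly_Mapping.keys p. sc (Poly_Mapping.lookup p t) (b t))"

context vector_space
begin

lemma linear_extension_superset:
  assumes "finite A" "Poly_Mapping.keys p \<subseteq> A"
  shows "linear_extension scale b p = (\<Sum>t\<in>A. scale (Poly_Mapping.lookup p t) (b t))"
  unfolding linear_extension_def
  by (rule sum.mono_neutral_left) (use assms in \<open>auto simp: in_keys_iff\<close>)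

lemma linear_extension_add:
  "linear_extension scale b (p + q) = linear_extension scale b p + linear_extension scale b q"
proof -
  let ?A = "Poly_Mapping.keys p \<union> Poly_Mapping.keys q"
  have "Poly_Mapping.keys (p + q) \<subseteq> ?A" by (rule keys_add)
  then show ?thesis
    by (simp add: linear_extension_superset[of ?A] lookup_add scale_left_distrib sum.distrib)
qed

lemma linear_extension_scale:
  "linear_extension scale b (pm_scale c p) = scale c (linear_extension scale b p)"
proof -
  have "Poly_Mapping.keys (pm_scale c p) \<subseteq> Poly_Mapping.keys p" by (auto simp: in_keys_iff)
  then show ?thesis
    by (simp add: linear_extension_superset[of "Poly_Mapping.keys p"] scale_sum_right)
qed

lemma linear_extension_single [simp]:
  "linear_extension scale b (Poly_Mapping.single t c) = scale c (b t)"
  by (simp add: linear_extension_def)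

lemma linear_extension_add_fun:
  "linear_extension scale (\<lambda>t. b t + b' t) p = linear_extension scale b p + linear_extension scale b' p"
  by (simp add: linear_extension_def scale_right_distrib sum.distrib)

lemma linear_extension_scale_fun:
  "linear_extension scale (\<lambda>t. scale c (b t)) p = scale c (linear_extension scale b p)"
  by (simp add: linear_extension_def scale_sum_right mult.commute)

end


section \<open>The free Lie algebra\<close>

text \<open>
  The free Lie algebra is the free nonassociative algebra, whose basis is the free magma, modulo
  the ideal generated by all \<open>u u\<close> and all \<open>(u v) w + (v w) u + (w u) v\<close>.
\<close>

datatype 'n magma = Gen 'n | Mul "'n magma" "'n magma"

definition na_mult :: "('n magma \<Rightarrow>\<^sub>0 'k::field) \<Rightarrow> ('n magma \<Rightarrow>\<^sub>0 'k) \<Rightarrow> ('n magma \<Rightarrow>\<^sub>0 'k)"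
  where "na_mult u v =
    linear_extension pm_scale (\<lambda>s. linear_extension pm_scale (\<lambda>t. Poly_Mapping.single (Mul s t) 1) v) u"

lemma na_mult_add_left: "na_mult (u + v) w = na_mult u w + na_mult v w"
  and na_mult_add_right: "na_mult u (v + w) = na_mult u v + na_mult u w"
  and na_mult_scale_left: "na_mult (pm_scale c u) w = pm_scale c (na_mult u w)"
  and na_mult_scale_right: "na_mult u (pm_scale c w) = pm_scale c (na_mult u w)"
  unfolding na_mult_def
  by (simp_all add: pm.linear_extension_add pm.linear_extension_scale
      pm.linear_extension_add_fun pm.linear_extension_scale_fun)

inductive_set lie_relations :: "('n magma \<Rightarrow>\<^sub>0 'k::field) set" where
  square: "na_mult u u \<in> lie_relations"
| jacobi: "na_mult (na_mult u v) w + na_mult (na_mult v w) u + na_mult (na_mult w u) v \<in> lie_relations"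
| zero: "0 \<in> lie_relations"
| add: "u \<in> lie_relations \<Longrightarrow> v \<in> lie_relations \<Longrightarrow> u + v \<in> lie_relations"
| scale: "u \<in> lie_relations \<Longrightarrow> pm_scale c u \<in> lie_relations"
| mult_left: "u \<in> lie_relations \<Longrightarrow> na_mult w u \<in> lie_relations"
| mult_right: "u \<in> lie_relations \<Longrightarrow> na_mult u w \<in> lie_relations"

lemma subspace_lie_relations: "pm.subspace lie_relations"
  by (auto simp: pm.subspace_def intro: lie_relations.intros)

quotient_type (overloaded) ('n, 'k) free_lie = "'n magma \<Rightarrow>\<^sub>0 'k::field" / "\<lambda>u v. u - v \<in> lie_relations"
  by (rule pm.equivp_subspace[OF subspace_lie_relations])

instantiation free_lie :: (type, field) ab_group_add
begin

lift_definition zero_free_lie :: "('a, 'b) free_lie" is 0 .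

lift_definition plus_free_lie :: "('a, 'b) free_lie \<Rightarrow> ('a, 'b) free_lie \<Rightarrow> ('a, 'b) free_lie" is "(+)"
  by (rule pm.subspace_cong(1)[OF subspace_lie_relations])

lift_definition uminus_free_lie :: "('a, 'b) free_lie \<Rightarrow> ('a, 'b) free_lie" is uminus
  by (rule pm.subspace_cong(3)[OF subspace_lie_relations])

lift_definition minus_free_lie :: "('a, 'b) free_lie \<Rightarrow> ('a, 'b) free_lie \<Rightarrow> ('a, 'b) free_lie" is "(-)"
  by (rule pm.subspace_cong(2)[OF subspace_lie_relations])

instance
  by (standard; transfer) (simp_all add: lie_relations.zero algebra_simps)

end

lift_definition fl_scale :: "'k::field \<Rightarrow> ('n, 'k) free_lie \<Rightarrow> ('n, 'k) free_lie" is pm_scale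
  by (rule pm.subspace_cong(4)[OF subspace_lie_relations])

lift_definition fl_bracket :: "('n, 'k::field) free_lie \<Rightarrow> ('n, 'k) free_lie \<Rightarrow> ('n, 'k) free_lie"
  is na_mult
proof -
  fix a b c d :: "'n magma \<Rightarrow>\<^sub>0 'k"
  assume *: "a - b \<in> lie_relations" "c - d \<in> lie_relations"
  have "na_mult a c = na_mult (a - b) c + na_mult b c"
    and "na_mult b c = na_mult b (c - d) + na_mult b d"
    by (simp_all only: diff_add_cancel flip: na_mult_add_left na_mult_add_right)
  then have "na_mult a c - na_mult b d = na_mult (a - b) c + na_mult b (c - d)" by simp
  with * show "na_mult a c - na_mult b d \<in> lie_relations"
    by (simp only: lie_relations.add lie_relations.mult_left lie_relations.mult_right)
qed

lift_definition fl_gen :: "'n \<Rightarrow> ('n, 'k::field) free_lie" is "\<lambda>j. Poly_Mapping.single (Gen j) 1" .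

interpretation fl: lie_algebra "fl_scale :: 'k::field \<Rightarrow> ('n, 'k) free_lie \<Rightarrow> _" fl_bracket
  by (unfold_locales; transfer)
    (simp_all add: pm.scale_left_distrib pm.scale_right_distrib lie_relations.zero
      na_mult_add_left na_mult_add_right na_mult_scale_left na_mult_scale_right
      lie_relations.square lie_relations.jacobi)


section \<open>The free metabelian Lie algebra\<close>

quotient_type (overloaded) ('n, 'k) free_metabelian =
    "('n, 'k::field) free_lie" / "\<lambda>u v. u - v \<in> fl.derived2"
  morphisms rep_fm fm_proj
  by (rule fl.equivp_subspace[OF fl.subspace_commutator])

instantiation free_metabelian :: (type, field) ab_group_add
begin

lift_definition zero_free_metabelian :: "('a, 'b) free_metabelian" is 0 .

lift_definition plus_free_metabelian ::
    "('a, 'b) free_metabelian \<Rightarrow> ('a, 'b) free_metabelian \<Rightarrow> ('a, 'b) free_metabelian" is "(+)"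
  by (rule fl.subspace_cong(1)[OF fl.subspace_commutator])

lift_definition uminus_free_metabelian ::
    "('a, 'b) free_metabelian \<Rightarrow> ('a, 'b) free_metabelian" is uminus
  by (rule fl.subspace_cong(3)[OF fl.subspace_commutator])

lift_definition minus_free_metabelian ::
    "('a, 'b) free_metabelian \<Rightarrow> ('a, 'b) free_metabelian \<Rightarrow> ('a, 'b) free_metabelian" is "(-)"
  by (rule fl.subspace_cong(2)[OF fl.subspace_commutator])

instance
  by (standard; transfer) (simp_all add: fl.subspace_0 fl.subspace_commutator algebra_simps)

end

lift_definition fm_scale ::
    "'k::field \<Rightarrow> ('n, 'k) free_metabelian \<Rightarrow> ('n, 'k) free_metabelian" is fl_scale
  by (rule fl.subspace_cong(4)[OF fl.subspace_commutator])

lift_definition fm_bracket ::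
    "('n, 'k::field) free_metabelian \<Rightarrow> ('n, 'k) free_metabelian \<Rightarrow> ('n, 'k) free_metabelian"
  is fl_bracket
proof -
  fix a b c d :: "('n, 'k) free_lie"
  assume *: "a - b \<in> fl.derived2" "c - d \<in> fl.derived2"
  have "fl_bracket a c - fl_bracket b d = fl_bracket (a - b) c + fl_bracket b (c - d)"
    by (simp add: fl.bracket_diff_left fl.bracket_diff_right)
  with * show "fl_bracket a c - fl_bracket b d \<in> fl.derived2"
    by (simp add: fl.subspace_add fl.subspace_commutator
        fl.derived2_bracket_left fl.derived2_bracket_right)
qed

lift_definition fm_gen :: "'n \<Rightarrow> ('n, 'k::field) free_metabelian" is fl_gen .

interpretation fm: lie_algebra "fm_scale :: 'k::field \<Rightarrow> ('n, 'k) free_metabelian \<Rightarrow> _" fm_bracket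
  by (unfold_locales; transfer)
    (simp_all add: fl.scale_left_distrib fl.scale_right_distrib fl.subspace_0 fl.subspace_commutator
      fl.bracket_add_left fl.bracket_add_right fl.bracket_scale_left fl.bracket_scale_right
      fl.bracket_self fl.jacobi)

text \<open>\<open>L\<^sub>d' / L\<^sub>d''\<close> as a subspace of \<open>L\<^sub>d / L\<^sub>d''\<close>; it is the commutator ideal of \<open>L\<^sub>d / L\<^sub>d''\<close>.\<close>

definition fm_commutator_ideal :: "('n, 'k::field) free_metabelian set"
  where "fm_commutator_ideal = fm_proj ` fl.derived"

lemma fm_proj_simps:
  "fm_proj 0 = 0" "fm_proj (u + v) = fm_proj u + fm_proj v"
  "fm_proj (fl_scale c u) = fm_scale c (fm_proj u)"
  "fm_proj (fl_bracket u v) = fm_bracket (fm_proj u) (fm_proj v)"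
  by (simp_all add: zero_free_metabelian.abs_eq plus_free_metabelian.abs_eq
      fm_scale.abs_eq fm_bracket.abs_eq)

lemma module_hom_fm_proj: "module_hom fl_scale fm_scale fm_proj"
  by unfold_locales (simp_all add: fm_proj_simps)

lemma fm_proj_surj: "\<exists>v. u = fm_proj v"
  by (rule exI[of _ "rep_fm u"], rule Quotient3_abs_rep[OF Quotient3_free_metabelian, symmetric])

lemma fm_commutator_ideal_eq:
  "(fm_commutator_ideal :: ('n, 'k::field) free_metabelian set) = fm.derived"
proof -
  let ?A = "{fl_bracket a b | a b :: ('n, 'k) free_lie. a \<in> UNIV \<and> b \<in> UNIV}"
  have "fm_bracket a b \<in> fm_proj ` ?A" for a b
  proof -
    obtain a' b' where "a = fm_proj a'" "b = fm_proj b'" using fm_proj_surj by blast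
    then have "fm_bracket a b = fm_proj (fl_bracket a' b')" by (simp only: fm_proj_simps)
    then show ?thesis by blast
  qed
  then have "{fm_bracket a b | a b. a \<in> UNIV \<and> b \<in> UNIV} \<subseteq> fm_proj ` ?A" by blast
  moreover have "fm_proj ` ?A \<subseteq> {fm_bracket a b | a b. a \<in> UNIV \<and> b \<in> UNIV}"
    using fm_proj_simps(4) by blast
  ultimately have "{fm_bracket a b | a b. a \<in> UNIV \<and> b \<in> UNIV} = fm_proj ` ?A"
    by (rule subset_antisym)
  then show ?thesis
    by (simp add: fm_commutator_ideal_def fl.commutator_def fm.commutator_def
        module_hom.span_image[OF module_hom_fm_proj])
qed

lemma fm_metabelian:
  assumes "u \<in> fm_commutator_ideal" "v \<in> fm_commutator_ideal"
  shows "fm_bracket u v = 0"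
proof -
  obtain a b where ab: "u = fm_proj a" "v = fm_proj b" "a \<in> fl.derived" "b \<in> fl.derived"
    using assms unfolding fm_commutator_ideal_def by blast
  then have "fl_bracket a b - 0 \<in> fl.derived2" by (simp add: fl.bracket_in_commutator)
  then have "fm_proj (fl_bracket a b) = fm_proj 0" by (simp only: free_metabelian.abs_eq_iff)
  then show ?thesis by (simp only: ab fm_proj_simps)
qed


section \<open>The polynomial algebra and its action\<close>

type_synonym ('n, 'k) mpoly = "('n \<Rightarrow>\<^sub>0 nat) \<Rightarrow>\<^sub>0 'k"

definition poly_gen :: "'n \<Rightarrow> ('n, 'k::field) mpoly"
  where "poly_gen j = Poly_Mapping.single (Poly_Mapping.single j 1) 1"

definition fm_ad :: "'n \<Rightarrow> ('n, 'k::field) free_metabelian \<Rightarrow> ('n, 'k) free_metabelian"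
  where "fm_ad j u = fm_bracket u (fm_gen j)"

text \<open>
  The order of the factors is irrelevant on \<open>L\<^sub>d' / L\<^sub>d''\<close>, where the \<open>fm_ad j\<close> commute; the order
  on \<open>'n\<close> only serves to make the definition total.
\<close>

definition fm_ad_monomial ::
    "('n::{finite, linorder} \<Rightarrow>\<^sub>0 nat) \<Rightarrow> ('n, 'k::field) free_metabelian \<Rightarrow> ('n, 'k) free_metabelian"
  where "fm_ad_monomial m u = foldr (\<lambda>j. fm_ad j ^^ Poly_Mapping.lookup m j) (sorted_list_of_set UNIV) u"

definition fm_act ::
    "('n::{finite, linorder}, 'k::field) free_metabelian \<Rightarrow> ('n, 'k) mpoly \<Rightarrow> ('n, 'k) free_metabelian"
  where "fm_act u f = linear_extension fm_scale (\<lambda>m. fm_ad_monomial m u) f"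

lemma fm_ad_in_commutator_ideal: "fm_ad j u \<in> fm_commutator_ideal"
  by (simp add: fm_ad_def fm_commutator_ideal_eq fm.bracket_in_commutator)

lemma fm_ad_commute:
  assumes "u \<in> fm_commutator_ideal"
  shows "fm_ad i (fm_ad j u) = fm_ad j (fm_ad i u)"
proof -
  have "fm_bracket (fm_gen j) (fm_gen i) \<in> fm_commutator_ideal"
    by (simp add: fm_commutator_ideal_eq fm.bracket_in_commutator)
  from fm_metabelian[OF assms this] show ?thesis
    unfolding fm_ad_def by (simp only: fm.bracket_jacobi_left[of u "fm_gen j" "fm_gen i"] add_0_right)
qed


section \<open>Weitzenboeck derivations\<close>

definition fm_lin :: "'k::field ^ 'n::finite \<Rightarrow> ('n, 'k) free_metabelian"
  where "fm_lin v = (\<Sum>j\<in>UNIV. fm_scale (v $ j) (fm_gen j))"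

definition poly_lin :: "'k::field ^ 'n::finite \<Rightarrow> ('n, 'k) mpoly"
  where "poly_lin v = (\<Sum>j\<in>UNIV. pm_scale (v $ j) (poly_gen j))"

definition nonzero_nilpotent_operator :: "('k::field ^ 'n::finite \<Rightarrow> 'k ^ 'n) \<Rightarrow> bool"
  where "nonzero_nilpotent_operator \<phi> \<longleftrightarrow>
    Vector_Spaces.linear (*s) (*s) \<phi> \<and> \<phi> \<noteq> (\<lambda>_. 0) \<and> (\<exists>m. \<phi> ^^ m = (\<lambda>_. 0))"

text \<open>
  \<open>\<delta>\<close> is the derivation of \<open>L\<^sub>d / L\<^sub>d''\<close>, resp. of \<open>K[X\<^sub>d]\<close>, extending the operator \<open>\<phi>\<close> of \<open>K X\<^sub>d\<close>.
\<close>

definition extends_to_fm ::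
    "('k::field ^ 'n::finite \<Rightarrow> 'k ^ 'n) \<Rightarrow> (('n, 'k) free_metabelian \<Rightarrow> ('n, 'k) free_metabelian) \<Rightarrow> bool"
  where "extends_to_fm \<phi> \<delta> \<longleftrightarrow>
    derivation fm_scale fm_bracket \<delta> \<and> (\<forall>v. \<delta> (fm_lin v) = fm_lin (\<phi> v))"

definition extends_to_poly ::
    "('k::field ^ 'n::finite \<Rightarrow> 'k ^ 'n) \<Rightarrow> (('n, 'k) mpoly \<Rightarrow> ('n, 'k) mpoly) \<Rightarrow> bool"
  where "extends_to_poly \<phi> \<delta> \<longleftrightarrow>
    derivation pm_scale (*) \<delta> \<and> (\<forall>v. \<delta> (poly_lin v) = poly_lin (\<phi> v))"

text \<open>
  The right module \<open>M\<close>, with action \<open>act\<close> of the ring \<open>R\<close>, is generated by a finite set. The equality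
  also says that \<open>M\<close> is closed under addition and under the action of \<open>R\<close>.
\<close>

definition finitely_generated_module :: "'r set \<Rightarrow> ('m::ab_group_add \<Rightarrow> 'r \<Rightarrow> 'm) \<Rightarrow> 'm set \<Rightarrow> bool"
  where "finitely_generated_module R act M \<longleftrightarrow>
    (\<exists>B. finite B \<and> B \<subseteq> M \<and> M = {\<Sum>b\<in>B. act b (c b) | c. \<forall>b\<in>B. c b \<in> R})"

end

theory Submission
  imports Defs
begin

text \<open>
  The Magnus embedding \<open>x\<^sub>i \<mapsto> (x\<^sub>i, z\<^sub>i)\<close> identifies \<open>L\<^sub>d' / L\<^sub>d''\<close> with a \<open>K[X\<^sub>d]\<close>-submodule of the
  part of \<open>K[X\<^sub>d, Z\<^sub>d]\<close> that is linear in the \<open>z\<^sub>i\<close>; it is injective because the Koszul complex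
  is exact, and it intertwines \<open>\<delta>\<close> with the derivation of \<open>K[X\<^sub>d, Z\<^sub>d]\<close> that acts by \<open>\<phi>\<close> on both
  sets of variables. It therefore suffices that every set of constants of this derivation lies in
  the span of finitely many of its members with constants as coefficients; comparing the parts
  linear in \<open>z\<close> then turns the coefficients into elements of \<open>K[X\<^sub>d]\<^sup>\<delta>\<close>.

  For this, complete \<open>\<phi>\<close> to an \<open>sl\<^sub>2\<close>-triple and adjoin the natural representation with basis
  \<open>x, y\<close>. A constant is then the value at \<open>x = 0, y = 1\<close> of an \<open>sl\<^sub>2\<close>-invariant. By Hilbert's basis
  theorem a set of invariants is contained in the ideal generated by finitely many of them, and the
  Reynolds operator makes the coefficients invariant.
\<close>

section \<open>Eigenvectors\<close>

text \<open>The constants of \<open>\<phi>\<close> are the invariants of an additive group, which is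
  not reductive, so there is no averaging over it. The natural representation removes this obstacle:
  the nonzero vectors of the plane form the quotient of \<open>SL_2\<close> by its unipotent
  subgroup, so invariants of that subgroup correspond to invariants of \<open>SL_2\<close> on the
  product with the plane. The point \<open>x = 0\<close>, \<open>y = 1\<close> is chosen because the
  vector field \<open>x d/dy\<close>, through which \<open>E\<close> acts on the plane, vanishes
  there; evaluation at it therefore commutes with \<open>E\<close>.

  The Magnus image of the commutator ideal is a proper submodule of the part linear in
  \<open>z\<close>, as it lies in the kernel of \<open>z_i \<mapsto> x_i\<close>. Generators found
  in the larger ring might leave it; this is why every finiteness statement below selects its finite
  set among the given elements.\<close>

lemma linear_simps:
  assumes "Vector_Spaces.linear s1 s2 T"
  shows "T 0 = 0" "T (u + v) = T u + T v" "T (u - v) = T u - T v" "T (- u) = - T u"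
    "T (s1 c u) = s2 c (T u)" "T (sum g A) = (\<Sum>a\<in>A. T (g a))"
proof -
  interpret module_hom s1 s2 T using assms by (simp add: linear_iff_module_hom)
  show "T 0 = 0" "T (u + v) = T u + T v" "T (u - v) = T u - T v" "T (- u) = - T u"
    "T (s1 c u) = s2 c (T u)" "T (sum g A) = (\<Sum>a\<in>A. T (g a))"
    by (rule zero add diff neg scale sum)+
qed

lemma linear_funpow:
  assumes "Vector_Spaces.linear s s T"
  shows "Vector_Spaces.linear s s (T ^^ n)"
proof (induction n)
  case 0
  then show ?case using assms vector_space.linear_id[of s]
    by (simp add: Vector_Spaces.linear_def id_def)
next
  case (Suc n)
  then show ?case using Vector_Spaces.linear_compose[OF Suc assms] by (simp add: comp_def)
qed

definition eigenvectors :: "('k \<Rightarrow> 'b \<Rightarrow> 'b) \<Rightarrow> ('b \<Rightarrow> 'b) \<Rightarrow> 'b set"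
  where "eigenvectors sc T = {u. \<exists>c. T u = sc c u}"

context vector_space
begin

text \<open>Applying \<open>T - a\<close> to the vanishing sum kills the summand of the eigenvalue
  \<open>a\<close> and multiplies every other one by the nonzero scalar \<open>c - a\<close>, which
  leaves a shorter vanishing sum.\<close>

lemma eigenvectors_independent:
  assumes T: "Vector_Spaces.linear scale scale T" and "finite W"
    and "\<And>c. c \<in> W \<Longrightarrow> T (g c) = scale c (g c)" "(\<Sum>c\<in>W. g c) = 0" "c \<in> W"
  shows "g c = 0"
  using assms(2-)
proof (induction W arbitrary: g c rule: finite_induct)
  case empty
  then show ?case by simp
next
  case (insert a W)
  let ?g = "\<lambda>c. scale (c - a) (g c)"
  have "(\<Sum>c\<in>insert a W. ?g c) = T (\<Sum>c\<in>insert a W. g c) - scale a (\<Sum>c\<in>insert a W. g c)"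
    using insert.prems(1)
    by (simp only: linear_simps(6)[OF T] scale_sum_right scale_left_diff_distrib sum_subtractf
        cong: sum.cong)
  then have "(\<Sum>c\<in>W. ?g c) = 0"
    using insert.hyps insert.prems(2) linear_simps(1)[OF T] by simp
  moreover have "T (?g c) = scale c (?g c)" if "c \<in> W" for c
    using insert.prems(1)[of c] that by (simp add: linear_simps(5)[OF T] mult.commute)
  ultimately have "?g c = 0" if "c \<in> W" for c using insert.IH[of ?g] that by blast
  then have 1: "g c = 0" if "c \<in> W" for c using that insert.hyps(2) by auto
  then have "g a = 0" using insert.prems(2) insert.hyps by simp
  with 1 show ?case using insert.prems(3) by auto
qed

text \<open>Eigenvectors with the same eigenvalue are merged. The family \<open>g\<close> is total
  and vanishes off \<open>W\<close>, so that finitely many decompositions can later be written over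
  one common index set.\<close>

lemma eigenvector_decomposition:
  assumes T: "Vector_Spaces.linear scale scale T" and "v \<in> span (eigenvectors scale T)"
  shows "\<exists>W g. finite W \<and> (\<forall>c. T (g c) = scale c (g c)) \<and> (\<forall>c. c \<notin> W \<longrightarrow> g c = 0)
    \<and> v = (\<Sum>c\<in>W. g c)"
  using assms(2)
proof (induction rule: span_induct_alt)
  case base
  show ?case by (rule exI[of _ "{}"], rule exI[of _ "\<lambda>_. 0"]) (simp add: linear_simps(1)[OF T])
next
  case (step b u w)
  then obtain a W g where u: "T u = scale a u" and W: "finite W"
    and g: "\<And>c. T (g c) = scale c (g c)" "\<And>c. c \<notin> W \<Longrightarrow> g c = 0" and w: "w = (\<Sum>c\<in>W. g c)"
    by (auto simp: eigenvectors_def)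
  let ?g = "\<lambda>c. (if c = a then scale b u else 0) + g c"
  have "T (?g c) = scale c (?g c)" for c
    by (simp add: linear_simps[OF T] g(1) u scale_right_distrib mult.commute)
  moreover have "?g c = 0" if "c \<notin> insert a W" for c using that g(2) by simp
  moreover have "scale b u + w = (\<Sum>c\<in>insert a W. ?g c)"
  proof -
    have "(\<Sum>c\<in>insert a W. g c) = w" unfolding w using W g(2) by (intro sum.mono_neutral_right) auto
    then show ?thesis using W by (simp add: sum.distrib sum.delta)
  qed
  ultimately show ?case using W by (metis (no_types, lifting) finite_insert)
qed

end


section \<open>Representations of \<open>sl\<^sub>2\<close>\<close>

locale sl2_rep = vector_space scale
  for scale :: "'k::field_char_0 \<Rightarrow> 'a::ab_group_add \<Rightarrow> 'a" +
  fixes E F H :: "'a \<Rightarrow> 'a"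
  assumes linear_E: "Vector_Spaces.linear scale scale E"
    and linear_F: "Vector_Spaces.linear scale scale F"
    and linear_H: "Vector_Spaces.linear scale scale H"
    and EF: "E (F v) = F (E v) + H v"
    and HE: "H (E v) = E (H v) + scale 2 (E v)"
    and HF: "H (F v) = F (H v) - scale 2 (F v)"
begin

lemmas E_simps = linear_simps[OF linear_E]
lemmas F_simps = linear_simps[OF linear_F]
lemmas H_simps = linear_simps[OF linear_H]
lemmas F_pow_simps = linear_simps[OF linear_funpow[OF linear_F]]

lemma weight_E: "H v = scale c v \<Longrightarrow> H (E v) = scale (c + 2) (E v)"
  by (simp add: HE E_simps scale_left_distrib)

lemma weight_F: "H v = scale c v \<Longrightarrow> H (F v) = scale (c - 2) (F v)"
  by (simp add: HF F_simps scale_left_diff_distrib)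

lemma weight_E_pow: "H v = scale c v \<Longrightarrow> H ((E ^^ k) v) = scale (c + 2 * of_nat k) ((E ^^ k) v)"
proof (induction k)
  case (Suc k)
  then show ?case using weight_E[OF Suc.IH] by (simp add: algebra_simps)
qed simp

lemma weight_F_pow: "H v = scale c v \<Longrightarrow> H ((F ^^ k) v) = scale (c - 2 * of_nat k) ((F ^^ k) v)"
proof (induction k)
  case (Suc k)
  then show ?case using weight_F[OF Suc.IH] by (simp add: algebra_simps)
qed simp

text \<open>Moving \<open>E\<close> past one \<open>F\<close> contributes the weight of the vector
  it meets; the weights \<open>c\<close>, \<open>c - 2\<close>, ..., \<open>c - 2k\<close> add up to
  \<open>(k + 1) * (c - k)\<close>.\<close>

lemma E_F_pow:
  assumes "H v = scale c v"
  shows "E ((F ^^ Suc k) v) = (F ^^ Suc k) (E v) + scale (of_nat (Suc k) * (c - of_nat k)) ((F ^^ k) v)"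
proof (induction k)
  case 0
  show ?case using EF assms by simp
next
  case (Suc k)
  have "E ((F ^^ Suc (Suc k)) v) = F (E ((F ^^ Suc k) v)) + H ((F ^^ Suc k) v)"
    using EF by simp
  also have "F (E ((F ^^ Suc k) v)) = (F ^^ Suc (Suc k)) (E v)
      + scale (of_nat (Suc k) * (c - of_nat k)) ((F ^^ Suc k) v)"
    by (simp only: Suc F_simps) simp
  also have "H ((F ^^ Suc k) v) = scale (c - 2 * of_nat (Suc k)) ((F ^^ Suc k) v)"
    by (rule weight_F_pow[OF assms])
  finally show ?case
    by (simp only: add.assoc flip: scale_left_distrib) (simp add: algebra_simps)
qed

text \<open>At the last nonvanishing power \<open>n\<close> of \<open>F\<close>,
  \<open>E_F_pow\<close> becomes \<open>0 = (n + 1) * (c - n) F^n v\<close>, and characteristic zero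
  forces \<open>c = n\<close>. Nilpotency of \<open>F\<close> at \<open>v\<close> stands in for
  finite dimension.\<close>

lemma highest_weight:
  assumes "E v = 0" "H v = scale c v" "(F ^^ N) v = 0" "v \<noteq> 0"
  obtains n where "c = of_nat n" "(F ^^ Suc n) v = 0"
proof -
  define M where "M = (LEAST M. (F ^^ M) v = 0)"
  have M: "(F ^^ M) v = 0" unfolding M_def using assms(3) by (rule LeastI)
  with assms(4) obtain n where n: "M = Suc n" by (cases M) auto
  then have "(F ^^ n) v \<noteq> 0" using not_less_Least[of n "\<lambda>M. (F ^^ M) v = 0"] M_def by simp
  moreover have "scale (of_nat (Suc n) * (c - of_nat n)) ((F ^^ n) v) = 0"
    using E_F_pow[OF assms(2), of n] assms(1) M n by (simp add: E_simps F_pow_simps F_simps)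
  ultimately have "c = of_nat n" by (simp del: of_nat_Suc)
  with M n that show ?thesis by blast
qed

text \<open>The extremal projector of \<open>sl\<^sub>2\<close> on vectors of weight zero, truncated.\<close>

definition reynolds :: "nat \<Rightarrow> 'a \<Rightarrow> 'a"
  where "reynolds N v = (\<Sum>k<N. scale ((- 1) ^ k / (fact k * fact (Suc k))) ((F ^^ k) ((E ^^ k) v)))"

text \<open>The sum telescopes: \<open>E\<close> of each new term cancels the remainder left by the
  earlier ones. What is left vanishes as soon as \<open>E^(N+1) v = 0\<close>.\<close>

lemma E_reynolds:
  assumes "H v = 0"
  shows "E (reynolds (Suc N) v) = scale ((- 1) ^ N / (fact N * fact (Suc N))) ((F ^^ N) ((E ^^ Suc N) v))"
proof (induction N)
  case 0
  show ?case by (simp add: reynolds_def)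
next
  case (Suc N)
  let ?c = "\<lambda>k. (- 1) ^ k / (fact k * fact (Suc k)) :: 'k"
  have "H ((E ^^ Suc N) v) = scale (0 + 2 * of_nat (Suc N)) ((E ^^ Suc N) v)"
    using weight_E_pow[of v 0 "Suc N"] assms by simp
  from E_F_pow[OF this, of N]
  have 1: "E ((F ^^ Suc N) ((E ^^ Suc N) v)) = (F ^^ Suc N) ((E ^^ Suc (Suc N)) v)
      + scale (of_nat (Suc N) * of_nat (Suc (Suc N))) ((F ^^ N) ((E ^^ Suc N) v))"
    by (simp add: algebra_simps)
  \<comment> \<open>This recursion dictates the coefficients of the projector:
    \<open>(N + 1) * (N + 2)\<close> is the factor that \<open>E_F_pow\<close> produces at weight
    \<open>2 * (N + 1)\<close>.\<close>
  have 2: "?c N + ?c (Suc N) * (of_nat (Suc N) * of_nat (Suc (Suc N))) = 0"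
    by (simp add: divide_simps del: of_nat_Suc)
  have "E (reynolds (Suc (Suc N)) v)
      = E (reynolds (Suc N) v) + scale (?c (Suc N)) (E ((F ^^ Suc N) ((E ^^ Suc N) v)))"
    unfolding reynolds_def sum.lessThan_Suc[of _ "Suc N"] by (simp only: E_simps)
  also have "\<dots> = scale (?c (Suc N)) ((F ^^ Suc N) ((E ^^ Suc (Suc N)) v))
      + scale (?c N + ?c (Suc N) * (of_nat (Suc N) * of_nat (Suc (Suc N)))) ((F ^^ N) ((E ^^ Suc N) v))"
    unfolding Suc 1 scale_right_distrib scale_scale scale_left_distrib by (simp only: add_ac)
  finally show ?case unfolding 2 by simp
qed

end


section \<open>Hilbert's basis theorem\<close>

text \<open>Subrings are sets inside a fixed ambient ring, so that variables can be adjoined one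
  after another without changing the type.\<close>

definition is_subring :: "'a::comm_ring_1 set \<Rightarrow> bool"
  where "is_subring S \<longleftrightarrow> 1 \<in> S \<and> (\<forall>a\<in>S. \<forall>b\<in>S. a - b \<in> S \<and> a * b \<in> S)"

lemma is_subringD:
  assumes "is_subring S"
  shows "1 \<in> S" "0 \<in> S" "a \<in> S \<Longrightarrow> b \<in> S \<Longrightarrow> a - b \<in> S" "a \<in> S \<Longrightarrow> b \<in> S \<Longrightarrow> a * b \<in> S"
    "a \<in> S \<Longrightarrow> - a \<in> S" "a \<in> S \<Longrightarrow> b \<in> S \<Longrightarrow> a + b \<in> S"
proof -
  show 1: "1 \<in> S" and d: "\<And>a b. a \<in> S \<Longrightarrow> b \<in> S \<Longrightarrow> a - b \<in> S"
    and "a \<in> S \<Longrightarrow> b \<in> S \<Longrightarrow> a * b \<in> S"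
    using assms by (auto simp: is_subring_def)
  show 0: "0 \<in> S" using d[OF 1 1] by simp
  show n: "- a \<in> S" if "a \<in> S" for a using d[OF 0 that] by simp
  show "a + b \<in> S" if "a \<in> S" "b \<in> S" using d[OF that(1) n[OF that(2)]] by simp
qed

section \<open>Linear combinations over a subring\<close>

inductive_set lin_span :: "'a::comm_ring_1 set \<Rightarrow> 'a set \<Rightarrow> 'a set" for S G where
  zero: "0 \<in> lin_span S G"
| step: "s \<in> S \<Longrightarrow> g \<in> G \<Longrightarrow> x \<in> lin_span S G \<Longrightarrow> s * g + x \<in> lin_span S G"

lemma lin_span_add: "x \<in> lin_span S G \<Longrightarrow> y \<in> lin_span S G \<Longrightarrow> x + y \<in> lin_span S G"
  by (induction rule: lin_span.induct) (auto simp: add.assoc intro: lin_span.step)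

lemma lin_span_sum: "(\<And>i. i \<in> A \<Longrightarrow> f i \<in> lin_span S G) \<Longrightarrow> sum f A \<in> lin_span S G"
  by (induction A rule: infinite_finite_induct) (auto intro: lin_span.zero lin_span_add)

lemma lin_span_base: "is_subring S \<Longrightarrow> g \<in> G \<Longrightarrow> g \<in> lin_span S G"
  using lin_span.step[OF is_subringD(1) _ lin_span.zero, of S g G] by simp

lemma lin_span_mult: "is_subring S \<Longrightarrow> s \<in> S \<Longrightarrow> x \<in> lin_span S G \<Longrightarrow> s * x \<in> lin_span S G"
  by (rotate_tac 2, induction rule: lin_span.induct)
    (auto simp: distrib_left mult.assoc[symmetric] intro: lin_span.intros is_subringD)

lemma lin_span_diff:
  assumes "is_subring S" "x \<in> lin_span S G" "y \<in> lin_span S G" shows "x - y \<in> lin_span S G"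
  using lin_span_add[OF assms(2) lin_span_mult[OF assms(1) is_subringD(5)[OF assms(1) is_subringD(1)[OF assms(1)]] assms(3)]]
  by simp

lemma lin_span_trans:
  assumes "is_subring S" "x \<in> lin_span S F" "F \<subseteq> lin_span S G" shows "x \<in> lin_span S G"
  using assms(2,3,1) by induction (auto intro!: lin_span.zero lin_span_add lin_span_mult)

lemma lin_span_mono: "x \<in> lin_span S F \<Longrightarrow> F \<subseteq> G \<Longrightarrow> x \<in> lin_span S G"
  by (induction rule: lin_span.induct) (auto intro: lin_span.intros)

lemma lin_span_finite_support:
  "x \<in> lin_span S G \<Longrightarrow> \<exists>G0. finite G0 \<and> G0 \<subseteq> G \<and> x \<in> lin_span S G0"
proof (induction rule: lin_span.induct)
  case zero
  show ?case by (rule exI[of _ "{}"]) (simp add: lin_span.zero)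
next
  case (step s g x)
  then obtain G0 where "finite G0" "G0 \<subseteq> G" "x \<in> lin_span S G0" by blast
  then show ?case using step.hyps
    by (intro exI[of _ "insert g G0"]) (auto intro!: lin_span.step elim: lin_span_mono)
qed

lemma lin_span_finite_subset:
  assumes S: "is_subring S" and "finite F" "F \<subseteq> lin_span S G"
  shows "\<exists>G0. finite G0 \<and> G0 \<subseteq> G \<and> F \<subseteq> lin_span S G0"
proof -
  have "\<forall>x\<in>F. \<exists>G0. finite G0 \<and> G0 \<subseteq> G \<and> x \<in> lin_span S G0"
    using assms(3) lin_span_finite_support by blast
  then obtain h where h: "\<And>x. x \<in> F \<Longrightarrow> finite (h x) \<and> h x \<subseteq> G \<and> x \<in> lin_span S (h x)"
    by metis
  have "x \<in> lin_span S (\<Union>(h ` F))" if "x \<in> F" for x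
    using lin_span_mono[of x S "h x"] h[OF that] that by blast
  then show ?thesis
    by (intro exI[of _ "\<Union>(h ` F)"]) (use h assms(2) in auto)
qed

lemma lin_span_finite_sum:
  assumes S: "is_subring S" and "finite G" "x \<in> lin_span S G"
  shows "\<exists>c. (\<forall>g. c g \<in> S) \<and> x = (\<Sum>g\<in>G. c g * g)"
  using assms(3)
proof (induction rule: lin_span.induct)
  case zero
  show ?case by (rule exI[of _ "\<lambda>_. 0"]) (simp add: is_subringD[OF S])
next
  case (step s g x)
  then obtain c where c: "\<And>g. c g \<in> S" "x = (\<Sum>g\<in>G. c g * g)" by blast
  have "s * g + x = (\<Sum>h\<in>G. ((if h = g then s else 0) + c h) * h)"
    using assms(2) step.hyps by (simp add: distrib_right sum.distrib c(2) if_distrib[of "\<lambda>a. a * _"]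
      cong: if_cong)
  then show ?case using c(1) step.hyps
    by (intro exI[of _ "\<lambda>h. (if h = g then s else 0) + c h"]) (simp add: is_subringD[OF S])
qed

text \<open>Demanded for arbitrary subsets \<open>G\<close>, with the finite generating set inside
  \<open>G\<close>: this form lets generators be chosen among prescribed elements.\<close>

definition noetherian :: "'a::comm_ring_1 set \<Rightarrow> bool"
  where "noetherian S \<longleftrightarrow> (\<forall>G\<subseteq>S. \<exists>G0\<subseteq>G. finite G0 \<and> G \<subseteq> lin_span S G0)"

text \<open>Here \<open>X\<close> is any element of the ambient ring, not necessarily transcendental over \<open>S\<close>.\<close>

fun polys_below :: "'a::comm_ring_1 set \<Rightarrow> 'a \<Rightarrow> nat \<Rightarrow> 'a set" where
  "polys_below S X 0 = {0}"
| "polys_below S X (Suc n) = {a * X ^ n + p | a p. a \<in> S \<and> p \<in> polys_below S X n}"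

definition adjoin :: "'a::comm_ring_1 set \<Rightarrow> 'a \<Rightarrow> 'a set"
  where "adjoin S X = (\<Union>n. polys_below S X n)"

context
  fixes S :: "'a::comm_ring_1 set" and X :: 'a
  assumes S: "is_subring S"
begin

private abbreviation "P \<equiv> polys_below S X"

private lemmas subring_simps = is_subringD[OF S]

lemma polys_below_SucI: "a \<in> S \<Longrightarrow> p \<in> P n \<Longrightarrow> a * X ^ n + p \<in> P (Suc n)"
  by auto

lemma polys_below_SucE:
  assumes "p \<in> P (Suc n)"
  obtains a q where "p = a * X ^ n + q" "a \<in> S" "q \<in> P n"
  using assms by auto

declare polys_below.simps(2) [simp del]

lemma polys_below_Suc: "p \<in> P n \<Longrightarrow> p \<in> P (Suc n)"
  using polys_below_SucI[OF subring_simps(2)] by fastforce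

lemma polys_below_zero: "0 \<in> P n"
  by (induction n) (auto intro: polys_below_Suc)

lemma polys_below_mono: "p \<in> P n \<Longrightarrow> n \<le> m \<Longrightarrow> p \<in> P m"
  by (induction m) (auto simp: le_Suc_eq intro: polys_below_Suc)

lemma polys_below_diff: "p \<in> P n \<Longrightarrow> q \<in> P n \<Longrightarrow> p - q \<in> P n"
proof (induction n arbitrary: p q)
  case (Suc n)
  from Suc.prems obtain a p' b q' where pq: "p = a * X ^ n + p'" "q = b * X ^ n + q'"
    and "a \<in> S" "b \<in> S" "p' \<in> P n" "q' \<in> P n" by (elim polys_below_SucE)
  then have "(a - b) * X ^ n + (p' - q') \<in> P (Suc n)"
    using Suc.IH by (intro polys_below_SucI subring_simps) auto
  then show ?case by (simp add: pq algebra_simps)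
qed simp

lemma polys_below_smult: "s \<in> S \<Longrightarrow> p \<in> P n \<Longrightarrow> s * p \<in> P n"
proof (induction n arbitrary: p)
  case (Suc n)
  from Suc.prems(2) obtain a q where p: "p = a * X ^ n + q" and "a \<in> S" "q \<in> P n"
    by (elim polys_below_SucE)
  then have "(s * a) * X ^ n + s * q \<in> P (Suc n)"
    using Suc by (intro polys_below_SucI subring_simps) auto
  then show ?case by (simp add: p algebra_simps)
qed simp

lemma polys_below_shift: "p \<in> P n \<Longrightarrow> X * p \<in> P (Suc n)"
proof (induction n arbitrary: p)
  case 0
  then show ?case using polys_below_zero[of "Suc 0"] by simp
next
  case (Suc n)
  from Suc.prems obtain a q where p: "p = a * X ^ n + q" and "a \<in> S" "q \<in> P n"
    by (elim polys_below_SucE)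
  then have "a * X ^ Suc n + X * q \<in> P (Suc (Suc n))"
    using Suc.IH by (intro polys_below_SucI) auto
  then show ?case by (simp add: p algebra_simps)
qed

lemma polys_below_sum:
  assumes "\<And>i. i \<in> I \<Longrightarrow> f i \<in> P n" shows "sum f I \<in> P n"
proof -
  have add: "p + q \<in> P n" if "p \<in> P n" "q \<in> P n" for p q
    using polys_below_diff[OF that(1) polys_below_diff[OF polys_below_zero that(2)]] by simp
  show ?thesis using assms
    by (induction I rule: infinite_finite_induct) (auto intro!: add polys_below_zero)
qed

lemma subset_adjoin: "S \<subseteq> adjoin S X"
proof
  fix s assume "s \<in> S"
  then have "s \<in> P (Suc 0)" using polys_below_SucI[of s 0 0] by simp
  then show "s \<in> adjoin S X" unfolding adjoin_def by blast
qed

lemma shift_in_adjoin: "p \<in> adjoin S X \<Longrightarrow> X * p \<in> adjoin S X"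
  unfolding adjoin_def using polys_below_shift by blast

lemma power_in_adjoin: "X ^ n \<in> adjoin S X"
  by (induction n) (use subset_adjoin subring_simps(1) shift_in_adjoin in auto)

lemma mem_adjoin: "X \<in> adjoin S X"
  using power_in_adjoin[of 1] by simp

lemma is_subring_adjoin: "is_subring (adjoin S X)"
proof -
  have diff: "p - q \<in> adjoin S X" if "p \<in> adjoin S X" "q \<in> adjoin S X" for p q
  proof -
    obtain n m where "p \<in> P n" "q \<in> P m" using \<open>p \<in> _\<close> \<open>q \<in> _\<close> by (auto simp: adjoin_def)
    then have "p - q \<in> P (max n m)" by (intro polys_below_diff) (auto elim: polys_below_mono)
    then show ?thesis by (auto simp: adjoin_def)
  qed
  have 0: "0 \<in> adjoin S X" using subset_adjoin subring_simps(2) by auto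
  have add: "p + q \<in> adjoin S X" if "p \<in> adjoin S X" "q \<in> adjoin S X" for p q
    using diff[OF that(1) diff[OF 0 that(2)]] by simp
  have pow: "X ^ n * q \<in> adjoin S X" if "q \<in> adjoin S X" for q n
    by (induction n) (use that shift_in_adjoin in \<open>auto simp: mult.assoc\<close>)
  have smult: "s * q \<in> adjoin S X" if "s \<in> S" "q \<in> adjoin S X" for s q
    using that polys_below_smult by (auto simp: adjoin_def)
  have mult: "p * q \<in> adjoin S X" if "p \<in> P n" "q \<in> adjoin S X" for p q n
    using that(1)
  proof (induction n arbitrary: p)
    case (Suc n)
    from Suc.prems obtain a p' where "p = a * X ^ n + p'" "a \<in> S" "p' \<in> P n"
      by (elim polys_below_SucE)
    with Suc.IH[of p'] show ?case
      by (auto simp: distrib_right mult.assoc intro!: add smult pow that(2))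
  qed (simp add: 0)
  have "p * q \<in> adjoin S X" if "p \<in> adjoin S X" "q \<in> adjoin S X" for p q
  proof -
    obtain n where "p \<in> P n" using \<open>p \<in> adjoin S X\<close> by (auto simp: adjoin_def)
    from mult[OF this that(2)] show ?thesis .
  qed
  with diff have "\<forall>a\<in>adjoin S X. \<forall>b\<in>adjoin S X. a - b \<in> adjoin S X \<and> a * b \<in> adjoin S X" by simp
  then show ?thesis using subset_adjoin subring_simps(1) unfolding is_subring_def by simp blast
qed

text \<open>Hilbert's argument with leading coefficients. Since \<open>X\<close> may satisfy
  relations, an element has no well-defined degree; \<open>L k\<close> records the coefficient
  \<open>a\<close> of every expression \<open>a * X ^ k + p\<close> of a member of \<open>I\<close>
  with \<open>p\<close> of lower formal degree. \<open>noetherian\<close> applies to these sets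
  directly because it speaks of arbitrary subsets.\<close>

theorem noetherian_adjoin:
  assumes noeth: "noetherian S"
  shows "noetherian (adjoin S X)"
  unfolding noetherian_def
proof (intro allI impI)
  fix G assume G: "G \<subseteq> adjoin S X"
  note SX = is_subring_adjoin
  define I where "I = lin_span (adjoin S X) G"
  have I_smult: "s * p \<in> I" if "s \<in> adjoin S X" "p \<in> I" for s p
    using lin_span_mult[OF SX] that unfolding I_def by blast
  have I_diff: "p - q \<in> I" if "p \<in> I" "q \<in> I" for p q
    using lin_span_diff[OF SX] that unfolding I_def by blast
  define L where "L = (\<lambda>k. {a \<in> S. \<exists>p\<in>P k. a * X ^ k + p \<in> I})"
  have "L k \<subseteq> L (Suc k)" for k
  proof
    fix a assume "a \<in> L k"
    then obtain p where p: "a \<in> S" "p \<in> P k" "a * X ^ k + p \<in> I" by (auto simp: L_def)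
    have "X * (a * X ^ k + p) \<in> I" using I_smult mem_adjoin p(3) by blast
    then have "a * X ^ Suc k + X * p \<in> I" by (simp add: algebra_simps)
    then show "a \<in> L (Suc k)" using p polys_below_shift unfolding L_def by blast
  qed
  then have L_mono: "L k \<subseteq> L m" if "k \<le> m" for k m using that by (rule lift_Suc_mono_le)
  have L_sub: "(\<Union>k. L k) \<subseteq> S" "\<And>k. L k \<subseteq> S" by (auto simp: L_def)
  obtain B0 where B0: "B0 \<subseteq> (\<Union>k. L k)" "finite B0" "(\<Union>k. L k) \<subseteq> lin_span S B0"
    using noeth L_sub(1) unfolding noetherian_def by meson
  have "\<forall>k. \<exists>B\<subseteq>L k. finite B \<and> L k \<subseteq> lin_span S B"
    using noeth L_sub(2) unfolding noetherian_def by meson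
  then obtain B where B: "\<And>k. B k \<subseteq> L k" "\<And>k. finite (B k)" "\<And>k. L k \<subseteq> lin_span S (B k)"
    by metis
  \<comment> \<open>The finite set \<open>B0\<close> generates all leading coefficients and lies in
    one member of the increasing chain, which is where the chain stabilises up to linear
    span.\<close>
  obtain N where N: "B0 \<subseteq> L N"
  proof -
    have "\<forall>b\<in>B0. \<exists>k. b \<in> L k" using B0(1) by blast
    then obtain h where h: "\<And>b. b \<in> B0 \<Longrightarrow> b \<in> L (h b)" by metis
    have "b \<in> L (Max (h ` B0))" if "b \<in> B0" for b
      using h[OF that] L_mono[of "h b" "Max (h ` B0)"] B0(2) that by auto
    then show ?thesis using that by blast
  qed
  have LN: "L k \<subseteq> lin_span S (B N)" for k
    using lin_span_trans[OF S _ subset_trans[OF N B(3)]] B0(3) by blast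
  have "\<forall>k. \<forall>b\<in>B k. \<exists>p\<in>P k. b * X ^ k + p \<in> I" using B(1) by (auto simp: L_def)
  then obtain r where r: "\<And>k b. b \<in> B k \<Longrightarrow> r k b \<in> P k" "\<And>k b. b \<in> B k \<Longrightarrow> b * X ^ k + r k b \<in> I"
    by metis
  define F where "F = (\<Union>k\<le>N. (\<lambda>b. b * X ^ k + r k b) ` B k)"
  have F: "finite F" "F \<subseteq> I" using B(2) r(2) by (auto simp: F_def)
  have IF: "q \<in> lin_span (adjoin S X) F" if "q \<in> P n" "q \<in> I" for q n
    using that
  proof (induction n arbitrary: q)
    case 0
    then show ?case by (simp add: lin_span.zero)
  next
    case (Suc n)
    from Suc.prems(1) obtain a p where q: "q = a * X ^ n + p" and a: "a \<in> S" and p: "p \<in> P n"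
      by (elim polys_below_SucE)
    with Suc.prems(2) have aL: "a \<in> L n" by (auto simp: L_def)
    \<comment> \<open>Up to \<open>N\<close> each degree has its own generators; beyond it those of
      degree \<open>N\<close> are reused after multiplication by \<open>X ^ (n - N)\<close>.\<close>
    define k where "k = min n N"
    have "a \<in> lin_span S (B k)"
      using aL B(3)[of n] LN[of n] by (auto simp: k_def min_def)
    then obtain c where c: "\<And>b. c b \<in> S" "a = (\<Sum>b\<in>B k. c b * b)"
      using lin_span_finite_sum[OF S B(2)] by blast
    let ?t = "\<lambda>b. c b * X ^ (n - k) * (b * X ^ k + r k b)"
    have t: "?t b \<in> I \<and> ?t b \<in> lin_span (adjoin S X) F" if "b \<in> B k" for b
    proof -
      have "b * X ^ k + r k b \<in> F" using that by (auto simp: F_def k_def)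
      moreover have "c b * X ^ (n - k) \<in> adjoin S X"
        using c(1) subset_adjoin power_in_adjoin is_subringD(4)[OF SX] by blast
      ultimately show ?thesis
        using F(2) I_smult lin_span_mult[OF SX] lin_span_base[OF SX] by blast
    qed
    have "X ^ (n - k) * X ^ k = X ^ n" by (simp add: k_def flip: power_add)
    then have "(\<Sum>b\<in>B k. ?t b) = a * X ^ n + (\<Sum>b\<in>B k. c b * (X ^ (n - k) * r k b))"
      unfolding c(2) sum_distrib_right sum.distrib[symmetric]
      by (intro sum.cong refl) (simp add: algebra_simps)
    \<comment> \<open>The terms in \<open>X ^ n\<close> cancel, so the difference has lower formal
      degree and falls under the induction hypothesis.\<close>
    then have eq: "q - (\<Sum>b\<in>B k. ?t b) = p - (\<Sum>b\<in>B k. c b * (X ^ (n - k) * r k b))"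
      by (simp add: q)
    have "X ^ j * s \<in> P (j + k)" if "s \<in> P k" for s j
      by (induction j) (use that polys_below_shift in \<open>auto simp: mult.assoc\<close>)
    from this[of _ "n - k"] have Xs: "X ^ (n - k) * s \<in> P n" if "s \<in> P k" for s
      using that by (simp add: k_def)
    have "q - (\<Sum>b\<in>B k. ?t b) \<in> P n"
      unfolding eq
    proof (intro polys_below_diff polys_below_sum p)
      fix b assume "b \<in> B k"
      show "c b * (X ^ (n - k) * r k b) \<in> P n"
        by (rule polys_below_smult[OF c(1) Xs[OF r(1)]]) fact
    qed
    moreover have sumI: "(\<Sum>b\<in>B k. ?t b) \<in> I" "(\<Sum>b\<in>B k. ?t b) \<in> lin_span (adjoin S X) F"
      using t unfolding I_def by (auto intro: lin_span_sum)
    ultimately have "q - (\<Sum>b\<in>B k. ?t b) \<in> lin_span (adjoin S X) F"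
      by (intro Suc.IH I_diff Suc.prems(2))
    from lin_span_add[OF this sumI(2)] show ?case by simp
  qed
  obtain G0 where G0: "finite G0" "G0 \<subseteq> G" "F \<subseteq> lin_span (adjoin S X) G0"
    using lin_span_finite_subset[OF SX F(1) F(2)[unfolded I_def]] by auto
  have "G \<subseteq> lin_span (adjoin S X) G0"
  proof
    fix g assume "g \<in> G"
    then have "g \<in> I" "g \<in> adjoin S X" using lin_span_base[OF SX] G unfolding I_def by auto
    then obtain n where "g \<in> P n" by (auto simp: adjoin_def)
    from lin_span_trans[OF SX IF[OF this \<open>g \<in> I\<close>] G0(3)]
    show "g \<in> lin_span (adjoin S X) G0" .
  qed
  with G0(1,2) show "\<exists>G0\<subseteq>G. finite G0 \<and> G \<subseteq> lin_span (adjoin S X) G0" by (intro exI[of _ G0] conjI)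
qed

end


section \<open>Polynomials\<close>

lemma pm_scale_single [simp]: "pm_scale c (Poly_Mapping.single m a) = Poly_Mapping.single m (c * a)"
  by (rule poly_mapping_eqI) (simp add: lookup_single when_def)

lemma pm_induct [case_names zero single add]:
  fixes p :: "'a \<Rightarrow>\<^sub>0 'b::comm_monoid_add"
  assumes "P 0" "\<And>m a. P (Poly_Mapping.single m a)" "\<And>p q. P p \<Longrightarrow> P q \<Longrightarrow> P (p + q)"
  shows "P p"
proof (induction p rule: update_induct)
  case const
  then show ?case using assms(1) by simp
next
  case (update f a b)
  have "Poly_Mapping.update a b f = f + Poly_Mapping.single a b"
    by (rule poly_mapping_eqI)
      (use update in \<open>auto simp: lookup_update lookup_add lookup_single when_def in_keys_iff\<close>)
  then show ?case using assms(2,3) update by simp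
qed

lemma pm_linear_induct [case_names zero single add scale]:
  fixes p :: "'a \<Rightarrow>\<^sub>0 'k::field"
  assumes "P 0" "\<And>m. P (Poly_Mapping.single m 1)" "\<And>p q. P p \<Longrightarrow> P q \<Longrightarrow> P (p + q)"
    "\<And>c p. P p \<Longrightarrow> P (pm_scale c p)"
  shows "P p"
proof (induction p rule: pm_induct)
  case (single m a)
  show ?case using assms(4)[OF assms(2)[of m], of a] by simp
qed (use assms in auto)

lemma (in vector_space) linear_linear_extension:
  "Vector_Spaces.linear pm_scale scale (linear_extension scale b)"
  by unfold_locales
    (simp_all add: linear_extension_add linear_extension_scale pm.scale_right_distrib pm.scale_left_distrib)

lemma pm_scale_mult_left: "pm_scale c p * q = pm_scale c (p * q)"
  for p q :: "'m::comm_monoid_add \<Rightarrow>\<^sub>0 'k::field"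
proof -
  have single: "pm_scale c (Poly_Mapping.single m a) * q = pm_scale c (Poly_Mapping.single m a * q)" for m a
    by (induction q rule: pm_induct)
      (simp_all add: mult_single distrib_left pm.scale_right_distrib mult.assoc)
  show ?thesis
    by (induction p rule: pm_induct) (simp_all only: single distrib_right pm.scale_right_distrib, simp)
qed

lemma pm_scale_mult_right: "p * pm_scale c q = pm_scale c (p * q)"
  for p q :: "'m::comm_monoid_add \<Rightarrow>\<^sub>0 'k::field"
  using pm_scale_mult_left[of c q p] by (simp add: mult.commute)

lemma pm_scale_of_nat: "pm_scale (of_nat n) p = of_nat n * p"
  for p :: "'m::comm_monoid_add \<Rightarrow>\<^sub>0 'k::field"
  by (induction n) (simp_all add: pm.scale_left_distrib distrib_right)

lemma mpoly_monomial_induct [case_names one gen]: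
  fixes P :: "('i, 'k::field) mpoly \<Rightarrow> bool"
  assumes "P 1" "\<And>i p. P p \<Longrightarrow> P (poly_gen i * p)"
  shows "P (Poly_Mapping.single m 1)"
proof -
  \<comment> \<open>Strengthened to multiplication of every \<open>p\<close> with
    \<open>P p\<close>: in this form the claims for two exponents compose to the claim for their
    sum.\<close>
  have "\<forall>p. P p \<longrightarrow> P (Poly_Mapping.single m 1 * p)"
  proof (induction m rule: pm_induct)
    case zero
    show ?case by (simp add: single_one)
  next
    case (single i n)
    show ?case
    proof (induction n)
      case 0
      show ?case by (simp add: single_one)
    next
      case (Suc n)
      have "Poly_Mapping.single (Poly_Mapping.single i (Suc n)) 1
          = poly_gen i * (Poly_Mapping.single (Poly_Mapping.single i n) 1 :: ('i, 'k) mpoly)"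
        by (simp add: poly_gen_def mult_single flip: single_add)
      then show ?case using Suc assms(2) by (simp add: mult.assoc)
    qed
  next
    case (add p q)
    have "Poly_Mapping.single (p + q) 1
        = Poly_Mapping.single p 1 * (Poly_Mapping.single q 1 :: ('i, 'k) mpoly)"
      by (simp add: mult_single)
    with add show ?case by (simp add: mult.assoc)
  qed
  from this[rule_format, OF assms(1)] show ?thesis by simp
qed

lemma mpoly_induct [case_names one gen add scale]:
  fixes p :: "('i, 'k::field) mpoly"
  assumes "P 1" "\<And>i p. P p \<Longrightarrow> P (poly_gen i * p)" "\<And>p q. P p \<Longrightarrow> P q \<Longrightarrow> P (p + q)"
    "\<And>c p. P p \<Longrightarrow> P (pm_scale c p)"
  shows "P p"
proof (induction p rule: pm_linear_induct)
  case zero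
  show ?case using assms(4)[OF assms(1), of 0] by simp
next
  case (single m)
  show ?case by (rule mpoly_monomial_induct) (use assms in auto)
qed (use assms in auto)

text \<open>The constants form a field, in which any nonzero member of \<open>G\<close> generates
  the rest; the finitely many variables are then adjoined one at a time.\<close>

lemma noetherian_mpoly: "noetherian (UNIV :: ('i::finite, 'k::field) mpoly set)"
proof -
  define C where "C = range (\<lambda>c. pm_scale c 1 :: ('i, 'k) mpoly)"
  have C: "is_subring C"
  proof -
    have "1 \<in> C" unfolding C_def by (rule range_eqI[of _ _ 1]) simp
    moreover have "pm_scale a 1 - pm_scale b 1 \<in> C" for a b
      unfolding C_def by (rule range_eqI[of _ _ "a - b"]) (simp add: pm.scale_left_diff_distrib)
    moreover have "pm_scale a 1 * pm_scale b 1 \<in> C" for a b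
      unfolding C_def by (rule range_eqI[of _ _ "a * b"]) (simp add: pm_scale_mult_left)
    ultimately show ?thesis unfolding is_subring_def C_def by blast
  qed
  have noethC: "noetherian C" unfolding noetherian_def
  proof (intro allI impI)
    fix G assume G: "G \<subseteq> C"
    show "\<exists>G0\<subseteq>G. finite G0 \<and> G \<subseteq> lin_span C G0"
    proof (cases "G \<subseteq> {0}")
      case True
      then have "G \<subseteq> lin_span C {}" using lin_span.zero by auto
      then show ?thesis by (intro exI[of _ "{}"]) auto
    next
      case False
      then obtain x where x: "x \<in> G" "x \<noteq> 0" by auto
      then obtain a where "x = pm_scale a 1" using G by (auto simp: C_def)
      with x have a: "pm_scale a 1 \<in> G" "a \<noteq> 0" by auto
      have "pm_scale b 1 \<in> lin_span C {pm_scale a 1}" for b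
      proof -
        have "pm_scale (b / a) 1 * pm_scale a 1 + 0 \<in> lin_span C {pm_scale a 1}"
          by (rule lin_span.intros) (auto simp: C_def intro: lin_span.zero)
        then show ?thesis using a(2) by (simp add: pm_scale_mult_left)
      qed
      then have "G \<subseteq> lin_span C {pm_scale a 1}" using G by (auto simp: C_def)
      then show ?thesis using a(1) by (intro exI[of _ "{pm_scale a 1}"]) auto
    qed
  qed
  have "\<exists>S. is_subring S \<and> noetherian S \<and> C \<subseteq> S \<and> (poly_gen ` V :: ('i, 'k) mpoly set) \<subseteq> S"
    if "finite V" for V
    using that
  proof (induction V rule: finite_induct)
    case empty
    then show ?case using C noethC by auto
  next
    case (insert i V)
    then obtain S where S: "is_subring S" "noetherian S" "C \<subseteq> S" "(poly_gen ` V :: ('i, 'k) mpoly set) \<subseteq> S"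
      by blast
    then show ?case
      using is_subring_adjoin[OF S(1)] noetherian_adjoin[OF S(1,2)] subset_adjoin[OF S(1)] mem_adjoin[OF S(1)]
      by (intro exI[of _ "adjoin S (poly_gen i)"]) blast
  qed
  then obtain S where S: "is_subring S" "noetherian S" "C \<subseteq> S"
    and "(range poly_gen :: ('i, 'k) mpoly set) \<subseteq> S" by (meson finite)
  then have gen: "(poly_gen i :: ('i, 'k) mpoly) \<in> S" for i by blast
  have "p \<in> S" for p
  proof (induction p rule: mpoly_induct)
    case (scale c p)
    then show ?case using is_subringD(4)[OF S(1), of "pm_scale c 1" p] S(3)
      by (auto simp: C_def pm_scale_mult_left)
  qed (use S gen is_subringD[OF S(1)] in auto)
  then have "S = UNIV" by blast
  with S(2) show ?thesis by simp
qed

section \<open>Algebra homomorphisms and substitutions\<close>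

definition algebra_hom :: "(('i, 'k::field) mpoly \<Rightarrow> ('j, 'k) mpoly) \<Rightarrow> bool"
  where "algebra_hom h \<longleftrightarrow>
    Vector_Spaces.linear pm_scale pm_scale h \<and> h 1 = 1 \<and> (\<forall>p q. h (p * q) = h p * h q)"

lemma algebra_hom_simps:
  assumes "algebra_hom h"
  shows "h 0 = 0" "h (p + q) = h p + h q" "h (p - q) = h p - h q" "h (- p) = - h p"
    "h (pm_scale c p) = pm_scale c (h p)" "h (sum f A) = (\<Sum>a\<in>A. h (f a))"
    "h 1 = 1" "h (p * q) = h p * h q" "h (p ^ n) = h p ^ n"
proof -
  have l: "Vector_Spaces.linear pm_scale pm_scale h" using assms by (simp add: algebra_hom_def)
  show "h 0 = 0" "h (p + q) = h p + h q" "h (p - q) = h p - h q" "h (- p) = - h p"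
    "h (pm_scale c p) = pm_scale c (h p)" "h (sum f A) = (\<Sum>a\<in>A. h (f a))"
    by (rule linear_simps[OF l])+
  show 1: "h 1 = 1" "h (p * q) = h p * h q" for p q using assms by (simp_all add: algebra_hom_def)
  show "h (p ^ n) = h p ^ n" by (induction n) (simp_all add: 1)
qed

definition poly_subst :: "('i::finite \<Rightarrow> ('j, 'k::field) mpoly) \<Rightarrow> ('i, 'k) mpoly \<Rightarrow> ('j, 'k) mpoly"
  where "poly_subst g = linear_extension pm_scale (\<lambda>m. \<Prod>i\<in>UNIV. g i ^ Poly_Mapping.lookup m i)"

text \<open>Serves both the multiplicativity of substitutions and the Leibniz rule, each an identity
  between bilinear maps that need only be checked on monomials.\<close>

lemma bilinear_mpoly_eqI:
  fixes B B' :: "('i, 'k::field) mpoly \<Rightarrow> ('i, 'k) mpoly \<Rightarrow> ('j, 'k) mpoly"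
  assumes "\<And>p. Vector_Spaces.linear pm_scale pm_scale (B p)" "\<And>p. Vector_Spaces.linear pm_scale pm_scale (B' p)"
    "\<And>q. Vector_Spaces.linear pm_scale pm_scale (\<lambda>p. B p q)"
    "\<And>q. Vector_Spaces.linear pm_scale pm_scale (\<lambda>p. B' p q)"
    "\<And>m n. B (Poly_Mapping.single m 1) (Poly_Mapping.single n 1)
        = B' (Poly_Mapping.single m 1) (Poly_Mapping.single n 1)"
  shows "B p q = B' p q"
proof (induction p rule: pm_linear_induct)
  case (single m)
  show ?case
    by (induction q rule: pm_linear_induct)
      (simp_all add: linear_simps[OF assms(1)] linear_simps[OF assms(2)] assms(5))
qed (simp_all add: linear_simps[OF assms(3)] linear_simps[OF assms(4)])

lemma pm_linearI:
  assumes "\<And>u v. T (u + v) = T u + T v" "\<And>c u. T (pm_scale c u) = pm_scale c (T u)"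
  shows "Vector_Spaces.linear pm_scale pm_scale T"
  using pm.vector_space_axioms assms by unfold_locales auto

lemma algebra_hom_poly_subst: "algebra_hom (poly_subst g)"
proof -
  let ?h = "poly_subst g"
  have l: "Vector_Spaces.linear pm_scale pm_scale ?h"
    unfolding poly_subst_def by (rule pm.linear_linear_extension)
  have single: "?h (Poly_Mapping.single m 1) = (\<Prod>i\<in>UNIV. g i ^ Poly_Mapping.lookup m i)" for m
    by (simp add: poly_subst_def)
  have "?h (p * q) = ?h p * ?h q" for p q
    by (rule bilinear_mpoly_eqI[where B = "\<lambda>p q. ?h (p * q)" and B' = "\<lambda>p q. ?h p * ?h q"])
      (auto intro!: pm_linearI simp: linear_simps[OF l] distrib_left distrib_right pm_scale_mult_left
        pm_scale_mult_right mult_single single lookup_add power_add prod.distrib)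
  moreover have "?h 1 = 1"
    by (simp add: single flip: single_one) (simp add: single_one)
  ultimately show ?thesis using l by (simp add: algebra_hom_def)
qed

lemma poly_subst_gen [simp]: "poly_subst g (poly_gen i) = g i"
proof -
  have "(\<Prod>j\<in>UNIV. g j ^ Poly_Mapping.lookup (Poly_Mapping.single i 1) j) = (\<Prod>j\<in>UNIV. if j = i then g j else 1)"
    by (rule prod.cong) (auto simp: lookup_single)
  then show ?thesis by (simp add: poly_subst_def poly_gen_def)
qed

text \<open>Both sides are derivations along \<open>h\<close> and hence determined by their values
  on the variables.\<close>

lemma algebra_hom_intertwine:
  fixes h :: "('i, 'k::field) mpoly \<Rightarrow> ('j, 'k) mpoly"
  assumes h: "algebra_hom h" and D: "derivation pm_scale (*) D" "derivation pm_scale (*) D'"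
    and gen: "\<And>i. h (D (poly_gen i)) = D' (h (poly_gen i))"
  shows "h (D p) = D' (h p)"
proof -
  have D1: "D 1 = 0" "D' 1 = 0"
    using D unfolding derivation_def
    by (metis add_cancel_right_left mult.left_neutral mult.right_neutral)+
  have l: "Vector_Spaces.linear pm_scale pm_scale D" "Vector_Spaces.linear pm_scale pm_scale D'"
    and L: "\<And>u v. D (u * v) = D u * v + u * D v" "\<And>u v. D' (u * v) = D' u * v + u * D' v"
    using D unfolding derivation_def by auto
  show ?thesis
    by (induction p rule: mpoly_induct)
      (simp_all add: algebra_hom_simps[OF h] D1 L gen linear_simps[OF l(1)] linear_simps[OF l(2)])
qed


section \<open>Derivations of polynomial rings\<close>

definition poly_derivation :: "('i::finite \<Rightarrow> ('i, 'k::field) mpoly) \<Rightarrow> ('i, 'k) mpoly \<Rightarrow> ('i, 'k) mpoly"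
  where "poly_derivation g = linear_extension pm_scale
    (\<lambda>m. \<Sum>i\<in>UNIV. of_nat (Poly_Mapping.lookup m i) *
      (Poly_Mapping.single (m - Poly_Mapping.single i 1) 1 * g i))"

lemma derivation_poly_derivation:
  fixes g :: "'i::finite \<Rightarrow> ('i, 'k::field) mpoly"
  shows "derivation pm_scale (*) (poly_derivation g)"
proof -
  let ?D = "poly_derivation g"
  have l: "Vector_Spaces.linear pm_scale pm_scale ?D"
    unfolding poly_derivation_def by (rule pm.linear_linear_extension)
  have single: "?D (Poly_Mapping.single (m + n) 1) =
      ?D (Poly_Mapping.single m 1) * Poly_Mapping.single n 1 +
      Poly_Mapping.single m 1 * ?D (Poly_Mapping.single n 1)" for m n
  proof -
    let ?x = "\<lambda>m. Poly_Mapping.single m 1 :: ('i, 'k) mpoly"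
    let ?e = "\<lambda>i. Poly_Mapping.single i (1::nat)"
    \<comment> \<open>If the variable \<open>i\<close> does not occur in \<open>m\<close>, truncated
      subtraction of exponents breaks the identity of monomials, but both sides carry the factor
      0.\<close>
    have sub: "of_nat (Poly_Mapping.lookup m i) * ?x (m + n - ?e i)
        = of_nat (Poly_Mapping.lookup m i) * (?x (m - ?e i) * ?x n)" for i m n
    proof (cases "Poly_Mapping.lookup m i = 0")
      case False
      then have "m + n - ?e i = (m - ?e i) + n"
        by (intro poly_mapping_eqI) (auto simp: lookup_add lookup_minus lookup_single when_def)
      then show ?thesis by (simp add: mult_single)
    qed simp
    have "of_nat (Poly_Mapping.lookup (m + n) i) * (?x (m + n - ?e i) * g i)
       = of_nat (Poly_Mapping.lookup m i) * (?x (m - ?e i) * g i) * ?x n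
        + ?x m * (of_nat (Poly_Mapping.lookup n i) * (?x (n - ?e i) * g i))" for i
    proof -
      have "of_nat (Poly_Mapping.lookup (m + n) i) * (?x (m + n - ?e i) * g i)
        = (of_nat (Poly_Mapping.lookup m i) * ?x (m + n - ?e i)) * g i
         + (of_nat (Poly_Mapping.lookup n i) * ?x (n + m - ?e i)) * g i"
        by (simp add: lookup_add algebra_simps)
      then show ?thesis unfolding sub by (simp add: mult_ac)
    qed
    then show ?thesis
      by (simp add: poly_derivation_def sum.distrib sum_distrib_left sum_distrib_right)
  qed
  have "?D (p * q) = ?D p * q + p * ?D q" for p q
    by (rule bilinear_mpoly_eqI[where B = "\<lambda>p q. ?D (p * q)" and B' = "\<lambda>p q. ?D p * q + p * ?D q"])
      (auto intro!: pm_linearI simp: linear_simps[OF l] distrib_left distrib_right pm_scale_mult_left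
        pm_scale_mult_right pm.scale_right_distrib mult_single single)
  then show ?thesis using l by (simp add: derivation_def)
qed

lemma poly_derivation_gen [simp]: "poly_derivation g (poly_gen i) = g i"
proof -
  have "(\<Sum>j\<in>UNIV. of_nat (Poly_Mapping.lookup (Poly_Mapping.single i 1) j) *
      (Poly_Mapping.single (Poly_Mapping.single i 1 - Poly_Mapping.single j 1) 1 * g j))
    = (\<Sum>j\<in>UNIV. if j = i then g j else 0)"
    by (rule sum.cong) (auto simp: lookup_single single_one)
  then show ?thesis by (simp add: poly_derivation_def poly_gen_def)
qed

lemma derivation_mpolyD:
  fixes D :: "('i, 'k::field) mpoly \<Rightarrow> ('i, 'k) mpoly"
  assumes "derivation pm_scale (*) D"
  shows "Vector_Spaces.linear pm_scale pm_scale D" "D (p * q) = D p * q + p * D q" "D 1 = 0"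
proof -
  show "Vector_Spaces.linear pm_scale pm_scale D" and L: "\<And>p q. D (p * q) = D p * q + p * D q"
    using assms by (auto simp: derivation_def)
  show "D 1 = 0" using L[of 1 1] by simp
qed

lemma derivation_power:
  assumes "derivation pm_scale (*) (D :: ('i, 'k::field) mpoly \<Rightarrow> _)"
  shows "D (p ^ n) = of_nat n * p ^ (n - 1) * D p"
proof (induction n)
  case (Suc n)
  show ?case
    by (cases n) (use Suc in \<open>simp_all add: derivation_mpolyD(2,3)[OF assms] algebra_simps\<close>)
qed (simp add: derivation_mpolyD[OF assms])

lemma derivation_eqI:
  fixes D D' :: "('i, 'k::field) mpoly \<Rightarrow> ('i, 'k) mpoly"
  assumes "derivation pm_scale (*) D" "derivation pm_scale (*) D'"
    and "\<And>i. D (poly_gen i) = D' (poly_gen i)"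
  shows "D p = D' p"
  using algebra_hom_intertwine[of id D D'] assms
  by (simp add: algebra_hom_def pm_linearI)

text \<open>Turns each \<open>sl_2\<close> relation into an equality of derivations, which can be
  tested on the variables.\<close>

lemma derivation_combination:
  fixes D D' :: "('i, 'k::field) mpoly \<Rightarrow> ('i, 'k) mpoly"
  assumes D: "derivation pm_scale (*) D" and D': "derivation pm_scale (*) D'"
  shows "derivation pm_scale (*) (\<lambda>p. pm_scale c (D p))"
    "derivation pm_scale (*) (\<lambda>p. D (D' p) - D' (D p))"
  using derivation_mpolyD(2)[OF D] derivation_mpolyD(2)[OF D']
  by (auto simp: derivation_def algebra_simps linear_simps[OF derivation_mpolyD(1)[OF D]]
      linear_simps[OF derivation_mpolyD(1)[OF D']] pm_scale_mult_left pm_scale_mult_right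
      pm.scale_right_distrib pm.scale_right_diff_distrib intro!: pm_linearI)

text \<open>Every term of the Leibniz expansion of \<open>D^(a+b) (p * q)\<close> differentiates
  \<open>p\<close> at least \<open>a\<close> times or \<open>q\<close> at least \<open>b\<close>
  times. Induction on \<open>a + b\<close> replaces the binomial expansion.\<close>

lemma locally_nilpotent_mult:
  fixes D :: "('i, 'k::field) mpoly \<Rightarrow> ('i, 'k) mpoly"
  assumes D: "derivation pm_scale (*) D"
  shows "(D ^^ a) p = 0 \<Longrightarrow> (D ^^ b) q = 0 \<Longrightarrow> (D ^^ (a + b)) (p * q) = 0"
proof (induction "a + b" arbitrary: a b p q)
  case 0
  then show ?case by simp
next
  case (Suc n)
  note pow = linear_simps[OF linear_funpow[OF derivation_mpolyD(1)[OF D]]]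
  show ?case
  proof (cases "a = 0 \<or> b = 0")
    case True
    then show ?thesis using Suc.prems by (auto simp: pow)
  next
    case False
    then obtain a' b' where ab: "a = Suc a'" "b = Suc b'" by (metis not0_implies_Suc)
    have "(D ^^ (a' + b)) (D p * q) = 0" "(D ^^ (a + b')) (p * D q) = 0"
      using Suc.hyps(1)[of a' b "D p" q] Suc.hyps(1)[of a b' p "D q"] Suc.hyps(2) Suc.prems
      by (simp_all add: ab funpow_swap1)
    then have "(D ^^ (a' + b)) (D p * q) + (D ^^ (a' + b)) (p * D q) = 0" by (simp add: ab)
    then have "(D ^^ (a' + b)) (D p * q + p * D q) = 0" by (simp only: pow)
    then show ?thesis by (simp add: ab(1) funpow_Suc_right derivation_mpolyD(2)[OF D] del: funpow.simps(2))
  qed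
qed

lemma locally_nilpotentI:
  fixes D :: "('i, 'k::field) mpoly \<Rightarrow> ('i, 'k) mpoly"
  assumes D: "derivation pm_scale (*) D" and gen: "\<And>i. \<exists>n. (D ^^ n) (poly_gen i) = 0"
  shows "\<exists>n. (D ^^ n) p = 0"
proof (induction p rule: mpoly_induct)
  case one
  show ?case by (rule exI[of _ 1]) (simp add: derivation_mpolyD(3)[OF D])
next
  case (gen i p)
  then show ?case using locally_nilpotent_mult[OF D] assms(2) by blast
next
  note pow = linear_simps[OF linear_funpow[OF derivation_mpolyD(1)[OF D]]]
  case (add p q)
  then obtain m n where "(D ^^ m) p = 0" "(D ^^ n) q = 0" by blast
  then have "(D ^^ (n + m)) p = 0" "(D ^^ (m + n)) q = 0" by (simp_all only: funpow_add o_apply pow)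
  then show ?case by (intro exI[of _ "m + n"]) (simp add: pow add.commute)
next
  note pow = linear_simps[OF linear_funpow[OF derivation_mpolyD(1)[OF D]]]
  case (scale c p)
  then show ?case by (auto simp: pow)
qed

text \<open>A product of eigenvectors is an eigenvector for the sum of the eigenvalues, so the span
  is closed under multiplication.\<close>

lemma eigenvectors_spanI:
  fixes D :: "('i, 'k::field) mpoly \<Rightarrow> ('i, 'k) mpoly"
  assumes D: "derivation pm_scale (*) D"
    and gen: "\<And>i. poly_gen i \<in> pm.span (eigenvectors pm_scale D)"
  shows "p \<in> pm.span (eigenvectors pm_scale D)"
proof -
  let ?E = "eigenvectors pm_scale D"
  have mult1: "u * v \<in> ?E" if "u \<in> ?E" "v \<in> ?E" for u v
  proof -
    obtain a b where "D u = pm_scale a u" "D v = pm_scale b v"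
      using \<open>u \<in> ?E\<close> \<open>v \<in> ?E\<close> by (auto simp: eigenvectors_def)
    then have "D (u * v) = pm_scale (a + b) (u * v)"
      by (simp add: derivation_mpolyD(2)[OF D] pm_scale_mult_left pm_scale_mult_right
          pm.scale_left_distrib)
    then show ?thesis by (auto simp: eigenvectors_def)
  qed
  have mult2: "u * v \<in> pm.span ?E" if u: "u \<in> ?E" and "v \<in> pm.span ?E" for u v
    using that(2)
  proof (induction rule: pm.span_induct_alt)
    case (step c x y)
    then have "pm_scale c (u * x) + u * y \<in> pm.span ?E"
      using mult1[OF u] by (intro pm.span_add[OF pm.span_scale[OF pm.span_base]]) auto
    then show ?case by (simp add: distrib_left pm_scale_mult_right)
  qed (simp add: pm.span_zero)
  have mult: "u * v \<in> pm.span ?E" if "u \<in> pm.span ?E" and v: "v \<in> pm.span ?E" for u v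
    using that(1)
  proof (induction rule: pm.span_induct_alt)
    case (step c x y)
    then have "pm_scale c (x * v) + y * v \<in> pm.span ?E"
      using mult2[OF _ v] by (intro pm.span_add pm.span_scale) auto
    then show ?case by (simp add: distrib_right pm_scale_mult_left)
  qed (simp add: pm.span_zero)
  show ?thesis
  proof (induction p rule: mpoly_induct)
    case one
    have "D 1 = pm_scale 0 1" using derivation_mpolyD(3)[OF D] by simp
    then show ?case by (auto simp: eigenvectors_def intro!: pm.span_base)
  next
    case (gen i p)
    then show ?case using mult assms(2) by blast
  qed (auto intro: pm.span_add pm.span_scale)
qed


section \<open>Finiteness of constants\<close>

text \<open>The assumptions \<open>nilpotent_E\<close>, \<open>nilpotent_F\<close> and
  \<open>weights\<close> take the place of local finiteness of the action. Compatibility of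
  \<open>ev\<close> is demanded for \<open>E\<close> alone and must fail for \<open>F\<close>, since
  \<open>ev (F x) = 1\<close> while \<open>F (ev x) = 0\<close>.\<close>

locale sl2_poly = sl2_rep pm_scale E F H
  for E F H :: "('j::finite, 'k::field_char_0) mpoly \<Rightarrow> ('j, 'k) mpoly" +
  fixes x y :: "('j, 'k) mpoly" and ev :: "('j, 'k) mpoly \<Rightarrow> ('j, 'k) mpoly"
  assumes der_E: "derivation pm_scale (*) E" and der_F: "derivation pm_scale (*) F"
    and nilpotent_E: "\<exists>n. (E ^^ n) p = 0" and nilpotent_F: "\<exists>n. (F ^^ n) p = 0"
    and weights: "p \<in> pm.span (eigenvectors pm_scale H)"
    and xy: "E x = 0" "E y = x" "F x = y" "F y = 0"
    and ev_hom: "algebra_hom ev" and ev_xy: "ev x = 0" "ev y = 1" and ev_E: "ev (E p) = E (ev p)"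
begin

lemma H_eq: "H p = E (F p) - F (E p)"
  by (simp add: EF)

lemma der_H: "derivation pm_scale (*) H"
  using derivation_combination(2)[OF der_E der_F] by (simp add: H_eq[abs_def])

lemmas Leibniz = derivation_mpolyD(2)[OF der_E] derivation_mpolyD(2)[OF der_F] derivation_mpolyD(2)[OF der_H]

text \<open>The lift is \<open>y^n exp (- (x/y) F) v\<close>, where \<open>n\<close> is the weight of \<open>v\<close>.\<close>

lemma lift_highest_weight:
  assumes "E v = 0" "H v = pm_scale c v"
  shows "\<exists>u. E u = 0 \<and> F u = 0 \<and> ev u = ev v"
proof (cases "v = 0")
  case True
  then show ?thesis by (intro exI[of _ 0]) (simp add: E_simps F_simps)
next
  case False
  from nilpotent_F obtain N where "(F ^^ N) v = 0" by blast
  with highest_weight[OF assms] False obtain n where c: "c = of_nat n" and n: "(F ^^ Suc n) v = 0"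
    by blast
  define s :: "nat \<Rightarrow> 'k" where "s j = (- 1) ^ j / fact j" for j
  have s_Suc: "of_nat (Suc j) * s (Suc j) = - (s j :: 'k)" for j
    by (simp add: s_def divide_simps del: of_nat_Suc)
  define t where "t j = pm_scale (s j) ((F ^^ j) v * (x ^ j * y ^ (n - j)))" for j
  \<comment> \<open>Up to the factor \<open>s m\<close>, \<open>A m\<close> and \<open>B m\<close>
    are what is left of \<open>E\<close> and \<open>F\<close> of the partial sum up to
    \<open>m\<close>. At \<open>m = n\<close> the first dies by its factor \<open>n - m\<close>, the
    second by \<open>(F ^^ Suc n) v = 0\<close>.\<close>
  define A where "A j = pm_scale (of_nat (n - j)) ((F ^^ j) v * (x ^ Suc j * y ^ (n - Suc j)))" for j
  define B where "B j = (F ^^ Suc j) v * (x ^ j * y ^ (n - j))" for j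
  have Ext: "E (x ^ j * y ^ (n - j)) = pm_scale (of_nat (n - j)) (x ^ Suc j * y ^ (n - Suc j))" for j
    by (simp add: Leibniz derivation_power[OF der_E] xy pm_scale_of_nat mult_ac)
  have Fxy: "F (x ^ Suc j * y ^ (n - Suc j)) = pm_scale (of_nat (Suc j)) (x ^ j * y ^ (n - j))"
    if "Suc j \<le> n" for j
  proof -
    have "n - j = Suc (n - Suc j)" using that by simp
    then show ?thesis
      by (simp add: Leibniz derivation_power[OF der_F] xy pm_scale_of_nat mult_ac del: of_nat_Suc power_Suc)
        (simp add: mult_ac)
  qed
  have Et: "E (\<Sum>j\<le>m. t j) = pm_scale (s m) (A m)" if "m \<le> n" for m
    using that
  proof (induction m)
    case 0
    show ?case by (simp add: t_def A_def E_simps Leibniz Ext[of 0, simplified] assms(1) pm_scale_mult_right)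
  next
    case (Suc m)
    have EFm: "E ((F ^^ Suc m) v) = pm_scale (of_nat (Suc m) * of_nat (n - m)) ((F ^^ m) v)"
      using E_F_pow[OF assms(2), of m] Suc.prems by (simp add: assms(1) F_pow_simps F_simps c of_nat_diff)
    have "E (t (Suc m)) = pm_scale (s (Suc m)) (A (Suc m))
        + pm_scale (of_nat (Suc m) * s (Suc m)) (A m)"
      unfolding t_def E_simps Leibniz(1)[of "(F ^^ Suc m) v"] EFm Ext A_def
      by (simp only: pm_scale_mult_left pm_scale_mult_right pm.scale_right_distrib pm.scale_scale)
        (simp add: mult_ac add_ac)
    then show ?case using Suc by (simp add: E_simps s_Suc del: of_nat_Suc)
  qed
  have Ft: "F (\<Sum>j\<le>m. t j) = pm_scale (s m) (B m)" if "m \<le> n" for m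
    using that
  proof (induction m)
    case 0
    show ?case by (simp add: t_def B_def F_simps Leibniz derivation_power[OF der_F] xy)
  next
    case (Suc m)
    have "F (t (Suc m)) = pm_scale (s (Suc m)) (B (Suc m)) + pm_scale (of_nat (Suc m) * s (Suc m)) (B m)"
      unfolding t_def F_simps Leibniz(2)[of "(F ^^ Suc m) v"] Fxy[OF Suc.prems] B_def
      by (simp only: pm_scale_mult_left pm_scale_mult_right pm.scale_right_distrib pm.scale_scale)
        (simp add: mult_ac add_ac)
    then show ?case using Suc by (simp add: F_simps s_Suc del: of_nat_Suc)
  qed
  have "ev (t j) = (if j = 0 then ev v else 0)" for j
    by (simp add: t_def s_def algebra_hom_simps[OF ev_hom] ev_xy zero_power)
  then have "ev (\<Sum>j\<le>n. t j) = ev v" by (simp add: algebra_hom_simps(6)[OF ev_hom])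
  moreover have "A n = 0" "B n = 0" using n by (simp_all add: A_def B_def)
  ultimately show ?thesis using Et[of n] Ft[of n] by (intro exI[of _ "\<Sum>j\<le>n. t j"]) simp
qed

text \<open>\<open>E\<close> raises every weight by 2, so it keeps the weight components of
  \<open>v\<close> apart; the components of a constant are constants and are lifted one by
  one.\<close>

lemma lift:
  assumes "E v = 0"
  shows "\<exists>u. E u = 0 \<and> F u = 0 \<and> ev u = ev v"
proof -
  obtain W g where W: "finite W" "\<And>c. H (g c) = pm_scale c (g c)" and v: "v = (\<Sum>c\<in>W. g c)"
    using pm.eigenvector_decomposition[OF linear_H weights] by blast
  have "E (g c) = 0" if "c \<in> W" for c
  proof -
    \<comment> \<open>Reindexing by \<open>c + 2\<close> places each summand under its own weight,
      as \<open>eigenvectors_independent\<close> demands.\<close>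
    have "(\<Sum>c\<in>(\<lambda>c. c + 2) ` W. E (g (c - 2))) = 0"
      using assms by (subst sum.reindex) (simp_all add: v E_simps)
    moreover have "H (E (g (c - 2))) = pm_scale c (E (g (c - 2)))" for c
      using weight_E[OF W(2), of "c - 2"] by simp
    ultimately have "E (g (c + 2 - 2)) = 0"
      using pm.eigenvectors_independent[OF linear_H, of "(\<lambda>c. c + 2) ` W" "\<lambda>c. E (g (c - 2))" "c + 2"]
        W(1) that by auto
    then show ?thesis by simp
  qed
  then have "\<forall>c\<in>W. \<exists>u. E u = 0 \<and> F u = 0 \<and> ev u = ev (g c)"
    using lift_highest_weight W(2) by blast
  then obtain u where u: "\<And>c. c \<in> W \<Longrightarrow> E (u c) = 0 \<and> F (u c) = 0 \<and> ev (u c) = ev (g c)"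
    by metis
  then show ?thesis
    by (intro exI[of _ "\<Sum>c\<in>W. u c"]) (simp add: v E_simps F_simps algebra_hom_simps(6)[OF ev_hom])
qed

text \<open>As \<open>v\<close> and the generators have weight zero, the relation survives when
  every coefficient is replaced by its component of weight zero.\<close>

lemma weight_zero_coefficients:
  assumes "finite G" "\<And>g. g \<in> G \<Longrightarrow> H g = 0" "H v = 0" "v = (\<Sum>g\<in>G. c g * g)"
  shows "\<exists>c. (\<forall>g. H (c g) = 0) \<and> v = (\<Sum>g\<in>G. c g * g)"
proof -
  have "\<exists>W f. finite W \<and> (\<forall>a. H (f a) = pm_scale a (f a)) \<and> (\<forall>a. a \<notin> W \<longrightarrow> f a = 0)
      \<and> c g = (\<Sum>a\<in>W. f a)" for g
    using pm.eigenvector_decomposition[OF linear_H weights] by blast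
  then obtain W f where W: "\<And>g. finite (W g)" and f: "\<And>g a. H (f g a) = pm_scale a (f g a)"
    "\<And>g a. a \<notin> W g \<Longrightarrow> f g a = 0" "\<And>g. c g = (\<Sum>a\<in>W g. f g a)"
    by metis
  \<comment> \<open>The weight 0 is inserted so that it can be singled out even if no coefficient
    has such a component.\<close>
  define V where "V = insert 0 (\<Union>(W ` G))"
  have V: "finite V" using W assms(1) by (simp add: V_def)
  have c: "c g = (\<Sum>a\<in>V. f g a)" if "g \<in> G" for g
    unfolding f(3) using V that f(2) by (intro sum.mono_neutral_left) (auto simp: V_def)
  \<comment> \<open>The component of weight \<open>a\<close> of the difference of the two sides of
    the relation.\<close>
  let ?u = "\<lambda>a. (\<Sum>g\<in>G. f g a * g) - (if a = 0 then v else 0)"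
  have "H (?u a) = pm_scale a (?u a)" for a
    using assms(2,3)
    by (simp add: H_simps Leibniz f(1) pm.scale_right_diff_distrib pm.scale_sum_right pm_scale_mult_left)
  moreover have "(\<Sum>a\<in>V. ?u a) = 0"
  proof -
    have "(\<Sum>a\<in>V. \<Sum>g\<in>G. f g a * g) = v"
      unfolding assms(4) by (subst sum.swap) (simp add: c sum_distrib_right)
    then show ?thesis using V by (simp add: sum_subtractf V_def)
  qed
  ultimately have "?u 0 = 0"
    using pm.eigenvectors_independent[OF linear_H V, of ?u 0] by (simp add: V_def)
  then show ?thesis using f(1)[of _ 0] by (intro exI[of _ "\<lambda>g. f g 0"]) simp
qed

text \<open>By the Leibniz rule, \<open>E\<close> and \<open>F\<close> are linear over the
  invariants.\<close>

lemma reynolds_mult: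
  assumes "E g = 0" "F g = 0"
  shows "reynolds N (c * g) = reynolds N c * g"
proof -
  have "(E ^^ k) (a * g) = (E ^^ k) a * g" "(F ^^ k) (a * g) = (F ^^ k) a * g" for k a
    by (induction k) (simp_all add: Leibniz assms)
  then show ?thesis by (simp add: reynolds_def sum_distrib_right pm_scale_mult_left)
qed

text \<open>The coefficients are first reduced to weight zero, because \<open>E_reynolds\<close> is
  available only there.\<close>

lemma invariant_coefficients:
  assumes "finite G" "\<And>g. g \<in> G \<Longrightarrow> E g = 0 \<and> F g = 0" "E v = 0" "F v = 0"
    and "v = (\<Sum>g\<in>G. c g * g)"
  shows "\<exists>c. (\<forall>g\<in>G. E (c g) = 0) \<and> v = (\<Sum>g\<in>G. c g * g)"
proof -
  have "H v = 0" "\<And>g. g \<in> G \<Longrightarrow> H g = 0" using assms(2-4) by (simp_all add: H_eq E_simps F_simps)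
  then obtain c where c: "\<And>g. H (c g) = 0" and v: "v = (\<Sum>g\<in>G. c g * g)"
    using weight_zero_coefficients[OF assms(1) _ _ assms(5)] by blast
  have "\<forall>g. \<exists>n. (E ^^ n) (c g) = 0" using nilpotent_E by blast
  then obtain n where n: "\<And>g. (E ^^ n g) (c g) = 0" by metis
  \<comment> \<open>One truncation order for all coefficients; the inserted 0 covers an empty
    \<open>G\<close>.\<close>
  define N where "N = Max (insert 0 (n ` G))"
  have "(E ^^ Suc N) (c g) = 0" if "g \<in> G" for g
  proof -
    have "n g \<le> Suc N" using assms(1) that by (simp add: N_def le_SucI)
    then have "(E ^^ Suc N) (c g) = (E ^^ (Suc N - n g)) ((E ^^ n g) (c g))"
      by (metis comp_apply funpow_add le_add_diff_inverse2)
    then show ?thesis using n by (simp add: linear_simps(1)[OF linear_funpow[OF linear_E]])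
  qed
  then have "E (reynolds (Suc N) (c g)) = 0" if "g \<in> G" for g
    using that E_reynolds[OF c] by (simp add: F_pow_simps)
  \<comment> \<open>The order \<open>Suc N\<close> is positive, so the term \<open>k = 0\<close>,
    which is \<open>v\<close> itself, is present; \<open>E v = 0\<close> kills all the
    others.\<close>
  moreover have "reynolds (Suc N) v = v"
  proof -
    have "(E ^^ Suc k) v = 0" for k
      by (simp add: assms(3) funpow_Suc_right linear_simps(1)[OF linear_funpow[OF linear_E]]
          del: funpow.simps)
    then show ?thesis
      unfolding reynolds_def sum.lessThan_Suc_shift by (simp add: F_pow_simps del: funpow.simps)
  qed
  moreover have "reynolds (Suc N) v = (\<Sum>g\<in>G. reynolds (Suc N) (c g) * g)"
  proof -
    have "reynolds (Suc N) (\<Sum>g\<in>G. c g * g) = (\<Sum>g\<in>G. reynolds (Suc N) (c g * g))"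
      unfolding reynolds_def
      by (simp only: linear_simps[OF linear_funpow[OF linear_E]] F_pow_simps pm.scale_sum_right)
        (rule sum.swap)
    then show ?thesis unfolding v[symmetric] using assms(2) by (simp add: reynolds_mult)
  qed
  ultimately show ?thesis by (intro exI[of _ "\<lambda>g. reynolds (Suc N) (c g)"]) simp
qed

text \<open>Evaluating a relation among the lifts returns a relation among the constants, whose
  coefficients are still constants because \<open>ev\<close> commutes with \<open>E\<close>. The
  generators lie in \<open>S\<close> because the basis theorem selects them among the lifts.\<close>

theorem constants_finitely_generated:
  assumes "S \<subseteq> {v. ev v = v \<and> E v = 0}"
  shows "\<exists>S0\<subseteq>S. finite S0 \<and> (\<forall>s\<in>S. \<exists>c. (\<forall>g\<in>S0. E (c g) = 0) \<and> s = (\<Sum>g\<in>S0. c g * g))"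
proof -
  have "\<forall>s\<in>S. \<exists>u. E u = 0 \<and> F u = 0 \<and> ev u = s" using assms lift by fastforce
  then obtain l where l: "\<And>s. s \<in> S \<Longrightarrow> E (l s) = 0 \<and> F (l s) = 0 \<and> ev (l s) = s" by metis
  have "\<exists>G0\<subseteq>l ` S. finite G0 \<and> l ` S \<subseteq> lin_span UNIV G0"
    using noetherian_mpoly[where 'i = 'j and 'k = 'k] unfolding noetherian_def by simp
  then obtain G0 where "G0 \<subseteq> l ` S" "finite G0" and G0: "l ` S \<subseteq> lin_span UNIV G0"
    by auto
  then obtain S0 where S0: "S0 \<subseteq> S" "finite S0" "G0 = l ` S0" by (meson finite_subset_image)
  have inj: "inj_on l S0" using l S0(1) by (metis inj_on_def subsetD)
  have "\<exists>c. (\<forall>g\<in>S0. E (c g) = 0) \<and> s = (\<Sum>g\<in>S0. c g * g)" if "s \<in> S" for s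
  proof -
    have "is_subring (UNIV :: ('j, 'k) mpoly set)" by (simp add: is_subring_def)
    moreover have "l s \<in> lin_span UNIV G0" using G0 that by blast
    ultimately obtain c where "l s = (\<Sum>g\<in>G0. c g * g)"
      using lin_span_finite_sum[of UNIV G0 "l s"] S0(2,3) by blast
    moreover have "finite G0" "\<And>g. g \<in> G0 \<Longrightarrow> E g = 0 \<and> F g = 0"
      using l S0 by auto
    ultimately have "\<exists>c. (\<forall>g\<in>G0. E (c g) = 0) \<and> l s = (\<Sum>g\<in>G0. c g * g)"
      using l[OF that] by (intro invariant_coefficients) auto
    then obtain c where c: "\<forall>g\<in>G0. E (c g) = 0" "l s = (\<Sum>g\<in>G0. c g * g)" by blast
    have "ev (l s) = (\<Sum>g\<in>S0. ev (c (l g)) * ev (l g))"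
      by (simp add: c(2) S0(3) sum.reindex[OF inj] algebra_hom_simps[OF ev_hom])
    then have "s = (\<Sum>g\<in>S0. ev (c (l g)) * g)"
      using l that S0(1) by (simp add: subset_iff)
    moreover have "E (ev (c (l g))) = 0" if "g \<in> S0" for g
      using c(1) that S0(3) algebra_hom_simps(1)[OF ev_hom] by (simp flip: ev_E)
    ultimately show ?thesis by (intro exI[of _ "\<lambda>g. ev (c (l g))"]) simp
  qed
  with S0(1,2) show ?thesis by blast
qed

end


section \<open>Nilpotent operators\<close>

lemma vec_linearI:
  fixes T :: "'k::field ^ 'n \<Rightarrow> 'k ^ 'm"
  assumes "\<And>u v. T (u + v) = T u + T v" "\<And>c u. T (c *s u) = c *s T u"
  shows "Vector_Spaces.linear (*s) (*s) T"
  using assms by unfold_locales (auto simp: vector_add_ldistrib vector_sadd_rdistrib)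

text \<open>The triple \<open>e, f, h\<close> is an \<open>sl\<^sub>2\<close>-triple on the range of the projection \<open>P\<close>, and \<open>f\<close> and \<open>h\<close>
  vanish on the kernel of \<open>P\<close>.\<close>

definition sl2_on ::
    "('k::field ^ 'n \<Rightarrow> 'k ^ 'n) \<Rightarrow> ('k ^ 'n \<Rightarrow> 'k ^ 'n) \<Rightarrow> ('k ^ 'n \<Rightarrow> 'k ^ 'n) \<Rightarrow> ('k ^ 'n \<Rightarrow> 'k ^ 'n) \<Rightarrow> bool"
  where "sl2_on e P f h \<longleftrightarrow>
    Vector_Spaces.linear (*s) (*s) P \<and> Vector_Spaces.linear (*s) (*s) f \<and> Vector_Spaces.linear (*s) (*s) h \<and>
    (\<forall>v. P (P v) = P v \<and> e (P v) = P (e v) \<and> f (P v) = f v \<and> P (f v) = f v \<and> h (P v) = h v \<and> P (h v) = h v) \<and>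
    (\<forall>v. e (f v) = f (e v) + h v) \<and> (\<forall>v. h (e v) = e (h v) + 2 *s e (P v)) \<and>
    (\<forall>v. h (f v) = f (h v) - 2 *s f v) \<and> (\<exists>N. \<forall>v. (f ^^ Suc N) v = 0) \<and>
    (\<forall>v. P v \<in> vec.span {u. P u = u \<and> (\<exists>c. h u = c *s u)})"

text \<open>The sums \<open>f + f'\<close> and \<open>h + h'\<close> work: each operator factors
  through its own projection on both sides, so all mixed products vanish.\<close>

lemma sl2_on_sum:
  fixes e :: "'k::field ^ 'n \<Rightarrow> 'k ^ 'n"
  assumes e: "Vector_Spaces.linear (*s) (*s) e"
    and 1: "sl2_on e P f h" and 2: "sl2_on e P' f' h'" and ortho: "\<And>v. P (P' v) = 0" "\<And>v. P' (P v) = 0"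
  shows "\<exists>f h. sl2_on e (\<lambda>v. P v + P' v) f h"
proof (intro exI)
  have lin: "Vector_Spaces.linear (*s) (*s) P" "Vector_Spaces.linear (*s) (*s) f" "Vector_Spaces.linear (*s) (*s) h"
      "Vector_Spaces.linear (*s) (*s) P'" "Vector_Spaces.linear (*s) (*s) f'" "Vector_Spaces.linear (*s) (*s) h'"
    and P: "\<And>v. P (P v) = P v" "\<And>v. e (P v) = P (e v)" "\<And>v. f (P v) = f v" "\<And>v. P (f v) = f v"
      "\<And>v. h (P v) = h v" "\<And>v. P (h v) = h v"
      "\<And>v. P' (P' v) = P' v" "\<And>v. e (P' v) = P' (e v)" "\<And>v. f' (P' v) = f' v" "\<And>v. P' (f' v) = f' v"
      "\<And>v. h' (P' v) = h' v" "\<And>v. P' (h' v) = h' v"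
    and rel: "\<And>v. e (f v) = f (e v) + h v" "\<And>v. h (e v) = e (h v) + 2 *s e (P v)" "\<And>v. h (f v) = f (h v) - 2 *s f v"
      "\<And>v. e (f' v) = f' (e v) + h' v" "\<And>v. h' (e v) = e (h' v) + 2 *s e (P' v)" "\<And>v. h' (f' v) = f' (h' v) - 2 *s f' v"
    using 1 2 unfolding sl2_on_def by auto
  note l = linear_simps[OF lin(1)] linear_simps[OF lin(2)] linear_simps[OF lin(3)]
    linear_simps[OF lin(4)] linear_simps[OF lin(5)] linear_simps[OF lin(6)] linear_simps[OF e]
  let ?P = "\<lambda>v. P v + P' v" and ?f = "\<lambda>v. f v + f' v" and ?h = "\<lambda>v. h v + h' v"
  have cross: "f (P' v) = 0" "h (P' v) = 0" "f' (P v) = 0" "h' (P v) = 0" for v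
    using P(3)[of "P' v"] P(5)[of "P' v"] P(9)[of "P v"] P(11)[of "P v"] by (simp_all add: ortho l)
  have cross2: "f (f' v) = 0" "f (h' v) = 0" "h (f' v) = 0" "h (h' v) = 0" "P (f' v) = 0" "P (h' v) = 0"
    "f' (f v) = 0" "f' (h v) = 0" "h' (f v) = 0" "h' (h v) = 0" "P' (f v) = 0" "P' (h v) = 0" for v
    by (metis cross ortho P)+
  \<comment> \<open>Restricted to positive exponents: at exponent 0 the right side would be
    \<open>2 v\<close>.\<close>
  have pow: "(?f ^^ Suc n) v = (f ^^ Suc n) v + (f' ^^ Suc n) v" for n v
  proof (induction n)
    case (Suc n)
    have "?f ((f ^^ Suc n) v + (f' ^^ Suc n) v) = f ((f ^^ Suc n) v) + f' ((f' ^^ Suc n) v)"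
      by (simp add: l cross2)
    then show ?case using Suc by simp
  qed simp
  obtain N N' where N: "\<And>v. (f ^^ Suc N) v = 0" "\<And>v. (f' ^^ Suc N') v = 0"
    using 1 2 unfolding sl2_on_def by blast
  have "(?f ^^ Suc (N + N')) v = 0" for v
  proof -
    have "(f ^^ Suc (N + N')) v = (f ^^ Suc N) ((f ^^ N') v)"
      "(f' ^^ Suc (N + N')) v = (f' ^^ Suc N') ((f' ^^ N) v)"
      by (metis add_Suc comp_apply funpow_add, metis add_Suc add.commute comp_apply funpow_add)
    then show ?thesis unfolding pow by (simp only: N add_0_left)
  qed
  moreover have "?P v \<in> vec.span {u. ?P u = u \<and> (\<exists>c. ?h u = c *s u)}" for v
  proof -
    let ?S = "{u. P u = u \<and> (\<exists>c. h u = c *s u)}" and ?S' = "{u. P' u = u \<and> (\<exists>c. h' u = c *s u)}"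
    let ?T = "{u. ?P u = u \<and> (\<exists>c. ?h u = c *s u)}"
    have "P' u = 0 \<and> h' u = 0" if "P u = u" for u using cross(4)[of u] ortho(2)[of u] that by simp
    then have "?S \<subseteq> ?T" by auto
    moreover have "P u = 0 \<and> h u = 0" if "P' u = u" for u using cross(2)[of u] ortho(1)[of u] that by simp
    then have "?S' \<subseteq> ?T" by auto
    moreover have "P v \<in> vec.span ?S" "P' v \<in> vec.span ?S'" using 1 2 unfolding sl2_on_def by blast+
    ultimately show ?thesis by (meson vec.span_add vec.span_mono subsetD)
  qed
  ultimately show "sl2_on e ?P ?f ?h"
    unfolding sl2_on_def
    by (intro conjI allI vec_linearI exI[of _ "N + N'"])
      (simp_all add: l cross cross2 ortho P rel vector_add_ldistrib algebra_simps del: funpow.simps)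
qed

text \<open>Splits off a Jordan block of maximal size: \<open>w\<close> is chosen such that the functional \<open>\<lambda>u. u $ i\<close> is
  \<open>1\<close> on \<open>e^l w\<close> and \<open>0\<close> on \<open>e^t w\<close> for \<open>t < l\<close>, so that \<open>u \<mapsto> \<Sum>\<^sub>s ((e^(l-s) P u) $ i) e^s w\<close> is a
  projection onto the block that commutes with \<open>e\<close>.\<close>

lemma sl2_on_cyclic:
  fixes e :: "'k::field ^ 'n::finite \<Rightarrow> 'k ^ 'n"
  assumes e: "Vector_Spaces.linear (*s) (*s) e" and P: "Vector_Spaces.linear (*s) (*s) P"
    and PP: "\<And>v. P (P v) = P v" and eP: "\<And>v. e (P v) = P (e v)"
    and nil: "\<And>v. (e ^^ Suc l) (P v) = 0" and "(e ^^ l) (P v0) \<noteq> 0"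
  shows "\<exists>R f h w. sl2_on e R f h \<and> (\<forall>v. R (P v) = R v \<and> P (R v) = R v) \<and> R w = w \<and> w \<noteq> 0"
proof -
  note pow = linear_simps[OF linear_funpow[OF e]]
  have eP_pow: "(e ^^ n) (P v) = P ((e ^^ n) v)" for n v by (induction n) (simp_all add: eP)
  obtain i where i: "(e ^^ l) (P v0) $ i \<noteq> 0" using assms(6) by (auto simp: vec_eq_iff)
  \<comment> \<open>\<open>j\<close> counts the exponents just below \<open>l\<close> at which the
    coordinate \<open>i\<close> has already been made to vanish.\<close>
  have "\<exists>w. P w = w \<and> (e ^^ l) w $ i = 1 \<and> (\<forall>t. l - j \<le> t \<longrightarrow> t < l \<longrightarrow> (e ^^ t) w $ i = 0)"
    if "j \<le> l" for j
    using that
  proof (induction j)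
    case 0
    show ?case using i
      by (intro exI[of _ "(1 / ((e ^^ l) (P v0) $ i)) *s P v0"]) (simp add: linear_simps[OF P] PP pow)
  next
    case (Suc j)
    then obtain w where w: "P w = w" "(e ^^ l) w $ i = 1"
      "\<And>t. l - j \<le> t \<Longrightarrow> t < l \<Longrightarrow> (e ^^ t) w $ i = 0" by auto
    have zero: "(e ^^ n) w = 0" if "Suc l \<le> n" for n
      using nil[of w] that by (metis w(1) funpow_add comp_apply le_add_diff_inverse2 pow(1))
    let ?a = "(e ^^ (l - Suc j)) w $ i"
    \<comment> \<open>At exponent \<open>l - (j + 1)\<close> the correction subtracts
      \<open>?a\<close> times the coordinate of \<open>e^l w\<close>, which is 1; at larger
      exponents it vanishes because \<open>e^(l+1)\<close> is zero on the range of
      \<open>P\<close>.\<close>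
    let ?w = "w - ?a *s (e ^^ Suc j) w"
    have ew: "(e ^^ t) ?w = (e ^^ t) w - ?a *s (e ^^ (t + Suc j)) w" for t
      unfolding funpow_add by (simp only: pow o_apply)
    have "P ?w = ?w" using eP_pow[of "Suc j" w] w(1) by (simp add: linear_simps[OF P])
    moreover have "(e ^^ l) ?w $ i = 1" using w(2) zero[of "l + Suc j"] unfolding ew by simp
    moreover have "(e ^^ t) ?w $ i = 0" if t: "l - Suc j \<le> t" "t < l" for t
    proof (cases "t = l - Suc j")
      case True
      then have "t + Suc j = l" using Suc.prems by simp
      then show ?thesis unfolding ew using w(2) True by simp
    next
      case False
      then have "l - j \<le> t" "Suc l \<le> t + Suc j" using t by auto
      then show ?thesis unfolding ew using zero[of "t + Suc j"] w(3)[of t] t(2) by simp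
    qed
    ultimately show ?case by blast
  qed
  from this[of l] obtain w where w: "P w = w" "(e ^^ l) w $ i = 1" "\<And>t. t < l \<Longrightarrow> (e ^^ t) w $ i = 0"
    by auto
  define b where "b s = (e ^^ s) w" for s
  have b_zero: "b n = 0" if "Suc l \<le> n" for n
    unfolding b_def using nil[of w] that by (metis w(1) funpow_add comp_apply le_add_diff_inverse2 pow(1))
  have eb: "e (b s) = b (Suc s)" for s by (simp add: b_def)
  have Pb: "P (b s) = b s" for s unfolding b_def eP_pow[symmetric] w(1) ..
  define \<rho> where "\<rho> s u = (e ^^ (l - s)) (P u) $ i" for s u
  have \<rho>_lin: "\<rho> s (u + v) = \<rho> s u + \<rho> s v" "\<rho> s (c *s u) = c * \<rho> s u" for s u v c
    by (simp_all add: \<rho>_def linear_simps[OF P] pow)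
  have \<rho>P: "\<rho> s (P u) = \<rho> s u" for s u by (simp add: \<rho>_def PP)
  have \<rho>b: "\<rho> s (b t) = (if s = t then 1 else 0)" if "s \<le> l" for s t
  proof -
    have "(e ^^ (l - s)) (P (b t)) = b (l - s + t)" unfolding Pb by (simp add: b_def funpow_add)
    moreover have "b (l - s + t) $ i = (if s = t then 1 else 0)"
    proof (cases "t \<le> s")
      case True
      then show ?thesis using w(2) w(3)[of "l - s + t"] that by (auto simp: b_def)
    next
      case False
      then show ?thesis using b_zero[of "l - s + t"] that by simp
    qed
    ultimately show ?thesis by (simp add: \<rho>_def)
  qed
  have \<rho>e: "\<rho> 0 (e u) = 0" "Suc s \<le> l \<Longrightarrow> \<rho> (Suc s) (e u) = \<rho> s u" for s u
  proof -
    show "\<rho> 0 (e u) = 0" using nil[of u] by (simp add: \<rho>_def funpow_swap1 flip: eP)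
    assume "Suc s \<le> l"
    then have "l - s = Suc (l - Suc s)" by simp
    then show "\<rho> (Suc s) (e u) = \<rho> s u" by (simp add: \<rho>_def funpow_swap1 flip: eP)
  qed
  define R where "R u = (\<Sum>s<Suc l. \<rho> s u *s b s)" for u
  \<comment> \<open>Since \<open>e\<close> raises \<open>s\<close> by one, the weights
    \<open>2 s - l\<close> run symmetrically from \<open>-l\<close> to \<open>l\<close>. The
    coefficient of \<open>f\<close> solves \<open>e f - f e = h\<close>, that is
    \<open>s (l + 1 - s) - (s + 1) (l - s) = 2 s - l\<close>; it is 0 at \<open>s = 0\<close>, which
    makes the truncated index \<open>s - 1\<close> harmless.\<close>
  define h where "h u = (\<Sum>s<Suc l. ((2 * of_nat s - of_nat l) * \<rho> s u) *s b s)" for u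
  define f where "f u = (\<Sum>s<Suc l. (of_nat s * (of_nat l + 1 - of_nat s) * \<rho> s u) *s b (s - 1))" for u
  have linR: "Vector_Spaces.linear (*s) (*s) R" and linh: "Vector_Spaces.linear (*s) (*s) h"
    and linf: "Vector_Spaces.linear (*s) (*s) f"
    by (auto intro!: vec_linearI simp: R_def h_def f_def \<rho>_lin vector_sadd_rdistrib sum.distrib
        distrib_left distrib_right vec.scale_sum_right mult_ac simp del: sum.lessThan_Suc)
  note l = linear_simps[OF linR] linear_simps[OF linh] linear_simps[OF linf] linear_simps[OF e]
  have Rb: "R (b s) = b s" and hb: "h (b s) = (2 * of_nat s - of_nat l) *s b s"
    and fb: "f (b s) = (of_nat s * (of_nat l + 1 - of_nat s)) *s b (s - 1)" if "s \<le> l" for s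
    using that by (simp_all add: R_def h_def f_def \<rho>b if_distrib if_distribR cong: if_cong del: sum.lessThan_Suc)
  have \<rho>R: "\<rho> s (R u) = \<rho> s u" if "s \<le> l" for s u
  proof -
    have "\<rho> s (\<Sum>t\<in>A. \<rho> t u *s b t) = (\<Sum>t\<in>A. \<rho> t u * \<rho> s (b t))" if "finite A" for A
      using that \<rho>_lin(2)[of s 0] by (induction A) (simp_all add: \<rho>_lin)
    then show ?thesis using that by (simp add: R_def \<rho>b if_distrib[of "(*) _"] cong: if_cong del: sum.lessThan_Suc)
  qed
  have fR: "f (R u) = f u" and hR: "h (R u) = h u" for u
    unfolding f_def h_def by (intro sum.cong refl, simp add: \<rho>R)+
  have RR: "R (R u) = R u" for u
  proof -
    have "(\<Sum>s<Suc l. \<rho> s (R u) *s b s) = (\<Sum>s<Suc l. \<rho> s u *s b s)"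
      by (intro sum.cong refl) (simp add: \<rho>R)
    then show ?thesis by (simp only: R_def[symmetric])
  qed
  \<comment> \<open>Each relation need only be checked on the \<open>b s\<close>. It extends from
    the range of \<open>R\<close> to all vectors by \<open>fR\<close>, \<open>hR\<close> and
    \<open>eR\<close>.\<close>
  have eqR: "S (R u) = T (R u)" if "Vector_Spaces.linear (*s) (*s) S" "Vector_Spaces.linear (*s) (*s) T"
    "\<And>s. s \<le> l \<Longrightarrow> S (b s) = T (b s)" for S T :: "'k ^ 'n \<Rightarrow> 'k ^ 'n" and u
    unfolding R_def linear_simps(6)[OF that(1)] linear_simps(6)[OF that(2)]
    by (rule sum.cong) (simp_all add: linear_simps[OF that(1)] linear_simps[OF that(2)] that(3))
  have eR: "e (R u) = R (e u)" for u
  proof -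
    have "R (e u) = (\<Sum>s<l. \<rho> s u *s b (Suc s))"
      unfolding R_def sum.lessThan_Suc_shift by (simp add: \<rho>e cong: sum.cong_simp)
    also have "\<dots> = (\<Sum>s<Suc l. \<rho> s u *s b (Suc s))" by (simp add: b_zero)
    also have "\<dots> = e (R u)" unfolding R_def by (simp only: l eb)
    finally show ?thesis by simp
  qed
  have Rf: "R (f u) = f u" and Rh: "R (h u) = h u" for u
    unfolding f_def h_def l by (auto intro!: sum.cong simp: Rb)
  \<comment> \<open>At the top index \<open>s = l\<close> this identity and the next one read
    \<open>0 = 0\<close>, since \<open>b (Suc l) = 0\<close>.\<close>
  have heb: "h (b (Suc s)) = (2 * of_nat (Suc s) - of_nat l) *s b (Suc s)" if "s \<le> l" for s
    using hb[of "Suc s"] that b_zero[of "Suc s"] by (cases "s = l") (auto simp: l)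
  have feb: "f (b (Suc s)) = (of_nat (Suc s) * (of_nat l - of_nat s)) *s b s" if "s \<le> l" for s
    using fb[of "Suc s"] that b_zero[of "Suc s"] by (cases "s = l") (auto simp: l)
  have efb: "e (f (b s)) = (of_nat s * (of_nat l + 1 - of_nat s)) *s b s" if "s \<le> l" for s
    using that by (cases s) (simp_all add: fb l eb)
  have hfb: "h (f (b s)) = (of_nat s * (of_nat l + 1 - of_nat s) * (2 * of_nat s - 2 - of_nat l)) *s b (s - 1)"
    if "s \<le> l" for s
    using that by (cases s) (simp_all add: fb hb l)
  have rel1: "e (f v) = f (e v) + h v" for v
  proof -
    have "e (f (R v)) = f (e (R v)) + h (R v)"
    proof (rule eqR[where S = "\<lambda>u. e (f u)" and T = "\<lambda>u. f (e u) + h u"])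
      show "e (f (b s)) = f (e (b s)) + h (b s)" if "s \<le> l" for s
        unfolding eb efb[OF that] feb[OF that] hb[OF that] vector_sadd_rdistrib[symmetric]
        by (rule arg_cong[where f = "\<lambda>c. c *s b s"]) (simp add: algebra_simps)
    qed (auto intro!: vec_linearI simp: l vector_add_ldistrib)
    then show ?thesis by (simp add: fR hR eR)
  qed
  have rel2: "h (e v) = e (h v) + 2 *s e (R v)" for v
  proof -
    have "h (e (R v)) = e (h (R v)) + 2 *s e (R v)"
    proof (rule eqR[where S = "\<lambda>u. h (e u)" and T = "\<lambda>u. e (h u) + 2 *s e u"])
      show "h (e (b s)) = e (h (b s)) + 2 *s e (b s)" if "s \<le> l" for s
        unfolding eb heb[OF that] hb[OF that] l vector_sadd_rdistrib[symmetric]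
        by (rule arg_cong[where f = "\<lambda>c. c *s b (Suc s)"]) (simp add: algebra_simps)
    qed (auto intro!: vec_linearI simp: l vector_add_ldistrib vector_smult_assoc mult.commute)
    then show ?thesis by (simp add: hR eR)
  qed
  have rel3: "h (f v) = f (h v) - 2 *s f v" for v
  proof -
    have "h (f (R v)) = f (h (R v)) - 2 *s f (R v)"
    proof (rule eqR[where S = "\<lambda>u. h (f u)" and T = "\<lambda>u. f (h u) - 2 *s f u"])
      show "h (f (b s)) = f (h (b s)) - 2 *s f (b s)" if "s \<le> l" for s
        unfolding hfb[OF that]
        unfolding fb[OF that] hb[OF that] l vector_smult_assoc vec.scale_left_diff_distrib[symmetric]
        by (rule arg_cong[where f = "\<lambda>c. c *s b (s - 1)"]) (simp add: algebra_simps)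
    qed (auto intro!: vec_linearI simp: l vector_add_ldistrib vector_ssub_ldistrib vector_smult_assoc mult.commute)
    then show ?thesis by (simp add: fR hR)
  qed
  have nilf: "(f ^^ Suc l) v = 0" for v
  proof -
    have "(f ^^ Suc s) (b s) = 0" if "s \<le> l" for s
      using that
    proof (induction s)
      case 0
      then show ?case by (simp add: fb)
    next
      case (Suc s)
      then have "(f ^^ Suc s) (f (b (Suc s))) = 0"
        by (simp only: fb linear_simps[OF linear_funpow[OF linf]]) simp
      then show ?case by (simp only: funpow_Suc_right o_apply)
    qed
    moreover have "(f ^^ Suc l) u = (f ^^ (l - s)) ((f ^^ Suc s) u)" if "s \<le> l" for s u
      by (metis that Suc_diff_le Suc_le_mono add_Suc_right comp_apply funpow_add le_add_diff_inverse2)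
    ultimately have "(f ^^ Suc l) (b s) = 0" if "s \<le> l" for s
      using that by (simp only: linear_simps[OF linear_funpow[OF linf]])
    then have "(f ^^ Suc l) (R v) = 0"
      unfolding R_def linear_simps[OF linear_funpow[OF linf]]
      by (intro sum.neutral) (simp del: funpow.simps)
    then show ?thesis by (simp only: funpow_Suc_right o_apply fR)
  qed
  have "R v \<in> vec.span {u. R u = u \<and> (\<exists>c. h u = c *s u)}" for v
    by (subst R_def, intro vec.span_sum vec.span_scale vec.span_base) (auto simp: Rb hb)
  then have "sl2_on e R f h"
    unfolding sl2_on_def using linR linf linh RR eR fR Rf hR Rh rel1 rel2 rel3 nilf by blast
  moreover have "R (P v) = R v" "P (R v) = R v" for v
    by (simp_all add: R_def \<rho>P linear_simps[OF P] Pb del: sum.lessThan_Suc)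
  moreover have "R w = w" using Rb[of 0] by (simp add: b_def)
  moreover have "w \<noteq> 0" using w(2) by (auto simp: pow)
  ultimately show ?thesis by blast
qed

text \<open>Generalised from the identity to projections commuting with \<open>e\<close>, so that
  the complement of a Jordan block needs no vector space type of its own: it is the range of
  \<open>P - R\<close>, again such a projection and of smaller rank.\<close>

lemma sl2_on_projection:
  fixes e :: "'k::field ^ 'n::finite \<Rightarrow> 'k ^ 'n"
  assumes e: "Vector_Spaces.linear (*s) (*s) e" and nil: "\<And>v. (e ^^ M) v = 0"
    and "Vector_Spaces.linear (*s) (*s) P" "\<And>v. P (P v) = P v" "\<And>v. e (P v) = P (e v)"
  shows "\<exists>f h. sl2_on e P f h"
  using assms(3-)
proof (induction "vec.dim (range P)" arbitrary: P rule: less_induct)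
  case less
  note P = linear_simps[OF less.prems(1)]
  show ?case
  proof (cases "\<forall>v. P v = 0")
    case True
    then have "P = (\<lambda>_. 0)" by auto
    then have "sl2_on e P (\<lambda>_. 0) (\<lambda>_. 0)"
      unfolding sl2_on_def by (auto intro!: vec_linearI vec.span_zero simp: linear_simps[OF e])
    then show ?thesis by blast
  next
    case False
    then obtain v0 where v0: "P v0 \<noteq> 0" by blast
    \<comment> \<open>The nilpotency index of \<open>e\<close> on the range of \<open>P\<close>; the
      block split off has this size, which is maximal.\<close>
    define m where "m = (LEAST m. \<forall>v. (e ^^ m) (P v) = 0)"
    have m: "\<forall>v. (e ^^ m) (P v) = 0" unfolding m_def by (rule LeastI[of _ M]) (simp add: nil)
    with v0 obtain l where l: "m = Suc l" by (cases m) auto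
    then obtain v1 where "(e ^^ l) (P v1) \<noteq> 0"
      using not_less_Least[of l "\<lambda>m. \<forall>v. (e ^^ m) (P v) = 0"] m_def by auto
    with m l obtain R f h w where R: "sl2_on e R f h" "\<And>v. R (P v) = R v" "\<And>v. P (R v) = R v"
      and w: "R w = w" "w \<noteq> 0"
      using sl2_on_cyclic[OF e less.prems, of l v1] by blast
    have linR: "Vector_Spaces.linear (*s) (*s) R" and RR: "R (R v) = R v" and eR: "e (R v) = R (e v)" for v
      using R(1) by (simp_all add: sl2_on_def)
    let ?Q = "\<lambda>v. P v - R v"
    note R' = linear_simps[OF linR]
    have linQ: "Vector_Spaces.linear (*s) (*s) ?Q"
      by (rule vec_linearI) (simp_all add: P R' vector_ssub_ldistrib)
    \<comment> \<open>\<open>w\<close> lies in the range of \<open>P\<close> and is fixed by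
      \<open>R\<close>, whereas \<open>R\<close> annihilates the range of \<open>?Q\<close>.\<close>
    have "range ?Q \<subset> range P"
    proof -
      have "?Q v = P (?Q v)" for v by (simp add: P R less.prems)
      then have "range ?Q \<subseteq> range P" by blast
      moreover have "w \<in> range P" using w(1) R(3)[of w] by (metis rangeI)
      moreover have "w \<notin> range ?Q"
      proof
        assume "w \<in> range ?Q"
        then obtain v where "w = P v - R v" by blast
        then have "R w = 0" by (simp add: R' R RR)
        with w show False by simp
      qed
      ultimately show ?thesis by blast
    qed
    moreover have span: "vec.span (range T) = range T" if "Vector_Spaces.linear (*s) (*s) T" for T :: "'k ^ 'n \<Rightarrow> 'k ^ 'n"
      using that by (simp add: vec.linear_subspace_image vec.span_eq_iff)
    ultimately have "vec.dim (range ?Q) < vec.dim (range P)"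
      by (intro vec.dim_psubset) (simp only: span[OF linQ] span[OF less.prems(1)])
    moreover have "?Q (?Q v) = ?Q v" "e (?Q v) = ?Q (e v)" for v
      by (simp_all add: P R' R RR less.prems eR linear_simps[OF e])
    ultimately obtain f' h' where "sl2_on e ?Q f' h'" using less.hyps linQ by blast
    then have "\<exists>f h. sl2_on e (\<lambda>v. ?Q v + R v) f h"
      by (intro sl2_on_sum[OF e _ R(1)]) (simp_all add: R' R RR)
    then show ?thesis by simp
  qed
qed

lemma nilpotent_sl2_triple:
  fixes e :: "'k::field ^ 'n::finite \<Rightarrow> 'k ^ 'n"
  assumes "Vector_Spaces.linear (*s) (*s) e" "\<And>v. (e ^^ M) v = 0"
  obtains f h N where "Vector_Spaces.linear (*s) (*s) f" "Vector_Spaces.linear (*s) (*s) h"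
    "\<And>v. e (f v) = f (e v) + h v" "\<And>v. h (e v) = e (h v) + 2 *s e v"
    "\<And>v. h (f v) = f (h v) - 2 *s f v" "\<And>v. (f ^^ N) v = 0"
    "\<And>v. v \<in> vec.span (eigenvectors (*s) h)"
proof -
  have "\<exists>f h. sl2_on e (\<lambda>v. v) f h"
    by (rule sl2_on_projection[OF assms]) (auto intro: vec_linearI)
  then obtain f h where fh: "sl2_on e (\<lambda>v. v) f h" by blast
  then obtain N where "\<And>v. (f ^^ Suc N) v = 0" unfolding sl2_on_def by blast
  moreover have "v \<in> vec.span (eigenvectors (*s) h)" for v
    using fh unfolding sl2_on_def eigenvectors_def by simp
  moreover have "Vector_Spaces.linear (*s) (*s) f" "Vector_Spaces.linear (*s) (*s) h"
    "\<And>v. e (f v) = f (e v) + h v" "\<And>v. h (e v) = e (h v) + 2 *s e v" "\<And>v. h (f v) = f (h v) - 2 *s f v"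
    using fh unfolding sl2_on_def by simp_all
  ultimately show ?thesis by (intro that[of f h "Suc N"])
qed


section \<open>The universal property of the free metabelian Lie algebra\<close>

lemma na_mult_single:
  "na_mult (Poly_Mapping.single s 1) (Poly_Mapping.single t 1) = Poly_Mapping.single (Mul s t) (1 :: 'k::field)"
  by (simp add: na_mult_def)

lemma na_mult_zero: "na_mult 0 p = 0" "na_mult p 0 = 0"
  using na_mult_scale_left[of 0 0 p] na_mult_scale_right[of p 0 0] by simp_all

lemma abs_free_lie_simps:
  "abs_free_lie (Poly_Mapping.single (Gen j) 1) = fl_gen j"
  "abs_free_lie (p + q) = abs_free_lie p + abs_free_lie q"
  "abs_free_lie (pm_scale c p) = fl_scale c (abs_free_lie p)"
  "abs_free_lie (na_mult p q) = fl_bracket (abs_free_lie p) (abs_free_lie q)"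
  "abs_free_lie 0 = 0"
  by (simp_all add: fl_gen_def plus_free_lie.abs_eq fl_scale.abs_eq fl_bracket.abs_eq zero_free_lie_def)

lemma abs_free_lie_surj: "\<exists>p. u = abs_free_lie p"
  by (rule exI[of _ "rep_free_lie u"], rule Quotient3_abs_rep[OF Quotient3_free_lie, symmetric])

lemma free_metabelian_induct [case_names gen add scale bracket]:
  fixes u :: "('n, 'k::field) free_metabelian"
  assumes gen: "\<And>j. P (fm_gen j)" and add: "\<And>u v. P u \<Longrightarrow> P v \<Longrightarrow> P (u + v)"
    and scale: "\<And>c u. P u \<Longrightarrow> P (fm_scale c u)" and bracket: "\<And>u v. P u \<Longrightarrow> P v \<Longrightarrow> P (fm_bracket u v)"
  shows "P u"
proof -
  have magma: "P (fm_proj (abs_free_lie (Poly_Mapping.single t 1)))" for t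
  proof (induction t)
    case (Gen j)
    then show ?case using gen[of j] by (simp add: abs_free_lie_simps fm_gen_def)
  next
    case (Mul s t)
    then show ?case using bracket
      by (simp add: abs_free_lie_simps fm_proj_simps flip: na_mult_single)
  qed
  have "P (fm_proj (abs_free_lie p))" for p
  proof (induction p rule: pm_linear_induct)
    case zero
    then show ?case using scale[OF magma, of 0 undefined]
      by (simp add: abs_free_lie_simps fm_proj_simps)
  next
    case (single m)
    then show ?case using magma by simp
  qed (simp_all add: abs_free_lie_simps fm_proj_simps add scale)
  then show ?thesis by (metis abs_free_lie_surj fm_proj_surj)
qed

primrec magma_eval :: "('a \<Rightarrow> 'a \<Rightarrow> 'a) \<Rightarrow> ('n \<Rightarrow> 'a) \<Rightarrow> 'n magma \<Rightarrow> 'a" where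
  "magma_eval br g (Gen j) = g j"
| "magma_eval br g (Mul s t) = br (magma_eval br g s) (magma_eval br g t)"

text \<open>Two quotients are crossed: evaluation of magma words kills the Lie relations by the laws
  of the target, and the resulting map kills \<open>fl.derived2\<close> because the target is
  metabelian.\<close>

theorem (in lie_algebra) free_metabelian_universal:
  fixes g :: "'n \<Rightarrow> 'a"
  assumes metabelian: "\<And>a b. a \<in> derived \<Longrightarrow> b \<in> derived \<Longrightarrow> bracket a b = 0"
  shows "\<exists>\<Psi>. Vector_Spaces.linear fm_scale scale \<Psi> \<and>
    (\<forall>u v. \<Psi> (fm_bracket u v) = bracket (\<Psi> u) (\<Psi> v)) \<and> (\<forall>j. \<Psi> (fm_gen j) = g j)"
proof -
  define \<Psi>0 where "\<Psi>0 = linear_extension scale (magma_eval bracket g)"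
  have l0: "Vector_Spaces.linear pm_scale scale \<Psi>0" unfolding \<Psi>0_def by (rule linear_linear_extension)
  note \<Psi>0 = linear_simps[OF l0]
  have single: "\<Psi>0 (Poly_Mapping.single t 1) = magma_eval bracket g t" for t by (simp add: \<Psi>0_def)
  have mult: "\<Psi>0 (na_mult p q) = bracket (\<Psi>0 p) (\<Psi>0 q)" for p q
  proof (induction p rule: pm_linear_induct)
    case zero
    show ?case by (simp add: na_mult_zero \<Psi>0 bracket_zero_left)
  next
    case (single s)
    show ?case
    proof (induction q rule: pm_linear_induct)
      case zero
      show ?case by (simp add: na_mult_zero \<Psi>0 bracket_zero_right)
    next
      case (single t)
      show ?case by (simp add: na_mult_single \<open>\<And>t. \<Psi>0 (Poly_Mapping.single t 1) = _ t\<close>)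
    qed (simp_all add: na_mult_add_right na_mult_scale_right \<Psi>0 bracket_add_right bracket_scale_right)
  qed (simp_all add: na_mult_add_left na_mult_scale_left \<Psi>0 bracket_add_left bracket_scale_left)
  have rel: "\<Psi>0 p = 0" if "p \<in> lie_relations" for p
    using that by (induction rule: lie_relations.induct)
      (simp_all add: \<Psi>0 mult bracket_self jacobi bracket_zero_left bracket_zero_right)
  define \<Psi>1 where "\<Psi>1 u = \<Psi>0 (rep_free_lie u)" for u
  have \<Psi>1_abs: "\<Psi>1 (abs_free_lie p) = \<Psi>0 p" for p
  proof -
    have "abs_free_lie (rep_free_lie (abs_free_lie p)) = abs_free_lie p"
      by (rule Quotient3_abs_rep[OF Quotient3_free_lie])
    then have "rep_free_lie (abs_free_lie p) - p \<in> lie_relations" by (simp only: free_lie.abs_eq_iff)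
    from rel[OF this] show ?thesis by (simp add: \<Psi>0 \<Psi>1_def)
  qed
  have \<Psi>1: "\<Psi>1 (u + v) = \<Psi>1 u + \<Psi>1 v" "\<Psi>1 (fl_scale c u) = scale c (\<Psi>1 u)"
    "\<Psi>1 (fl_bracket u v) = bracket (\<Psi>1 u) (\<Psi>1 v)" for u v c
  proof -
    obtain p q where u: "u = abs_free_lie p" and v: "v = abs_free_lie q" using abs_free_lie_surj by metis
    show "\<Psi>1 (u + v) = \<Psi>1 u + \<Psi>1 v" "\<Psi>1 (fl_scale c u) = scale c (\<Psi>1 u)"
      "\<Psi>1 (fl_bracket u v) = bracket (\<Psi>1 u) (\<Psi>1 v)"
      unfolding u v abs_free_lie_simps[symmetric] \<Psi>1_abs by (simp_all add: \<Psi>0 mult)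
  qed
  have \<Psi>1_0: "\<Psi>1 0 = 0" using \<Psi>1(2)[of 0 0] by simp
  have \<Psi>1_diff: "\<Psi>1 (u - v) = \<Psi>1 u - \<Psi>1 v" for u v using \<Psi>1(1)[of "u - v" v] by simp
  have der: "\<Psi>1 a \<in> derived" if "a \<in> fl.derived" for a
    using that unfolding fl.commutator_def
  proof (induction rule: fl.span_induct_alt)
    case base
    show ?case by (simp add: \<Psi>1_0 subspace_0 subspace_commutator)
  next
    case (step c x y)
    then have "\<Psi>1 x \<in> derived" by (auto simp: \<Psi>1 intro!: bracket_in_commutator)
    then show ?case using step by (simp add: \<Psi>1 subspace_add subspace_scale subspace_commutator)
  qed
  have der2: "\<Psi>1 a = 0" if "a \<in> fl.derived2" for a
    using that unfolding fl.commutator_def[of fl.derived fl.derived]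
  proof (induction rule: fl.span_induct_alt)
    case (step c x y)
    then have "\<Psi>1 x = 0" using metabelian der by (auto simp: \<Psi>1)
    then show ?case using step by (simp add: \<Psi>1)
  qed (simp add: \<Psi>1_0)
  define \<Psi> where "\<Psi> u = \<Psi>1 (rep_fm u)" for u
  have \<Psi>_proj: "\<Psi> (fm_proj a) = \<Psi>1 a" for a
  proof -
    have "fm_proj (rep_fm (fm_proj a)) = fm_proj a"
      by (rule Quotient3_abs_rep[OF Quotient3_free_metabelian])
    then have "rep_fm (fm_proj a) - a \<in> fl.derived2" by (simp only: free_metabelian.abs_eq_iff)
    from der2[OF this] show ?thesis by (simp add: \<Psi>1_diff \<Psi>_def)
  qed
  have \<Psi>: "\<Psi> (u + v) = \<Psi> u + \<Psi> v" "\<Psi> (fm_scale c u) = scale c (\<Psi> u)"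
    "\<Psi> (fm_bracket u v) = bracket (\<Psi> u) (\<Psi> v)" for u v c
  proof -
    obtain a b where u: "u = fm_proj a" and v: "v = fm_proj b" using fm_proj_surj by metis
    show "\<Psi> (u + v) = \<Psi> u + \<Psi> v" "\<Psi> (fm_scale c u) = scale c (\<Psi> u)"
      "\<Psi> (fm_bracket u v) = bracket (\<Psi> u) (\<Psi> v)"
      unfolding u v fm_proj_simps[symmetric] \<Psi>_proj by (simp_all add: \<Psi>1)
  qed
  have "\<Psi> (fm_gen j) = g j" for j
    using \<Psi>_proj[of "fl_gen j"] \<Psi>1_abs[of "Poly_Mapping.single (Gen j) 1"]
    by (simp add: fm_gen_def abs_free_lie_simps single)
  moreover have "Vector_Spaces.linear fm_scale scale \<Psi>"
    by unfold_locales (simp_all add: \<Psi> fm.scale_right_distrib fm.scale_left_distrib)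
  ultimately show ?thesis using \<Psi>(3) by blast
qed


section \<open>The commutator ideal as a module\<close>

lemma fm_commutator_ideal_simps:
  "0 \<in> fm_commutator_ideal" "u \<in> fm_commutator_ideal \<Longrightarrow> v \<in> fm_commutator_ideal \<Longrightarrow> u + v \<in> fm_commutator_ideal"
  "u \<in> fm_commutator_ideal \<Longrightarrow> fm_scale c u \<in> fm_commutator_ideal"
  "fm_bracket x y \<in> fm_commutator_ideal"
  unfolding fm_commutator_ideal_eq
  by (auto intro: fm.subspace_0 fm.subspace_add fm.subspace_scale fm.subspace_commutator
      fm.bracket_in_commutator)

lemma linear_fm_ad: "Vector_Spaces.linear fm_scale fm_scale (fm_ad j)"
  by unfold_locales (simp_all add: fm_ad_def fm.bracket_add_left fm.bracket_scale_left
      fm.scale_right_distrib fm.scale_left_distrib)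

lemma fm_linear_compose:
  "Vector_Spaces.linear fm_scale fm_scale S \<Longrightarrow> Vector_Spaces.linear fm_scale fm_scale T \<Longrightarrow>
    Vector_Spaces.linear fm_scale fm_scale (\<lambda>u. S (T u))"
  using Vector_Spaces.linear_compose[of fm_scale fm_scale T fm_scale S] by (simp add: comp_def)

lemma linear_fm_ad_monomial: "Vector_Spaces.linear fm_scale fm_scale (fm_ad_monomial m)"
proof -
  have "Vector_Spaces.linear fm_scale fm_scale (foldr (\<lambda>j. fm_ad j ^^ Poly_Mapping.lookup m j) xs)" for xs
  proof (induction xs)
    case Nil
    show ?case using linear_funpow[OF linear_fm_ad, of 0] by (simp add: id_def)
  next
    case (Cons a xs)
    then show ?case using fm_linear_compose[OF linear_funpow[OF linear_fm_ad]] by (simp add: comp_def)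
  qed
  then show ?thesis by (simp add: fm_ad_monomial_def[abs_def])
qed

lemma fm_ad_pow_in_commutator_ideal: "u \<in> fm_commutator_ideal \<Longrightarrow> (fm_ad j ^^ n) u \<in> fm_commutator_ideal"
  by (induction n) (simp_all add: fm_ad_in_commutator_ideal)

lemma fm_ad_pow_commute:
  "u \<in> fm_commutator_ideal \<Longrightarrow> fm_ad i ((fm_ad j ^^ n) u) = (fm_ad j ^^ n) (fm_ad i u)"
proof (induction n)
  case (Suc n)
  then show ?case using fm_ad_commute[OF fm_ad_pow_in_commutator_ideal, of u i j] by simp
qed simp

lemma fm_ad_monomial_in_commutator_ideal:
  assumes "u \<in> fm_commutator_ideal" shows "fm_ad_monomial m u \<in> fm_commutator_ideal"
proof -
  have "foldr (\<lambda>j. fm_ad j ^^ Poly_Mapping.lookup m j) xs u \<in> fm_commutator_ideal" for xs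
    by (induction xs) (simp_all add: assms fm_ad_pow_in_commutator_ideal)
  then show ?thesis by (simp add: fm_ad_monomial_def)
qed

lemma fm_ad_monomial_gen:
  assumes "u \<in> fm_commutator_ideal"
  shows "fm_ad k (fm_ad_monomial m u) = fm_ad_monomial m (fm_ad k u)"
proof -
  let ?f = "\<lambda>m xs. foldr (\<lambda>j. fm_ad j ^^ Poly_Mapping.lookup m j) xs"
  have mem: "?f m xs v \<in> fm_commutator_ideal" if "v \<in> fm_commutator_ideal" for m xs v
    by (induction xs) (simp_all add: that fm_ad_pow_in_commutator_ideal)
  have "fm_ad k (?f m xs u) = ?f m xs (fm_ad k u)" for xs
    by (induction xs) (simp_all add: assms mem fm_ad_pow_commute)
  then show ?thesis by (simp add: fm_ad_monomial_def)
qed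

lemma fm_ad_monomial_add_single:
  assumes "u \<in> fm_commutator_ideal"
  shows "fm_ad_monomial (m + Poly_Mapping.single k 1) u = fm_ad_monomial m (fm_ad k u)"
proof -
  let ?f = "\<lambda>m xs. foldr (\<lambda>j. fm_ad j ^^ Poly_Mapping.lookup m j) xs"
  have mem: "?f m xs v \<in> fm_commutator_ideal" if "v \<in> fm_commutator_ideal" for m xs v
    by (induction xs) (simp_all add: that fm_ad_pow_in_commutator_ideal)
  \<comment> \<open>In a distinct list the extra exponent takes effect exactly once, where
    \<open>k\<close> is met.\<close>
  have "?f (m + Poly_Mapping.single k 1) xs u = (if k \<in> set xs then fm_ad k (?f m xs u) else ?f m xs u)"
    if "distinct xs" for xs
    using that
    by (induction xs)
      (auto simp: lookup_add lookup_single when_def assms mem fm_ad_pow_commute funpow_swap1)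
  from this[of "sorted_list_of_set UNIV"] show ?thesis
    by (simp add: fm_ad_monomial_def fm_ad_monomial_gen[OF assms, unfolded fm_ad_monomial_def])
qed

lemma fm_ad_monomial_zero: "fm_ad_monomial 0 u = u"
proof -
  have "foldr (\<lambda>j. fm_ad j ^^ Poly_Mapping.lookup 0 j) xs u = u" for xs by (induction xs) auto
  then show ?thesis by (simp add: fm_ad_monomial_def)
qed

lemma fm_act_in_commutator_ideal:
  "u \<in> fm_commutator_ideal \<Longrightarrow> fm_act u f \<in> fm_commutator_ideal"
  unfolding fm_act_def linear_extension_def fm_commutator_ideal_eq
  by (intro fm.subspace_sum fm.subspace_scale fm.subspace_commutator
      fm_ad_monomial_in_commutator_ideal[unfolded fm_commutator_ideal_eq])

abbreviation fm_basic :: "('n::{finite, linorder} \<Rightarrow>\<^sub>0 nat) \<Rightarrow> 'n \<Rightarrow> 'n \<Rightarrow> ('n, 'k::field) free_metabelian"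
  where "fm_basic m i j \<equiv> fm_ad_monomial m (fm_bracket (fm_gen i) (fm_gen j))"

lemma bracket_span:
  assumes "u \<in> fm.span A" "v \<in> fm.span B" "\<And>a b. a \<in> A \<Longrightarrow> b \<in> B \<Longrightarrow> fm_bracket a b \<in> fm.span C"
  shows "fm_bracket u v \<in> fm.span C"
  using assms(1)
proof (induction rule: fm.span_induct_alt)
  case base
  show ?case by (simp add: fm.bracket_zero_left fm.span_zero)
next
  case (step c a u)
  have "fm_bracket a v \<in> fm.span C"
    using assms(2)
  proof (induction rule: fm.span_induct_alt)
    case base
    show ?case by (simp add: fm.bracket_zero_right fm.span_zero)
  next
    case (step d b w)
    then show ?case using assms(3)[OF \<open>a \<in> A\<close>]
      by (simp add: fm.bracket_add_right fm.bracket_scale_right fm.span_add fm.span_scale)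
  qed
  with step show ?case
    by (simp add: fm.bracket_add_left fm.bracket_scale_left fm.span_add fm.span_scale)
qed

text \<open>The generators and the \<open>fm_basic m i j\<close> together span the algebra, because
  all brackets among them are combinations of the \<open>fm_basic m i j\<close>; brackets of two
  elements of the latter kind are zero.\<close>

lemma fm_commutator_ideal_span:
  "(fm_commutator_ideal :: ('n::{finite, linorder}, 'k::field) free_metabelian set)
    = fm.span {fm_basic m i j | m i j. True}"
proof
  let ?T = "{fm_basic m i j | m i j. True} :: ('n, 'k) free_metabelian set"
  have T: "?T \<subseteq> fm_commutator_ideal"
    by (auto intro: fm_ad_monomial_in_commutator_ideal fm_commutator_ideal_simps)
  then show "fm.span ?T \<subseteq> fm_commutator_ideal"
    unfolding fm_commutator_ideal_eq by (rule fm.span_minimal) (rule fm.subspace_commutator)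
  have gen: "fm_bracket t (fm_gen k) \<in> fm.span ?T" if "t \<in> ?T" for t k
  proof -
    obtain m i j where t: "t = fm_basic m i j" using \<open>t \<in> ?T\<close> by blast
    have "fm_bracket t (fm_gen k) = fm_basic (m + Poly_Mapping.single k 1) i j"
      unfolding t fm_ad_monomial_add_single[OF fm_commutator_ideal_simps(4)]
        fm_ad_monomial_gen[OF fm_commutator_ideal_simps(4), symmetric] by (simp add: fm_ad_def)
    then show ?thesis by (auto intro: fm.span_base)
  qed
  have br: "fm_bracket a b \<in> fm.span ?T" if a: "a \<in> range fm_gen \<union> ?T" and b: "b \<in> range fm_gen \<union> ?T" for a b
  proof -
    consider (gg) i j where "a = fm_gen i" "b = fm_gen j" | (tg) j where "a \<in> ?T" "b = fm_gen j"
      | (gt) i where "a = fm_gen i" "b \<in> ?T" | (tt) "a \<in> ?T" "b \<in> ?T"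
      using a b by blast
    then show ?thesis
    proof cases
      case gg
      then have "fm_bracket a b = fm_basic 0 i j" by (simp add: fm_ad_monomial_zero)
      then show ?thesis by (auto intro: fm.span_base)
    next
      case tg
      then show ?thesis using gen by simp
    next
      case gt
      then show ?thesis using fm.span_neg[OF gen[of b i]] fm.bracket_anti[of a b] by simp
    next
      case tt
      then have "fm_bracket a b = 0" using T by (intro fm_metabelian) auto
      then show ?thesis by (simp add: fm.span_zero)
    qed
  qed
  have all: "u \<in> fm.span (range fm_gen \<union> ?T)" for u
  proof (induction u rule: free_metabelian_induct)
    case (gen j)
    show ?case by (rule fm.span_base) simp
  next
    case (bracket u v)
    then have "fm_bracket u v \<in> fm.span ?T" using br by (rule bracket_span)
    then show ?case using fm.span_mono[of ?T "range fm_gen \<union> ?T"] by blast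
  qed (auto intro: fm.span_add fm.span_scale)
  have "fm_bracket u v \<in> fm.span ?T" for u v by (rule bracket_span[OF all all br])
  then show "fm_commutator_ideal \<subseteq> fm.span ?T"
    unfolding fm_commutator_ideal_eq fm.commutator_def by (intro fm.span_minimal) auto
qed


section \<open>The Magnus embedding\<close>

text \<open>The indices \<open>Inl i\<close> are those of \<open>x\<^sub>i\<close>, the indices \<open>Inr (Inl i)\<close> those of the
  coefficients \<open>z\<^sub>i\<close> in the Magnus embedding \<open>x\<^sub>i \<mapsto> (x\<^sub>i, z\<^sub>i)\<close>, and the last two are those of the
  natural representation of \<open>sl\<^sub>2\<close>.\<close>

type_synonym 'n magnus_index = "'n + 'n + bool"

definition X :: "'n \<Rightarrow> ('n magnus_index, 'k::field) mpoly" where "X i = poly_gen (Inl i)"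
definition Z :: "'n \<Rightarrow> ('n magnus_index, 'k::field) mpoly" where "Z i = poly_gen (Inr (Inl i))"
definition sx :: "('n magnus_index, 'k::field) mpoly" where "sx = poly_gen (Inr (Inr True))"
definition sy :: "('n magnus_index, 'k::field) mpoly" where "sy = poly_gen (Inr (Inr False))"

definition magnus_fun :: "('n \<Rightarrow> 'a) \<Rightarrow> ('n \<Rightarrow> 'a) \<Rightarrow> 'a \<Rightarrow> 'a \<Rightarrow> 'n magnus_index \<Rightarrow> 'a"
  where "magnus_fun f g a b t =
    (case t of Inl i \<Rightarrow> f i | Inr (Inl i) \<Rightarrow> g i | Inr (Inr c) \<Rightarrow> if c then a else b)"

lemma magnus_fun_simps [simp]:
  "poly_subst (magnus_fun f g a b) (X i) = f i" "poly_subst (magnus_fun f g a b) (Z i) = g i"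
  "poly_subst (magnus_fun f g a b) sx = a" "poly_subst (magnus_fun f g a b) sy = b"
  by (simp_all add: X_def Z_def sx_def sy_def magnus_fun_def)

lemma magnus_der_simps [simp]:
  "poly_derivation (magnus_fun f g a b) (X i) = f i" "poly_derivation (magnus_fun f g a b) (Z i) = g i"
  "poly_derivation (magnus_fun f g a b) sx = a" "poly_derivation (magnus_fun f g a b) sy = b"
  by (simp_all add: X_def Z_def sx_def sy_def magnus_fun_def)

lemma magnus_index_cases:
  assumes "\<And>i. P (X i)" "\<And>i. P (Z i)" "P sx" "P sy"
  shows "P (poly_gen t)"
proof (cases t)
  case (Inl i)
  then show ?thesis using assms(1)[of i] by (simp add: X_def)
next
  case (Inr s)
  show ?thesis
  proof (cases s)
    case (Inl i)
    then show ?thesis using assms(2)[of i] \<open>t = Inr s\<close> by (simp add: Z_def)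
  next
    case (Inr c)
    then show ?thesis using assms(3,4) \<open>t = Inr s\<close> by (cases c) (simp_all add: sx_def sy_def)
  qed
qed

definition poly_embed :: "('n::finite, 'k::field) mpoly \<Rightarrow> ('n magnus_index, 'k) mpoly"
  where "poly_embed = poly_subst X"

text \<open>Besides \<open>sx = 0\<close>, \<open>sy = 1\<close>, the condition \<open>z = 0\<close>
  is respected by the lift of \<open>\<phi>\<close>, so constants of the large ring are sent to
  constants of \<open>K[X_d]\<close>.\<close>

definition retract :: "('n::finite magnus_index, 'k::field) mpoly \<Rightarrow> ('n, 'k) mpoly"
  where "retract = poly_subst (magnus_fun poly_gen (\<lambda>_. 0) 0 1)"

definition dZ :: "'n \<Rightarrow> ('n::finite magnus_index, 'k::field) mpoly \<Rightarrow> ('n magnus_index, 'k) mpoly"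
  where "dZ i = poly_derivation (magnus_fun (\<lambda>_. 0) (\<lambda>j. if j = i then 1 else 0) 0 0)"

lemma algebra_hom_poly_embed: "algebra_hom poly_embed"
  unfolding poly_embed_def by (rule algebra_hom_poly_subst)

lemma algebra_hom_retract: "algebra_hom retract"
  unfolding retract_def by (rule algebra_hom_poly_subst)

lemma derivation_dZ: "derivation pm_scale (*) (dZ i)"
  unfolding dZ_def by (rule derivation_poly_derivation)

lemma poly_embed_gen [simp]: "poly_embed (poly_gen i) = X i"
  by (simp add: poly_embed_def)

lemma retract_simps [simp]:
  "retract (X i) = poly_gen i" "retract (Z i) = 0" "retract sx = 0" "retract sy = 1"
  by (simp_all add: retract_def)

lemma dZ_simps [simp]:
  "dZ i (X j) = 0" "dZ i (Z j) = (if j = i then 1 else 0)" "dZ i sx = 0" "dZ i sy = 0"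
  by (simp_all add: dZ_def)

lemma retract_poly_embed [simp]: "retract (poly_embed f) = f"
  by (induction f rule: mpoly_induct)
    (simp_all add: algebra_hom_simps[OF algebra_hom_poly_embed] algebra_hom_simps[OF algebra_hom_retract])

lemma dZ_poly_embed [simp]: "dZ i (poly_embed f) = 0"
  by (induction f rule: mpoly_induct)
    (simp_all add: algebra_hom_simps[OF algebra_hom_poly_embed] derivation_mpolyD[OF derivation_dZ]
      linear_simps[OF derivation_mpolyD(1)[OF derivation_dZ]])

text \<open>Differentiating by \<open>z_i\<close> before setting \<open>z = 0\<close> extracts the
  coefficient of \<open>z_i\<close> in the part linear in \<open>z\<close>, with no grading of the
  ring.\<close>

definition coefficient :: "'n \<Rightarrow> ('n::finite magnus_index, 'k::field) mpoly \<Rightarrow> ('n, 'k) mpoly"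
  where "coefficient i p = retract (dZ i p)"

lemma linear_coefficient: "Vector_Spaces.linear pm_scale pm_scale (coefficient i)"
  by (rule pm_linearI)
    (simp_all add: coefficient_def algebra_hom_simps[OF algebra_hom_retract]
      linear_simps[OF derivation_mpolyD(1)[OF derivation_dZ]])

lemma coefficient_mult:
  "coefficient i (p * q) = coefficient i p * retract q + retract p * coefficient i q"
  by (simp add: coefficient_def derivation_mpolyD[OF derivation_dZ] algebra_hom_simps[OF algebra_hom_retract])

lemma coefficient_simps [simp]:
  "coefficient i (X j) = 0" "coefficient i (Z j) = (if j = i then 1 else 0)" "coefficient i (poly_embed f) = 0"
  by (simp_all add: coefficient_def algebra_hom_simps[OF algebra_hom_retract])

definition pair_scale :: "'k::field \<Rightarrow> ('a \<Rightarrow>\<^sub>0 'k) \<times> ('b \<Rightarrow>\<^sub>0 'k) \<Rightarrow> ('a \<Rightarrow>\<^sub>0 'k) \<times> ('b \<Rightarrow>\<^sub>0 'k)"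
  where "pair_scale c u = (pm_scale c (fst u), pm_scale c (snd u))"

text \<open>The semidirect product of two abelian copies of the ring, the first acting on the second
  by multiplication. Brackets have first component 0, so it is metabelian, and bracketing such an
  element with \<open>(X j, Z j)\<close> multiplies it by \<open>X j\<close>.\<close>

definition magnus_bracket :: "'a::comm_ring_1 \<times> 'a \<Rightarrow> 'a \<times> 'a \<Rightarrow> 'a \<times> 'a"
  where "magnus_bracket u v = (0, snd u * fst v - snd v * fst u)"

lemma lie_algebra_magnus:
  "lie_algebra pair_scale (magnus_bracket :: ('j, 'k::field) mpoly \<times> ('j, 'k) mpoly \<Rightarrow> _)"
  by unfold_locales
    (auto simp: pair_scale_def magnus_bracket_def prod_eq_iff pm.scale_left_distrib pm.scale_right_distrib
      pm.scale_right_diff_distrib pm_scale_mult_left pm_scale_mult_right algebra_simps)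

lemma exists_magnus_hom:
  "\<exists>\<Psi> :: ('n, 'k::field) free_metabelian \<Rightarrow> ('n::finite magnus_index, 'k) mpoly \<times> ('n magnus_index, 'k) mpoly.
    Vector_Spaces.linear fm_scale pair_scale \<Psi> \<and>
    (\<forall>u v. \<Psi> (fm_bracket u v) = magnus_bracket (\<Psi> u) (\<Psi> v)) \<and> (\<forall>j. \<Psi> (fm_gen j) = (X j, Z j))"
proof -
  interpret L: lie_algebra pair_scale
    "magnus_bracket :: ('n magnus_index, 'k) mpoly \<times> ('n magnus_index, 'k) mpoly \<Rightarrow> _"
    by (rule lie_algebra_magnus)
  have "fst a = 0" if "a \<in> L.derived" for a
    using that unfolding L.commutator_def
    by (induction rule: L.span_induct_alt) (auto simp: magnus_bracket_def pair_scale_def)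
  then show ?thesis by (intro L.free_metabelian_universal) (simp add: magnus_bracket_def zero_prod_def)
qed

definition magnus_hom ::
    "('n, 'k::field) free_metabelian \<Rightarrow> ('n::finite magnus_index, 'k) mpoly \<times> ('n magnus_index, 'k) mpoly"
  where "magnus_hom = (SOME \<Psi>. Vector_Spaces.linear fm_scale pair_scale \<Psi> \<and>
    (\<forall>u v. \<Psi> (fm_bracket u v) = magnus_bracket (\<Psi> u) (\<Psi> v)) \<and> (\<forall>j. \<Psi> (fm_gen j) = (X j, Z j)))"

lemma magnus_hom:
  "Vector_Spaces.linear fm_scale pair_scale magnus_hom"
  "magnus_hom (fm_bracket u v) = magnus_bracket (magnus_hom u) (magnus_hom v)"
  "magnus_hom (fm_gen j) = (X j, Z j)"
  using someI_ex[OF exists_magnus_hom] unfolding magnus_hom_def[symmetric] by blast+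

definition magnus :: "('n, 'k::field) free_metabelian \<Rightarrow> ('n::finite magnus_index, 'k) mpoly"
  where "magnus u = snd (magnus_hom u)"

lemma linear_magnus: "Vector_Spaces.linear fm_scale pm_scale magnus"
  by unfold_locales (simp_all add: magnus_def linear_simps[OF magnus_hom(1)] pair_scale_def
      fm.scale_right_distrib fm.scale_left_distrib pm.scale_right_distrib pm.scale_left_distrib)

lemma magnus_ad:
  "u \<in> fm_commutator_ideal \<Longrightarrow> magnus (fm_ad j u) = magnus u * X j"
proof -
  assume "u \<in> fm_commutator_ideal"
  then have "fst (magnus_hom u) = 0"
    unfolding fm_commutator_ideal_eq fm.commutator_def
    by (induction rule: fm.span_induct_alt)
      (auto simp: linear_simps[OF magnus_hom(1)] magnus_hom(2) magnus_bracket_def pair_scale_def)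
  then show ?thesis by (simp add: magnus_def fm_ad_def magnus_hom(2,3) magnus_bracket_def)
qed

lemma magnus_ad_monomial:
  fixes u :: "('n::{finite, linorder}, 'k::field) free_metabelian"
  assumes "u \<in> fm_commutator_ideal"
  shows "magnus (fm_ad_monomial m u) = magnus u * poly_embed (Poly_Mapping.single m 1)"
proof -
  have pow: "magnus ((fm_ad j ^^ n) v) = magnus v * X j ^ n" if "v \<in> fm_commutator_ideal"
    for j n and v :: "('n, 'k) free_metabelian"
    by (induction n) (simp_all add: that magnus_ad fm_ad_pow_in_commutator_ideal mult_ac)
  let ?f = "\<lambda>xs. foldr (\<lambda>j. fm_ad j ^^ Poly_Mapping.lookup m j) xs u"
  have mem: "?f xs \<in> fm_commutator_ideal" for xs
    by (induction xs) (simp_all add: assms fm_ad_pow_in_commutator_ideal)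
  have "magnus (?f xs) = magnus u * (\<Prod>j\<in>set xs. X j ^ Poly_Mapping.lookup m j)" if "distinct xs" for xs
    using that by (induction xs) (simp_all add: pow mem mult_ac)
  from this[of "sorted_list_of_set UNIV"] show ?thesis
    by (simp add: fm_ad_monomial_def poly_embed_def poly_subst_def)
qed

lemma magnus_act:
  assumes "u \<in> fm_commutator_ideal"
  shows "magnus (fm_act u f) = magnus u * poly_embed f"
  unfolding fm_act_def
  by (induction f rule: pm_linear_induct)
    (simp_all add: linear_simps[OF fm.linear_linear_extension] linear_simps[OF linear_magnus]
      algebra_hom_simps[OF algebra_hom_poly_embed] magnus_ad_monomial[OF assms] distrib_left pm_scale_mult_right)

lemma magnus_basic:
  "magnus (fm_basic m i j) = (Z i * X j - Z j * X i) * poly_embed (Poly_Mapping.single m 1)"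
  by (subst magnus_ad_monomial[OF fm_commutator_ideal_simps(4)])
    (simp add: magnus_def magnus_hom magnus_bracket_def)

text \<open>The contracting homotopy of the Koszul complex, \<open>z\<^sub>i f \<mapsto> \<Sum>\<^sub>j [x\<^sub>i, x\<^sub>j] \<partial>f/\<partial>x\<^sub>j\<close> up to a
  factor depending on the degree.\<close>

definition koszul :: "'n \<Rightarrow> ('n::{finite, linorder}, 'k::field_char_0) mpoly \<Rightarrow> ('n, 'k) free_metabelian"
  where "koszul i = linear_extension fm_scale (\<lambda>m.
    fm_scale (1 / (1 + (\<Sum>j\<in>UNIV. of_nat (Poly_Mapping.lookup m j))))
      (\<Sum>j\<in>UNIV. fm_scale (of_nat (Poly_Mapping.lookup m j)) (fm_basic (m - Poly_Mapping.single j 1) i j)))"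

text \<open>The left side is the homotopy applied to the coefficients of
  \<open>magnus (fm_basic m i j)\<close>. Its monomials have degree one more than \<open>m\<close>,
  whence the denominator \<open>2 + ?d m\<close>. Differentiating the added variables gives two
  copies of \<open>fm_basic m i j\<close>; Jacobi's identity and Euler's formula give
  \<open>?d m\<close> more.\<close>

lemma koszul_basic:
  fixes m :: "'n::{finite, linorder} \<Rightarrow>\<^sub>0 nat"
  shows "koszul i (poly_gen j * Poly_Mapping.single m 1) - koszul j (poly_gen i * Poly_Mapping.single m 1)
    = (fm_basic m i j :: ('n, 'k::field_char_0) free_metabelian)"
proof -
  let ?e = "\<lambda>i. Poly_Mapping.single i (1::nat)"
  let ?d = "\<lambda>m. (\<Sum>j\<in>UNIV. of_nat (Poly_Mapping.lookup m j)) :: 'k"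
  let ?ad = "\<lambda>k l i. fm_ad_monomial (m - ?e k) (fm_ad l (fm_bracket (fm_gen i) (fm_gen k)))
    :: ('n, 'k) free_metabelian"
  note ad = linear_simps[OF linear_fm_ad_monomial]
  have d: "?d (m + ?e j) = ?d m + 1" for j
  proof -
    have "?d (m + ?e j) = ?d m + (\<Sum>k\<in>UNIV. if k = j then 1 else 0)"
      unfolding sum.distrib[symmetric] by (rule sum.cong) (auto simp: lookup_add lookup_single when_def)
    then show ?thesis by simp
  qed
  have half: "(\<Sum>k\<in>UNIV. fm_scale (of_nat (Poly_Mapping.lookup (m + ?e j) k)) (fm_basic (m + ?e j - ?e k) i k))
    = fm_basic m i j + (\<Sum>k\<in>UNIV. fm_scale (of_nat (Poly_Mapping.lookup m k)) (?ad k j i))" for i j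
  proof -
    have "fm_scale (of_nat (Poly_Mapping.lookup (m + ?e j) k)) (fm_basic (m + ?e j - ?e k) i k)
      = (if k = j then fm_basic m i j else 0) + fm_scale (of_nat (Poly_Mapping.lookup m k)) (?ad k j i)" for k
    proof -
      have eq: "fm_scale (of_nat (Poly_Mapping.lookup m k)) (fm_basic (m + ?e j - ?e k) i k)
        = fm_scale (of_nat (Poly_Mapping.lookup m k)) (?ad k j i)"
      proof (cases "Poly_Mapping.lookup m k = 0")
        case False
        then have "m + ?e j - ?e k = (m - ?e k) + ?e j"
          by (intro poly_mapping_eqI) (auto simp: lookup_add lookup_minus lookup_single when_def)
        then show ?thesis
          by (simp only: fm_ad_monomial_add_single[OF fm_commutator_ideal_simps(4)])
      qed simp
      show ?thesis
        by (cases "k = j")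
          (use eq in \<open>simp_all add: lookup_add lookup_single fm.scale_left_distrib\<close>)
    qed
    then show ?thesis by (simp add: sum.distrib)
  qed
  have jacobi: "?ad k j i - ?ad k i j = fm_ad_monomial (m - ?e k) (fm_ad k (fm_bracket (fm_gen i) (fm_gen j)))" for k
  proof -
    have "fm_ad k (fm_bracket (fm_gen i) (fm_gen j)) = fm_ad j (fm_bracket (fm_gen i) (fm_gen k))
        - fm_ad i (fm_bracket (fm_gen j) (fm_gen k) :: ('n, 'k) free_metabelian)"
      unfolding fm_ad_def fm.bracket_jacobi_left[of "fm_gen i" "fm_gen j"]
      by (simp add: fm.bracket_anti[of "fm_gen i" "fm_bracket _ _"])
    then show ?thesis by (simp add: ad)
  qed
  \<comment> \<open>Dividing by \<open>x_k\<close> and multiplying by it again restores the monomial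
    wherever the factor \<open>lookup m k\<close> is nonzero.\<close>
  have euler: "fm_scale (of_nat (Poly_Mapping.lookup m k)) (?ad k j i - ?ad k i j)
      = fm_scale (of_nat (Poly_Mapping.lookup m k)) (fm_basic m i j)" for k
  proof (cases "Poly_Mapping.lookup m k = 0")
    case False
    then have "m = (m - ?e k) + ?e k"
      by (intro poly_mapping_eqI) (auto simp: lookup_add lookup_minus lookup_single when_def)
    then have "fm_basic m i j = fm_ad_monomial (m - ?e k) (fm_ad k (fm_bracket (fm_gen i) (fm_gen j)) :: ('n, 'k) free_metabelian)"
      by (metis fm_ad_monomial_add_single[OF fm_commutator_ideal_simps(4)])
    then show ?thesis unfolding jacobi by simp
  qed simp
  have anti: "fm_basic m j i = - (fm_basic m i j :: ('n, 'k) free_metabelian)"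
    by (subst fm.bracket_anti) (simp add: ad)
  have x: "poly_gen j * Poly_Mapping.single m 1 = (Poly_Mapping.single (m + ?e j) 1 :: ('n, 'k) mpoly)" for j
    by (simp add: poly_gen_def mult_single add.commute)
  have nz: "(2::'k) + ?d m \<noteq> 0"
  proof -
    have "(2::'k) + ?d m = of_nat (2 + (\<Sum>j\<in>UNIV. Poly_Mapping.lookup m j))" by simp
    then show ?thesis by (simp only: of_nat_eq_0_iff)
  qed
  have "koszul i (poly_gen j * Poly_Mapping.single m 1) - koszul j (poly_gen i * Poly_Mapping.single m 1)
    = fm_scale (1 / (2 + ?d m)) (fm_basic m i j - fm_basic m j i
        + (\<Sum>k\<in>UNIV. fm_scale (of_nat (Poly_Mapping.lookup m k)) (?ad k j i - ?ad k i j)))"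
    unfolding x koszul_def fm.linear_extension_single d half
    by (simp add: fm.scale_right_diff_distrib fm.scale_right_distrib sum_subtractf add_ac)
  also have "\<dots> = fm_scale (1 / (2 + ?d m)) (fm_scale (2 + ?d m) (fm_basic m i j))"
  proof -
    have "(2::'k) = 1 + 1" by simp
    then have "fm_scale (2 + ?d m) (fm_basic m i j) = fm_basic m i j + fm_basic m i j
        + (\<Sum>k\<in>UNIV. fm_scale (of_nat (Poly_Mapping.lookup m k)) (fm_basic m i j))"
      by (simp only: fm.scale_left_distrib fm.scale_sum_left fm.scale_one)
    then show ?thesis unfolding euler anti by simp
  qed
  also have "\<dots> = fm_basic m i j" using nz by simp
  finally show ?thesis .
qed

text \<open>The homotopy provides a left inverse \<open>\<eta>\<close> of \<open>magnus\<close> on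
  the commutator ideal, checked on a spanning set. As \<open>\<eta>\<close> sees only the
  coefficients, their vanishing suffices, and it is what the final comparison delivers.\<close>

theorem magnus_injective:
  fixes u :: "('n::{finite, linorder}, 'k::field_char_0) free_metabelian"
  assumes "u \<in> fm_commutator_ideal" "\<And>k. coefficient k (magnus u) = 0"
  shows "u = 0"
proof -
  define \<eta> :: "('n magnus_index, 'k) mpoly \<Rightarrow> ('n, 'k) free_metabelian"
    where "\<eta> p = (\<Sum>k\<in>UNIV. koszul k (coefficient k p))" for p
  have lk: "Vector_Spaces.linear pm_scale fm_scale (koszul k :: ('n, 'k) mpoly \<Rightarrow> _)" for k
    unfolding koszul_def by (rule fm.linear_linear_extension)
  note k = linear_simps[OF lk]
  note c = linear_simps[OF linear_coefficient]
  have \<eta>: "\<eta> (p + q) = \<eta> p + \<eta> q" "\<eta> (pm_scale a p) = fm_scale a (\<eta> p)" "\<eta> 0 = 0" for p q a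
    by (simp_all add: \<eta>_def k c sum.distrib fm.scale_sum_right)
  have basic: "\<eta> (magnus (fm_basic m i j)) = fm_basic m i j" for m i j
  proof -
    have "coefficient k (magnus (fm_basic m i j)) =
        (if k = i then poly_gen j * Poly_Mapping.single m 1 else 0)
        - (if k = j then poly_gen i * Poly_Mapping.single m 1 else (0 :: ('n, 'k) mpoly))" for k
      by (auto simp: magnus_basic coefficient_mult c algebra_hom_simps[OF algebra_hom_retract])
    then have "\<eta> (magnus (fm_basic m i j)) =
        (\<Sum>k\<in>UNIV. (if k = i then koszul i (poly_gen j * Poly_Mapping.single m 1) else 0)
          - (if k = j then koszul j (poly_gen i * Poly_Mapping.single m 1) else 0))"
      unfolding \<eta>_def by (intro sum.cong) (auto simp: k)
    then show ?thesis by (simp add: sum_subtractf koszul_basic)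
  qed
  have "u \<in> fm.span {fm_basic m i j | m i j. True}" using assms(1) fm_commutator_ideal_span by blast
  then have "\<eta> (magnus u) = u"
    by (induction rule: fm.span_induct_alt) (auto simp: \<eta> linear_simps[OF linear_magnus] basic)
  then show ?thesis by (simp add: assms(2) \<eta>_def k)
qed


section \<open>Weitzenboeck derivations in Magnus coordinates\<close>

definition LX :: "'k::field ^ 'n::finite \<Rightarrow> ('n magnus_index, 'k) mpoly"
  where "LX v = (\<Sum>j\<in>UNIV. pm_scale (v $ j) (X j))"

definition LZ :: "'k::field ^ 'n::finite \<Rightarrow> ('n magnus_index, 'k) mpoly"
  where "LZ v = (\<Sum>j\<in>UNIV. pm_scale (v $ j) (Z j))"

lemma L_axis: "LX (axis i 1) = X i" "LZ (axis i 1) = Z i"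
proof -
  have "LX (axis i 1) = (\<Sum>j\<in>UNIV. if j = i then X j else 0)"
    "LZ (axis i 1) = (\<Sum>j\<in>UNIV. if j = i then Z j else 0)"
    unfolding LX_def LZ_def by (intro sum.cong; simp add: axis_def)+
  then show "LX (axis i 1) = X i" "LZ (axis i 1) = Z i" by simp_all
qed

lemma linear_L: "Vector_Spaces.linear (*s) pm_scale LX" "Vector_Spaces.linear (*s) pm_scale LZ"
  by (unfold_locales; simp add: LX_def LZ_def pm.scale_left_distrib pm.scale_right_distrib sum.distrib
      pm.scale_sum_right)+

lemmas L_simps = linear_simps[OF linear_L(1)] linear_simps[OF linear_L(2)]

text \<open>\<open>T\<close> acts alike on both sets of variables because \<open>x_i\<close> and
  \<open>z_i\<close> are the components of the image of one Lie generator.\<close>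

definition lift_operator ::
    "('k::field ^ 'n::finite \<Rightarrow> 'k ^ 'n) \<Rightarrow> ('n magnus_index, 'k) mpoly \<Rightarrow> ('n magnus_index, 'k) mpoly \<Rightarrow>
      ('n magnus_index, 'k) mpoly \<Rightarrow> ('n magnus_index, 'k) mpoly"
  where "lift_operator T a b =
    poly_derivation (magnus_fun (\<lambda>i. LX (T (axis i 1))) (\<lambda>i. LZ (T (axis i 1))) a b)"

lemma derivation_lift_operator: "derivation pm_scale (*) (lift_operator T a b)"
  unfolding lift_operator_def by (rule derivation_poly_derivation)

lemma lift_operator_gens [simp]:
  "lift_operator T a b (X i) = LX (T (axis i 1))" "lift_operator T a b (Z i) = LZ (T (axis i 1))"
  "lift_operator T a b sx = a" "lift_operator T a b sy = b"
  by (simp_all add: lift_operator_def)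

lemma lift_operator_L:
  assumes T: "Vector_Spaces.linear (*s) (*s) T"
  shows "lift_operator T a b (LX v) = LX (T v)" "lift_operator T a b (LZ v) = LZ (T v)"
proof -
  note l = linear_simps[OF derivation_mpolyD(1)[OF derivation_lift_operator]]
  have "T v = (\<Sum>i\<in>UNIV. v $ i *s T (axis i 1))"
    by (subst basis_expansion[symmetric]) (simp only: linear_simps[OF T])
  then have "LX (T v) = (\<Sum>i\<in>UNIV. pm_scale (v $ i) (LX (T (axis i 1))))"
    "LZ (T v) = (\<Sum>i\<in>UNIV. pm_scale (v $ i) (LZ (T (axis i 1))))"
    by (simp_all only: L_simps)
  then show "lift_operator T a b (LX v) = LX (T v)" "lift_operator T a b (LZ v) = LZ (T v)"
    unfolding LX_def[of v] LZ_def[of v] by (simp_all add: l)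
qed

lemma lift_operator_pow:
  assumes "Vector_Spaces.linear (*s) (*s) T"
  shows "(lift_operator T a b ^^ n) (LX v) = LX ((T ^^ n) v)"
    "(lift_operator T a b ^^ n) (LZ v) = LZ ((T ^^ n) v)"
  by (induction n) (simp_all add: lift_operator_L[OF assms])

definition eval_spin :: "('n::finite magnus_index, 'k::field) mpoly \<Rightarrow> ('n magnus_index, 'k) mpoly"
  where "eval_spin = poly_subst (magnus_fun X Z 0 1)"

lemma algebra_hom_eval_spin: "algebra_hom eval_spin"
  unfolding eval_spin_def by (rule algebra_hom_poly_subst)

lemma eval_spin_gens [simp]:
  "eval_spin (X i) = X i" "eval_spin (Z i) = Z i" "eval_spin sx = 0" "eval_spin sy = 1"
  by (simp_all add: eval_spin_def)

lemma eval_spin_L [simp]: "eval_spin (LX v) = LX v" "eval_spin (LZ v) = LZ v"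
  by (simp_all add: LX_def LZ_def algebra_hom_simps[OF algebra_hom_eval_spin])

lemma L_weights:
  assumes T: "Vector_Spaces.linear (*s) (*s) T" and "v \<in> vec.span (eigenvectors (*s) T)"
  shows "LX v \<in> pm.span (eigenvectors pm_scale (lift_operator T a b))"
    "LZ v \<in> pm.span (eigenvectors pm_scale (lift_operator T a b))"
proof -
  let ?E = "eigenvectors pm_scale (lift_operator T a b)"
  have "LX x \<in> ?E" "LZ x \<in> ?E" if "x \<in> eigenvectors (*s) T" for x
    using that by (auto simp: eigenvectors_def lift_operator_L[OF T] L_simps)
  then have base: "LX x \<in> pm.span ?E" "LZ x \<in> pm.span ?E" if "x \<in> eigenvectors (*s) T" for x
    using that pm.span_base by blast+
  show "LX v \<in> pm.span ?E"
    using assms(2) by (induction rule: vec.span_induct_alt)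
      (simp_all add: L_simps pm.span_zero pm.span_add pm.span_scale base)
  show "LZ v \<in> pm.span ?E"
    using assms(2) by (induction rule: vec.span_induct_alt)
      (simp_all add: L_simps pm.span_zero pm.span_add pm.span_scale base)
qed

text \<open>On the variables the relations are those of \<open>e\<close>, \<open>f\<close>,
  \<open>h\<close> and of the natural representation, in which \<open>sx\<close> and
  \<open>sy\<close> have weights 1 and -1.\<close>

lemma sl2_poly_lift:
  fixes e f h :: "'k::field_char_0 ^ 'n::finite \<Rightarrow> 'k ^ 'n"
  assumes lin: "Vector_Spaces.linear (*s) (*s) e" "Vector_Spaces.linear (*s) (*s) f"
      "Vector_Spaces.linear (*s) (*s) h"
    and rel: "\<And>v. e (f v) = f (e v) + h v" "\<And>v. h (e v) = e (h v) + 2 *s e v"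
      "\<And>v. h (f v) = f (h v) - 2 *s f v"
    and nil: "\<And>v. (e ^^ M) v = 0" "\<And>v. (f ^^ N) v = 0"
    and weights: "\<And>v. v \<in> vec.span (eigenvectors (*s) h)"
  shows "sl2_poly (lift_operator e 0 sx) (lift_operator f sy 0) (lift_operator h sx (- sy)) sx sy eval_spin"
proof -
  let ?E = "lift_operator e 0 sx" and ?F = "lift_operator f sy 0" and ?H = "lift_operator h sx (- sy)"
  note L = lift_operator_L[OF lin(1)] lift_operator_L[OF lin(2)] lift_operator_L[OF lin(3)]
  note der = derivation_lift_operator[of e 0 sx] derivation_lift_operator[of f sy 0]
    derivation_lift_operator[of h sx "- sy"]
  note l = linear_simps[OF derivation_mpolyD(1)[OF der(1)]] linear_simps[OF derivation_mpolyD(1)[OF der(2)]]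
    linear_simps[OF derivation_mpolyD(1)[OF der(3)]]
  have "?E (?F p) - ?F (?E p) = ?H p" for p
    by (rule derivation_eqI[OF derivation_combination(2)[OF der(1,2)] der(3)], rule magnus_index_cases)
      (simp_all add: L l rel(1) L_simps)
  then have EF: "?E (?F p) = ?F (?E p) + ?H p" for p by (metis add.commute diff_add_cancel)
  have "?H (?E p) - ?E (?H p) = pm_scale 2 (?E p)" for p
    by (rule derivation_eqI[OF derivation_combination(2)[OF der(3,1)] derivation_combination(1)[OF der(1,1)]],
        rule magnus_index_cases)
      (simp_all add: L l rel(2) L_simps pm.scale_left_distrib[of 1 1, simplified])
  then have HE: "?H (?E p) = ?E (?H p) + pm_scale 2 (?E p)" for p by (metis add.commute diff_add_cancel)
  have "?H (?F p) - ?F (?H p) = pm_scale (- 2) (?F p)" for p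
    by (rule derivation_eqI[OF derivation_combination(2)[OF der(3,2)] derivation_combination(1)[OF der(2,2)]],
        rule magnus_index_cases)
      (simp_all add: L l rel(3) L_simps pm.scale_left_distrib[of 1 1, simplified])
  then have "?H (?F p) = ?F (?H p) + pm_scale (- 2) (?F p)" for p by (metis add.commute diff_add_cancel)
  then have HF: "?H (?F p) = ?F (?H p) - pm_scale 2 (?F p)" for p by simp
  have "\<exists>n. (?E ^^ n) (poly_gen t) = 0" for t
  proof (rule magnus_index_cases)
    show "\<exists>n. (?E ^^ n) (X i) = 0" "\<exists>n. (?E ^^ n) (Z i) = 0" for i
      using lift_operator_pow[OF lin(1), where n = M and a = 0 and b = sx and v = "axis i 1"] by (auto simp: L_axis nil L_simps)
    show "\<exists>n. (?E ^^ n) sx = 0" by (rule exI[of _ 1]) simp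
    show "\<exists>n. (?E ^^ n) sy = 0" by (rule exI[of _ 2]) (simp add: numeral_2_eq_2)
  qed
  then have nE: "\<exists>n. (?E ^^ n) p = 0" for p by (rule locally_nilpotentI[OF der(1)])
  have "\<exists>n. (?F ^^ n) (poly_gen t) = 0" for t
  proof (rule magnus_index_cases)
    show "\<exists>n. (?F ^^ n) (X i) = 0" "\<exists>n. (?F ^^ n) (Z i) = 0" for i
      using lift_operator_pow[OF lin(2), where n = N and a = sy and b = 0 and v = "axis i 1"] by (auto simp: L_axis nil L_simps)
    show "\<exists>n. (?F ^^ n) sx = 0" by (rule exI[of _ 2]) (simp add: numeral_2_eq_2)
    show "\<exists>n. (?F ^^ n) sy = 0" by (rule exI[of _ 1]) simp
  qed
  then have nF: "\<exists>n. (?F ^^ n) p = 0" for p by (rule locally_nilpotentI[OF der(2)])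
  have "poly_gen t \<in> pm.span (eigenvectors pm_scale ?H)" for t
  proof (rule magnus_index_cases)
    show "X i \<in> pm.span (eigenvectors pm_scale ?H)" "Z i \<in> pm.span (eigenvectors pm_scale ?H)" for i
      using L_weights[OF lin(3) weights, of "axis i 1"] by (simp_all add: L_axis)
    have "?H sx = pm_scale 1 sx" "?H sy = pm_scale (- 1) sy" by simp_all
    then show "sx \<in> pm.span (eigenvectors pm_scale ?H)" "sy \<in> pm.span (eigenvectors pm_scale ?H)"
      unfolding eigenvectors_def by (blast intro: pm.span_base)+
  qed
  then have w: "p \<in> pm.span (eigenvectors pm_scale ?H)" for p by (rule eigenvectors_spanI[OF der(3)])
  have ev: "eval_spin (?E p) = ?E (eval_spin p)" for p
    by (rule algebra_hom_intertwine[OF algebra_hom_eval_spin der(1,1)], rule magnus_index_cases)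
      (simp_all add: algebra_hom_simps[OF algebra_hom_eval_spin] l derivation_mpolyD(3)[OF der(1)])
  show ?thesis
    by unfold_locales
      (simp_all add: l EF HE HF der nE nF w ev algebra_hom_eval_spin)
qed

lemma fm_gen_lin: "fm_gen j = (fm_lin (axis j 1) :: ('n::finite, 'k::field) free_metabelian)"
proof -
  have "(fm_lin (axis j 1) :: ('n, 'k) free_metabelian) = (\<Sum>i\<in>UNIV. if i = j then fm_gen i else 0)"
    unfolding fm_lin_def by (intro sum.cong) (simp_all add: axis_def)
  then show ?thesis by simp
qed

lemma poly_gen_lin: "poly_gen j = (poly_lin (axis j 1) :: ('n::finite, 'k::field) mpoly)"
proof -
  have "(poly_lin (axis j 1) :: ('n, 'k) mpoly) = (\<Sum>i\<in>UNIV. if i = j then poly_gen i else 0)"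
    unfolding poly_lin_def by (intro sum.cong) (simp_all add: axis_def)
  then show ?thesis by simp
qed

lemma magnus_hom_lin:
  fixes v :: "'k::field ^ 'n::finite"
  shows "magnus_hom (fm_lin v) = (LX v, LZ v)"
  by (simp add: fm_lin_def linear_simps[OF magnus_hom(1)] magnus_hom(3) pair_scale_def LX_def LZ_def
      prod_eq_iff fst_sum snd_sum)

text \<open>No term of \<open>magnus u\<close> is free of \<open>z\<close>. This removes one of the
  two terms in \<open>coefficient_mult\<close> when a relation is compared coefficientwise.\<close>

lemma retract_magnus: "retract (magnus u) = 0"
  by (induction u rule: free_metabelian_induct)
    (simp_all add: magnus_def linear_simps[OF magnus_hom(1)] magnus_hom(2,3) pair_scale_def
      magnus_bracket_def algebra_hom_simps[OF algebra_hom_retract])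

lemma eval_spin_magnus: "eval_spin (magnus u) = magnus u"
proof -
  have "eval_spin (fst (magnus_hom u)) = fst (magnus_hom u) \<and> eval_spin (snd (magnus_hom u)) = snd (magnus_hom u)"
    by (induction u rule: free_metabelian_induct)
      (simp_all add: linear_simps[OF magnus_hom(1)] magnus_hom(2,3) pair_scale_def
        magnus_bracket_def algebra_hom_simps[OF algebra_hom_eval_spin])
  then show ?thesis by (simp add: magnus_def)
qed

text \<open>The induction has to carry both components of \<open>magnus_hom\<close>, since brackets
  mix them. The values \<open>a\<close> and \<open>b\<close> are arbitrary because \<open>sx\<close>
  and \<open>sy\<close> do not occur in the image.\<close>

lemma magnus_derivation:
  assumes "extends_to_fm \<phi> \<delta>" and \<phi>: "Vector_Spaces.linear (*s) (*s) \<phi>"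
  shows "magnus (\<delta> u) = lift_operator \<phi> a b (magnus u)"
proof -
  let ?E = "lift_operator \<phi> a b"
  have \<delta>: "Vector_Spaces.linear fm_scale fm_scale \<delta>" "\<And>u v. \<delta> (fm_bracket u v) = fm_bracket (\<delta> u) v + fm_bracket u (\<delta> v)"
    "\<And>j. \<delta> (fm_gen j) = fm_lin (\<phi> (axis j 1))"
    using assms(1) by (auto simp: extends_to_fm_def derivation_def fm_gen_lin)
  note der = derivation_mpolyD[OF derivation_lift_operator]
  have "fst (magnus_hom (\<delta> u)) = ?E (fst (magnus_hom u)) \<and> snd (magnus_hom (\<delta> u)) = ?E (snd (magnus_hom u))"
    by (induction u rule: free_metabelian_induct)
      (simp_all add: linear_simps[OF \<delta>(1)] \<delta>(2,3) linear_simps[OF magnus_hom(1)] magnus_hom(2,3) pair_scale_def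
        magnus_bracket_def linear_simps[OF der(1)] der(2,3) magnus_hom_lin algebra_simps)
  then show ?thesis by (simp add: magnus_def)
qed

text \<open>Constants are moved both ways: \<open>poly_embed\<close> serves to show that they act on
  the constants of the module, \<open>retract\<close> returns coefficients found in the large ring
  to \<open>K[X_d]\<close>.\<close>

lemma poly_derivation_transfer:
  assumes "extends_to_poly \<phi> \<delta>\<^sub>K" and \<phi>: "Vector_Spaces.linear (*s) (*s) \<phi>"
  shows "retract (lift_operator \<phi> 0 sx p) = \<delta>\<^sub>K (retract p)"
    and "poly_embed (\<delta>\<^sub>K f) = lift_operator \<phi> 0 sx (poly_embed f)"
proof -
  have der: "derivation pm_scale (*) \<delta>\<^sub>K" and gen: "\<delta>\<^sub>K (poly_gen i) = poly_lin (\<phi> (axis i 1))" for i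
    using assms(1) by (auto simp: extends_to_poly_def poly_gen_lin)
  have L: "retract (LX v) = poly_lin v" "retract (LZ v) = 0" "poly_embed (poly_lin v) = LX v" for v
    by (simp_all add: LX_def LZ_def poly_lin_def algebra_hom_simps[OF algebra_hom_retract]
        algebra_hom_simps[OF algebra_hom_poly_embed])
  show "retract (lift_operator \<phi> 0 sx p) = \<delta>\<^sub>K (retract p)"
    by (rule algebra_hom_intertwine[OF algebra_hom_retract derivation_lift_operator der], rule magnus_index_cases)
      (simp_all add: L gen linear_simps[OF derivation_mpolyD(1)[OF der]] derivation_mpolyD(3)[OF der]
        algebra_hom_simps[OF algebra_hom_retract])
  show "poly_embed (\<delta>\<^sub>K f) = lift_operator \<phi> 0 sx (poly_embed f)"
    by (rule algebra_hom_intertwine[OF algebra_hom_poly_embed der derivation_lift_operator]) (simp add: L gen)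
qed

lemma derivation_fm_commutator_ideal:
  assumes "derivation fm_scale fm_bracket \<delta>" "u \<in> fm_commutator_ideal"
  shows "\<delta> u \<in> fm_commutator_ideal"
proof -
  have l: "Vector_Spaces.linear fm_scale fm_scale \<delta>"
    and L: "\<And>u v. \<delta> (fm_bracket u v) = fm_bracket (\<delta> u) v + fm_bracket u (\<delta> v)"
    using assms(1) by (auto simp: derivation_def)
  from assms(2)[unfolded fm_commutator_ideal_eq fm.commutator_def] show ?thesis
    by (induction rule: fm.span_induct_alt) (auto simp: linear_simps[OF l] L fm_commutator_ideal_simps)
qed

theorem theorem2p2:
  fixes \<phi> :: "'k::field_char_0 ^ 'n::{finite, linorder} \<Rightarrow> 'k ^ 'n::{finite, linorder}"
    and \<delta> :: "('n, 'k) free_metabelian \<Rightarrow> ('n, 'k) free_metabelian"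
    and \<delta>\<^sub>K :: "('n, 'k) mpoly \<Rightarrow> ('n, 'k) mpoly"
  assumes "CARD('n) \<ge> 2"
    and "nonzero_nilpotent_operator \<phi>"
    and "extends_to_fm \<phi> \<delta>"
    and "extends_to_poly \<phi> \<delta>\<^sub>K"
  shows "finitely_generated_module {f. \<delta>\<^sub>K f = 0} fm_act {u \<in> fm_commutator_ideal. \<delta> u = 0}"
proof -
  from assms(2) obtain M where \<phi>: "Vector_Spaces.linear (*s) (*s) \<phi>" and "\<phi> ^^ M = (\<lambda>_. 0)"
    unfolding nonzero_nilpotent_operator_def by blast
  then have nil: "\<And>v. (\<phi> ^^ M) v = 0" by simp
  obtain f h N where fh: "Vector_Spaces.linear (*s) (*s) f" "Vector_Spaces.linear (*s) (*s) h"
    "\<And>v. \<phi> (f v) = f (\<phi> v) + h v" "\<And>v. h (\<phi> v) = \<phi> (h v) + 2 *s \<phi> v"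
    "\<And>v. h (f v) = f (h v) - 2 *s f v" "\<And>v. (f ^^ N) v = 0"
    "\<And>v. v \<in> vec.span (eigenvectors (*s) h)"
    by (rule nilpotent_sl2_triple[OF \<phi> nil]) blast
  let ?E = "lift_operator \<phi> 0 sx"
  interpret sl2_poly ?E "lift_operator f sy 0" "lift_operator h sx (- sy)" sx sy eval_spin
    by (rule sl2_poly_lift[OF \<phi> fh(1-5) nil fh(6,7)])
  define C where "C = {u \<in> fm_commutator_ideal. \<delta> u = 0}"
  have der: "derivation fm_scale fm_bracket \<delta>" using assms(3) by (simp add: extends_to_fm_def)
  then have \<delta>: "Vector_Spaces.linear fm_scale fm_scale \<delta>" by (simp add: derivation_def)
  note magnus_\<delta> = magnus_derivation[OF assms(3) \<phi>, of _ 0 sx]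
  note transfer = poly_derivation_transfer[OF assms(4) \<phi>]
  note m = linear_simps[OF linear_magnus]
  note co = linear_simps[OF linear_coefficient]
  have sub: "fm.subspace C"
    unfolding C_def by (auto simp: fm.subspace_def fm_commutator_ideal_simps linear_simps[OF \<delta>])
  have act: "fm_act b c \<in> C" if "b \<in> C" "\<delta>\<^sub>K c = 0" for b c
  proof -
    have b: "b \<in> fm_commutator_ideal" "\<delta> b = 0" using that by (auto simp: C_def)
    have "?E (poly_embed c) = 0"
      using that(2) by (simp add: algebra_hom_simps[OF algebra_hom_poly_embed] flip: transfer(2))
    \<comment> \<open>Closure under the action is the Leibniz rule in the large ring, brought back
      by injectivity.\<close>
    then have "magnus (\<delta> (fm_act b c)) = 0"
      by (simp add: magnus_\<delta> magnus_act[OF b(1)] Leibniz m b(2) flip: magnus_\<delta>[of b])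
    then have "\<delta> (fm_act b c) = 0"
      by (intro magnus_injective derivation_fm_commutator_ideal[OF der] fm_act_in_commutator_ideal b)
        (simp add: co)
    then show ?thesis using fm_act_in_commutator_ideal[OF b(1)] by (simp add: C_def)
  qed
  have "magnus ` C \<subseteq> {v. eval_spin v = v \<and> ?E v = 0}"
    by (auto simp: C_def eval_spin_magnus m simp flip: magnus_\<delta>)
  from constants_finitely_generated[OF this] obtain S0 where S0: "S0 \<subseteq> magnus ` C" "finite S0"
    "\<forall>s\<in>magnus ` C. \<exists>c. (\<forall>g\<in>S0. ?E (c g) = 0) \<and> s = (\<Sum>g\<in>S0. c g * g)"
    by (elim exE conjE)
  then obtain B where B: "B \<subseteq> C" "finite B" "S0 = magnus ` B" by (meson finite_subset_image)
  have inj: "inj_on magnus B"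
  proof (rule inj_onI)
    fix u v assume uv: "u \<in> B" "v \<in> B" "magnus u = magnus v"
    then have "u - v \<in> C" using sub B(1) fm.subspace_diff by blast
    then have "u - v = 0" by (intro magnus_injective) (simp_all add: C_def m uv(3) co)
    then show "u = v" by simp
  qed
  have "C = {\<Sum>b\<in>B. fm_act b (c b) | c. \<forall>b\<in>B. c b \<in> {f. \<delta>\<^sub>K f = 0}}" (is "_ = ?R")
  proof
    show "?R \<subseteq> C"
      using act B(1) by (auto intro!: fm.subspace_sum[OF sub])
    show "C \<subseteq> ?R"
    proof
      fix u assume u: "u \<in> C"
      then obtain c where c: "\<And>g. g \<in> S0 \<Longrightarrow> ?E (c g) = 0" "magnus u = (\<Sum>g\<in>S0. c g * g)"
        using S0(3) by blast
      \<comment> \<open>As \<open>magnus b\<close> has no term free of \<open>z\<close>, only the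
        part of a coefficient that is free of \<open>z\<close> affects the comparison of linear
        parts.\<close>
      define d where "d b = retract (c (magnus b))" for b
      have d: "\<delta>\<^sub>K (d b) = 0" if "b \<in> B" for b
        using c(1) that B(3) by (simp add: d_def algebra_hom_simps[OF algebra_hom_retract] flip: transfer(1))
      define w where "w = (\<Sum>b\<in>B. fm_act b (d b))"
      have "w \<in> C" unfolding w_def using act d B(1) by (intro fm.subspace_sum[OF sub]) auto
      have mem: "b \<in> fm_commutator_ideal" if "b \<in> B" for b using that B(1) by (auto simp: C_def)
      have "coefficient k (magnus u) = (\<Sum>b\<in>B. d b * coefficient k (magnus b))" for k
        unfolding c(2) B(3) sum.reindex[OF inj]
        by (simp add: co coefficient_mult retract_magnus d_def)
      moreover have "coefficient k (magnus w) = (\<Sum>b\<in>B. coefficient k (magnus b) * d b)" for k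
        by (simp add: w_def m co magnus_act mem coefficient_mult cong: sum.cong)
      ultimately have "coefficient k (magnus (u - w)) = 0" for k
        by (simp add: m co mult.commute)
      moreover have "u - w \<in> fm_commutator_ideal"
        using fm.subspace_diff[OF sub u \<open>w \<in> C\<close>] by (simp add: C_def)
      ultimately have "u - w = 0" by (intro magnus_injective)
      then show "u \<in> ?R" using d by (auto simp: w_def)
    qed
  qed
  then show ?thesis
    unfolding finitely_generated_module_def C_def[symmetric] using B(1,2) by blast
qed

end
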